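(* Let $\Omega=(-1,1)\times(-1,1)\subset\mathbb{R}^2$ be the square of sidelength $2$, and let $\lambda_n(\alpha)$ denote the $n$-th eigenvalue of the fractional Laplacian $(-\Delta)^{\alpha/2}$ on $\Omega$. The fractional P\'olya conjecture fails on $\Omega$ for some values of $\alpha$: there exists $\alpha\in(0,2)$ for which it is not true that $$\lambda_n(\alpha)\ge (n\pi)^{\alpha/2}\qquad\text{for all } n=1,2,3,\ldots .$$
   Context: For $u\in L^2(\mathbb{R}^d)$ the Fourier transform is $\widehat{u}(\xi)=(2\pi)^{-d/2}\int_{\mathbb{R}^d}u(x)e^{-ix\cdot\xi}\,dx$. For $\alpha>0$, the fractional Laplacian $(-\Delta)^{\alpha/2}$ is the Fourier multiplier operator given by $\big((-\Delta)^{\alpha/2}u\big)\widehat{\ }(\xi)=|\xi|^\alpha\widehat{u}(\xi)$. For a bounded domain $\Omega\subset\mathbb{R}^d$, set $$H^{\alpha/2}_0(\Omega)=\{u\in H^{\alpha/2}(\mathbb{R}^d): u=0 \text{ a.e. on } \mathbb{R}^d\setminus\Omega\}.$$ The operator $(-\Delta)^{\alpha/2}$ on $\Omega$ is understood with this Dirichlet (exterior) condition; it has discrete spectrum with weak eigenfunctions in $H^{\alpha/2}_0(\Omega)$. Its eigenvalues, in nondecreasing order and counted with multiplicity, are $\lambda_1(\alpha)\le\lambda_2(\alpha)\le\cdots$, and they are characterized by $$\lambda_n(\alpha)=\min_{S}\max\Big\{\int_{\mathbb{R}^d}|\xi|^\alpha|\widehat{u}(\xi)|^2\,d\xi : u\in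 S,\ \int_{\mathbb{R}^d}|u|^2\,dx=1\Big\},$$ where $S$ ranges over all $n$-dimensional subspaces of $H^{\alpha/2}_0(\Omega)$. The fractional P\'olya conjecture for a bounded domain $\Omega\subset\mathbb{R}^d$ of volume $V$ is the assertion that $\lambda_n(\alpha)\ge(nC_d/V)^{\alpha/d}$ for all $n\ge1$, where $C_d=(2\pi)^d/\omega_d$ and $\omega_d$ is the volume of the unit ball in $\mathbb{R}^d$. Here $d=2$, $C_2=4\pi$ and $V=4$, so the right side is $(n\pi)^{\alpha/2}$. *)

theory Defs
  imports "HOL-Analysis.Analysis"
begin

text \<open>Elements of \<open>L\<^sup>2\<close> are represented by Borel functions; identities between them are
  required almost everywhere.\<close>

definition square_integrable :: "('a::euclidean_space \<Rightarrow> complex) \<Rightarrow> bool" where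
  "square_integrable u \<longleftrightarrow>
     u \<in> borel_measurable lborel \<and> integrable lborel (\<lambda>x. (norm (u x))\<^sup>2)"

definition fourier_integral :: "('a::euclidean_space \<Rightarrow> complex) \<Rightarrow> 'a \<Rightarrow> complex" where
  "fourier_integral u \<xi> =
     of_real ((2 * pi) powr (- real DIM('a) / 2)) *
     (LINT x|lborel. u x * exp (- \<i> * of_real (x \<bullet> \<xi>)))"

text \<open>The integral need not converge for \<open>u \<in> L\<^sup>2\<close>; as usual, the transform is then the
  \<open>L\<^sup>2\<close> limit of the transforms of the truncations of \<open>u\<close> to balls, which determines it up
  to null sets. The distance is a \<open>nn_integral\<close> so that convergence to 0 cannot come from the
  default value of the Bochner integral.\<close>

definition is_fourier_transform ::
    "('a::euclidean_space \<Rightarrow> complex) \<Rightarrow> ('a \<Rightarrow> complex) \<Rightarrow> bool" where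
  "is_fourier_transform u v \<longleftrightarrow>
     square_integrable v \<and>
     ((\<lambda>R::real. \<integral>\<^sup>+\<xi>. ennreal ((norm (fourier_integral
          (\<lambda>x. indicator (ball 0 R) x * u x) \<xi> - v \<xi>))\<^sup>2) \<partial>lborel) \<longlongrightarrow> 0) at_top"

definition fourier :: "('a::euclidean_space \<Rightarrow> complex) \<Rightarrow> 'a \<Rightarrow> complex" where
  "fourier u = (SOME v. is_fourier_transform u v)"

definition sobolev :: "real \<Rightarrow> ('a::euclidean_space \<Rightarrow> complex) set" where
  "sobolev s = {u. square_integrable u \<and>
     integrable lborel (\<lambda>\<xi>. (1 + (norm \<xi>)\<^sup>2) powr s * (norm (fourier u \<xi>))\<^sup>2)}"

definition sobolev0 :: "real \<Rightarrow> 'a::euclidean_space set \<Rightarrow> ('a \<Rightarrow> complex) set" where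
  "sobolev0 s \<Omega> = {u \<in> sobolev s. AE x in lborel. x \<notin> \<Omega> \<longrightarrow> u x = 0}"

text \<open>The weak form of \<open>(-\<Delta>)\<^bsup>\<alpha>/2\<^esup>\<close>: its symbol \<open>\<bar>\<xi>\<bar>\<^bsup>\<alpha>\<^esup>\<close> is paired with the test function on
  the Fourier side.\<close>

definition frac_laplacian_form ::
    "real \<Rightarrow> ('a::euclidean_space \<Rightarrow> complex) \<Rightarrow> ('a \<Rightarrow> complex) \<Rightarrow> complex" where
  "frac_laplacian_form \<alpha> u v =
     (LINT \<xi>|lborel. of_real (norm \<xi> powr \<alpha>) * fourier u \<xi> * cnj (fourier v \<xi>))"

definition frac_laplacian_eigenfunction ::
    "'a::euclidean_space set \<Rightarrow> real \<Rightarrow> real \<Rightarrow> ('a \<Rightarrow> complex) \<Rightarrow> bool" where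
  "frac_laplacian_eigenfunction \<Omega> \<alpha> \<mu> u \<longleftrightarrow>
     u \<in> sobolev0 (\<alpha> / 2) \<Omega> \<and> \<not> (AE x in lborel. u x = 0) \<and>
     (\<forall>v \<in> sobolev0 (\<alpha> / 2) \<Omega>.
        frac_laplacian_form \<alpha> u v = of_real \<mu> * (LINT x|lborel. u x * cnj (v x)))"

definition lin_indep_ae :: "nat \<Rightarrow> (nat \<Rightarrow> 'a::euclidean_space \<Rightarrow> complex) \<Rightarrow> bool" where
  "lin_indep_ae n u \<longleftrightarrow>
     (\<forall>c. (AE x in lborel. (\<Sum>i<n. c i * u i x) = 0) \<longrightarrow> (\<forall>i<n. c i = 0))"

text \<open>The \<open>n\<close>-th eigenvalue (\<open>n \<ge> 1\<close>), in nondecreasing order and counted with multiplicity, is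
  the least \<open>\<mu>\<close> such that the eigenspaces for eigenvalues \<open>\<le> \<mu>\<close> contain \<open>n\<close> linearly independent
  eigenfunctions. For bounded \<open>\<Omega>\<close> the spectrum is discrete, so the infimum is attained.\<close>

definition frac_laplacian_eigenvalue :: "'a::euclidean_space set \<Rightarrow> real \<Rightarrow> nat \<Rightarrow> real" where
  "frac_laplacian_eigenvalue \<Omega> \<alpha> n =
     Inf {\<mu>. \<exists>u \<nu>. (\<forall>i<n. frac_laplacian_eigenfunction \<Omega> \<alpha> (\<nu> i) (u i) \<and> \<nu> i \<le> \<mu>) \<and>
                  lin_indep_ae n u}"

end

theory Submission
  imports Defs "HOL-Probability.Characteristic_Functions" "HOL-Complex_Analysis.Great_Picard"
begin

text \<open>For \<open>n = 1\<close> the conjectured bound on the square reads \<open>\<lambda>\<^sub>1(\<alpha>) \<ge> \<pi>\<^bsup>\<alpha>/2\<^esup>\<close>. Both sides tend to \<open>1\<close> as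
  \<open>\<alpha> \<rightarrow> 0\<close>, so small \<open>\<alpha>\<close> are decided by the first-order terms. For a trial function \<open>u\<close> of unit norm
  let \<open>E\<close> be the mean over the frequency \<open>\<xi>\<close> whose probability density is the squared modulus of
  the Fourier transform of \<open>u\<close>. With
  \<open>\<alpha> = 2 s\<close> the quotient \<open>(E \<bar>\<xi>\<bar>\<^bsup>2s\<^esup> - 1) / s\<close> tends to \<open>E ln \<bar>\<xi>\<bar>\<^sup>2\<close>, whereas \<open>(\<pi>\<^sup>s - 1) / s\<close> tends to \<open>ln \<pi>\<close>.
  Hence the bound fails for some small \<open>\<alpha>\<close> as soon as one \<open>u\<close> has \<open>E ln \<bar>\<xi>\<bar>\<^sup>2 < ln \<pi>\<close>
  (\<open>exists_small_power\<close>).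

  The trial function is \<open>u(x, y) = (1 - x\<^sup>2) (1 - y\<^sup>2)\<close>. Under \<open>E\<close> the two frequencies are independent
  with a common law of second moment \<open>5/2\<close>. The concave logarithm lies below its tangent at any point, and
  the tangent point \<open>(1 + \<xi>\<^sub>1\<^sup>2) (1 + \<xi>\<^sub>2\<^sup>2) / 2\<close> reduces the estimate to one-dimensional means
  (\<open>ln_sum_squares_le\<close>). The remaining \<open>E ln (1 + \<xi>\<^sub>1\<^sup>2)\<close> is bounded by a rational function that touches
  the logarithm to third order (\<open>ln_le_radau\<close>), whose mean involves only the second moment and
  \<open>E 1 / (9/4 + \<xi>\<^sub>1\<^sup>2)\<close>. The latter is bounded below variationally by integrals of polynomials
  (\<open>resolvent_lower_bound\<close>). The outcome is \<open>E ln \<bar>\<xi>\<bar>\<^sup>2 \<le> ln (25/8) < ln \<pi>\<close> (\<open>trial_energy\<close>).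

  The eigenvalue is defined through eigenfunctions in the form domain, so it has to be shown that
  the lowest one is at most the Rayleigh quotient of any trial function (\<open>first_eigenvalue_le\<close>). This is
  the direct method of the calculus of variations: the compactness lemma \<open>rellich\<close> provides a minimizer
  (\<open>ground_state_exists\<close>), and the Euler--Lagrange equation makes it an eigenfunction
  (\<open>ground_state_eigenfunction\<close>). It rests on the Plancherel identity, which is proved by Gaussian
  regularization. All functions in the form domain vanish outside a bounded set, and for these the
  transform defined as an \<open>L\<^sup>2\<close> limit is the Fourier integral (\<open>fourier_eq_fourier_integral\<close>).\<close>

section \<open>Gaussian integrals on Euclidean space\<close>

lemma lborel_integral_affine:
  fixes f :: "'a::euclidean_space \<Rightarrow> 'b::{banach, second_countable_topology}" and c :: real
  assumes "c \<noteq> 0" and [measurable]: "f \<in> borel_measurable borel"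
  shows "(LINT x|lborel. f x) = \<bar>c\<bar> ^ DIM('a) *\<^sub>R (LINT x|lborel. f (t + c *\<^sub>R x))"
  by (subst lborel_affine[OF assms(1), of t])
     (simp add: integral_density integral_distr)

lemma integrable_lborel_affine:
  fixes f :: "'a::euclidean_space \<Rightarrow> 'b::{banach, second_countable_topology}" and c :: real
  assumes "c \<noteq> 0" "integrable lborel f"
  shows "integrable lborel (\<lambda>x. f (t + c *\<^sub>R x))"
proof -
  have [measurable]: "f \<in> borel_measurable borel"
    using assms(2) by auto
  have "integrable lborel (\<lambda>x. \<bar>c\<bar> ^ DIM('a) *\<^sub>R f (t + c *\<^sub>R x))"
    using assms by (subst (asm) lborel_affine[OF assms(1), of t])
      (simp add: integrable_density integrable_distr_eq)
  then have "integrable lborel (\<lambda>x. (1 / \<bar>c\<bar> ^ DIM('a)) *\<^sub>R (\<bar>c\<bar> ^ DIM('a) *\<^sub>R f (t + c *\<^sub>R x)))"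
    by (rule integrable_scaleR_right)
  then show ?thesis
    using assms(1) by simp
qed

lemma
  fixes f :: "'a::euclidean_space \<Rightarrow> real \<Rightarrow> complex"
  assumes f: "\<And>b. b \<in> Basis \<Longrightarrow> integrable lborel (f b)"
  shows lborel_integral_prod: "(LINT x|lborel. (\<Prod>b\<in>Basis. f b (x \<bullet> b))) = (\<Prod>b\<in>Basis. (LINT t|lborel. f b t))"
    and integrable_lborel_prod: "integrable lborel (\<lambda>x. (\<Prod>b\<in>Basis. f b (x \<bullet> b)))"
proof -
  interpret product_sigma_finite "\<lambda>_::'a. lborel :: real measure" ..
  have [measurable]: "b \<in> Basis \<Longrightarrow> f b \<in> borel_measurable borel" for b
    using f[of b] by auto
  have m [measurable]: "(\<lambda>x. \<Prod>b\<in>Basis. f b (x \<bullet> b)) \<in> borel_measurable borel"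
    by (rule borel_measurable_prod) measurable
  have eq: "(\<Prod>b\<in>Basis. f b ((\<Sum>b\<in>Basis. g b *\<^sub>R b) \<bullet> b)) = (\<Prod>b\<in>Basis. f b (g b))" for g :: "'a \<Rightarrow> real"
    by (intro prod.cong refl) (simp add: inner_sum_left inner_Basis if_distrib cong: if_cong)
  show "(LINT x|lborel. (\<Prod>b\<in>Basis. f b (x \<bullet> b))) = (\<Prod>b\<in>Basis. (LINT t|lborel. f b t))"
    by (subst lborel_eq, subst integral_distr) (simp_all add: eq product_integral_prod f)
  show "integrable lborel (\<lambda>x. (\<Prod>b\<in>Basis. f b (x \<bullet> b)))"
    by (subst lborel_eq, subst integrable_distr_eq)
       (simp_all add: eq product_integrable_prod f)
qed

lemma sum_inner_Basis_square: "(\<Sum>b\<in>Basis. (x \<bullet> b)\<^sup>2) = (norm (x::'a::euclidean_space))\<^sup>2"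
  unfolding power2_norm_eq_inner[of x] using euclidean_inner[of x x] by (simp only: power2_eq_square)

definition gauss :: "'a::euclidean_space \<Rightarrow> real" where
  "gauss x = (\<Prod>b\<in>Basis. std_normal_density (x \<bullet> b))"

text \<open>The product form gives the Fourier transform coordinate by coordinate; this closed form shows that
  \<open>gauss\<close> is, up to a constant, its own transform.\<close>

lemma gauss_eq: "gauss (x::'a::euclidean_space) = (2 * pi) powr (- real DIM('a) / 2) * exp (- (norm x)\<^sup>2 / 2)"
proof -
  have "gauss x = (\<Prod>b::'a\<in>Basis. 1 / sqrt (2 * pi)) * (\<Prod>b\<in>Basis. exp (- (x \<bullet> b)\<^sup>2 / 2))"
    unfolding gauss_def std_normal_density_def by (rule prod.distrib)
  also have "(\<Prod>b\<in>Basis. exp (- (x \<bullet> b)\<^sup>2 / 2)) = exp (- (norm x)\<^sup>2 / 2)"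
    by (simp add: exp_sum[symmetric] sum_negf sum_divide_distrib[symmetric] sum_inner_Basis_square)
  also have "(\<Prod>b::'a\<in>Basis. 1 / sqrt (2 * pi)) = (2 * pi) powr (- real DIM('a) / 2)"
  proof -
    have "(2 * pi) powr (- (1/2)) = inverse ((2 * pi) powr (1/2))"
      by (rule powr_minus)
    also have "\<dots> = 1 / sqrt (2 * pi)"
      by (subst powr_half_sqrt) (auto simp only: inverse_eq_divide pi_ge_zero mult_nonneg_nonneg zero_le_numeral)
    finally have "(\<Prod>b::'a\<in>Basis. 1 / sqrt (2 * pi)) = ((2 * pi) powr (- (1/2))) ^ DIM('a)"
      by (simp only: prod_constant)
    also have "\<dots> = (2 * pi) powr (- (1/2) * real DIM('a))"
      by (subst powr_realpow[symmetric]) (use pi_gt_zero in \<open>simp_all add: powr_powr\<close>)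
    finally show ?thesis by (simp only: minus_mult_left[symmetric] mult_minus_left) simp
  qed
  finally show ?thesis .
qed

lemma gauss_pos: "gauss x > 0" by (simp add: gauss_eq)

lemma gauss_measurable [measurable]: "gauss \<in> borel_measurable borel"
  unfolding gauss_def[abs_def] by measurable

lemma
  fixes x :: "'a::euclidean_space"
  shows gauss_ft: "(LINT \<xi>|lborel. gauss \<xi> * exp (\<i> * of_real (x \<bullet> \<xi>))) = of_real (exp (- (norm x)\<^sup>2 / 2))" (is ?A)
    and integrable_gauss: "integrable lborel (gauss :: 'a \<Rightarrow> real)" (is ?B)
    and integral_gauss: "(LINT \<xi>|lborel. gauss (\<xi>::'a)) = 1" (is ?C)
proof -
  define f where "f x b t = of_real (std_normal_density t) * exp (\<i> * of_real ((x \<bullet> b) * t))" for x b :: 'a and t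
  have [measurable]: "f x b \<in> borel_measurable borel" for x b
    unfolding f_def by measurable
  have int: "integrable lborel (f x b)" for x b
    by (rule Bochner_Integration.integrable_bound[of _ "std_normal_density"])
       (simp_all add: f_def[of x b] norm_mult abs_of_nonneg)
  have f: "(LINT t|lborel. f x b t) = of_real (exp (- (x \<bullet> b)\<^sup>2 / 2))" for x b
  proof -
    have "(LINT t|lborel. f x b t) = char std_normal_distribution (x \<bullet> b)"
      unfolding char_def f_def
      by (subst integral_density) (auto simp: scaleR_conv_of_real ac_simps)
    then show ?thesis by (simp add: char_std_normal_distribution)
  qed
  have eq: "(\<Prod>b\<in>Basis. f x b (\<xi> \<bullet> b)) = gauss \<xi> * exp (\<i> * of_real (x \<bullet> \<xi>))" for x \<xi> :: 'a
    unfolding f_def gauss_def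
    by (simp add: prod.distrib exp_sum[symmetric] sum_distrib_left euclidean_inner[of x \<xi>])
  have A: "(LINT \<xi>|lborel. gauss \<xi> * exp (\<i> * of_real (x \<bullet> \<xi>))) = of_real (exp (- (norm x)\<^sup>2 / 2))" for x :: 'a
  proof -
    have "(LINT \<xi>|lborel. gauss \<xi> * exp (\<i> * of_real (x \<bullet> \<xi>))) = (\<Prod>b\<in>Basis. of_real (exp (- (x \<bullet> b)\<^sup>2 / 2)))"
      using lborel_integral_prod[of "f x", OF int] by (simp add: eq f)
    also have "\<dots> = of_real (exp (- (norm x)\<^sup>2 / 2))"
      by (simp add: exp_sum[symmetric] sum_negf sum_divide_distrib[symmetric] sum_inner_Basis_square
        of_real_prod[symmetric] del: of_real_prod)
    finally show ?thesis .
  qed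
  then show ?A .
  have "integrable lborel (\<lambda>\<xi>::'a. complex_of_real (gauss \<xi>))"
    using integrable_lborel_prod[of "f 0", OF int] by (simp add: eq)
  then show ?B by (simp add: complex_of_real_integrable_eq)
  have "complex_of_real (LINT \<xi>|lborel. gauss (\<xi>::'a)) = 1"
    using A[of 0] by (simp flip: integral_complex_of_real)
  then show ?C by simp
qed

section \<open>Square-integrable functions\<close>

lemma norm_add_sq_le: "(norm (a + b))\<^sup>2 \<le> 2 * (norm (a::complex))\<^sup>2 + 2 * (norm b)\<^sup>2"
proof -
  have "(norm (a + b))\<^sup>2 \<le> (norm a + norm b)\<^sup>2"
    by (intro power_mono norm_triangle_ineq) auto
  also have "\<dots> \<le> 2 * (norm a)\<^sup>2 + 2 * (norm b)\<^sup>2"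
    using sum_squares_bound[of "norm a" "norm b"] by (simp add: power2_sum)
  finally show ?thesis .
qed

lemma norm_diff_sq_le: "(norm (a - b))\<^sup>2 \<le> 2 * (norm (a::complex))\<^sup>2 + 2 * (norm b)\<^sup>2"
  using norm_add_sq_le[of a "- b"] by simp

lemma norm_mult_le_sum_sq: "norm (a * b) \<le> (norm (a::complex))\<^sup>2 + (norm b)\<^sup>2"
proof -
  have "0 \<le> norm a * norm b" by simp
  then show ?thesis
    unfolding norm_mult using sum_squares_bound[of "norm a" "norm b"] by (simp only: mult.assoc)
qed

lemma borel_measurable_cnj [measurable]:
  "f \<in> borel_measurable M \<Longrightarrow> (\<lambda>x. cnj (f x)) \<in> borel_measurable M"
  by (rule measurable_compose[OF _ borel_measurable_continuous_onI]) (auto intro!: continuous_intros)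

lemma integrable_indicator_ball [simp]: "integrable lborel (indicator (ball c r :: 'a::euclidean_space set) :: 'a \<Rightarrow> real)"
  by (simp add: integrable_indicator_iff emeasure_lborel_ball_finite[unfolded infinity_ennreal_def])

lemma square_integrableD:
  assumes "square_integrable u"
  shows square_integrable_measurable: "u \<in> borel_measurable borel"
    and square_integrable_norm_sq: "integrable lborel (\<lambda>x. (norm (u x))\<^sup>2)"
  using assms by (auto simp: square_integrable_def)

lemma square_integrable_add:
  assumes u: "square_integrable u" and v: "square_integrable v"
  shows "square_integrable (\<lambda>x. u x + v x)"
proof -
  note [measurable] = square_integrable_measurable[OF u] square_integrable_measurable[OF v]
  have "integrable lborel (\<lambda>x. 2 * (norm (u x))\<^sup>2 + 2 * (norm (v x))\<^sup>2)"
    using u v by (intro Bochner_Integration.integrable_add integrable_mult_right square_integrable_norm_sq)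
  then have "integrable lborel (\<lambda>x. (norm (u x + v x))\<^sup>2)"
    by (rule Bochner_Integration.integrable_bound) (auto intro: order_trans[OF norm_add_sq_le])
  then show ?thesis by (simp add: square_integrable_def)
qed

lemma square_integrable_cmult:
  assumes u: "square_integrable u"
  shows "square_integrable (\<lambda>x. c * u x)"
proof -
  note [measurable] = square_integrable_measurable[OF u]
  show ?thesis
    using square_integrable_norm_sq[OF u] by (simp add: square_integrable_def norm_mult power_mult_distrib)
qed

lemma square_integrable_diff:
  assumes "square_integrable u" "square_integrable v"
  shows "square_integrable (\<lambda>x. u x - v x)"
  using square_integrable_add[OF assms(1) square_integrable_cmult[OF assms(2), of "-1"]] by simp

lemma square_integrable_mult_cnj:
  assumes u: "square_integrable u" and v: "square_integrable v"
  shows "integrable lborel (\<lambda>x. u x * cnj (v x))"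
proof -
  note [measurable] = square_integrable_measurable[OF u] square_integrable_measurable[OF v]
  have "integrable lborel (\<lambda>x. (norm (u x))\<^sup>2 + (norm (v x))\<^sup>2)"
    using u v by (intro Bochner_Integration.integrable_add square_integrable_norm_sq)
  then show ?thesis
  proof (rule Bochner_Integration.integrable_bound)
    show "AE x in lborel. norm (u x * cnj (v x)) \<le> norm ((norm (u x))\<^sup>2 + (norm (v x))\<^sup>2)"
      using norm_mult_le_sum_sq[of "u _" "cnj (v _)"] by auto
  qed simp
qed

lemma square_integrable_shift:
  assumes u: "square_integrable u"
  shows "square_integrable (\<lambda>x. u (x + z))"
    and "(LINT x|lborel. (norm (u (x + z)))\<^sup>2) = (LINT x|lborel. (norm (u x))\<^sup>2)"
proof -
  note [measurable] = square_integrable_measurable[OF u]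
  show "square_integrable (\<lambda>x. u (x + z))"
    using integrable_lborel_affine[OF _ square_integrable_norm_sq[OF u], of 1 z]
    by (simp add: square_integrable_def add.commute)
  show "(LINT x|lborel. (norm (u (x + z)))\<^sup>2) = (LINT x|lborel. (norm (u x))\<^sup>2)"
    by (subst lborel_integral_affine[of 1 "\<lambda>x. (norm (u x))\<^sup>2" z]) (simp_all add: add.commute)
qed

lemma bounded_support_integrable:
  assumes "square_integrable u" and "AE x in lborel. x \<notin> ball 0 R \<longrightarrow> u x = 0"
  shows "integrable lborel u"
proof -
  note [measurable] = square_integrable_measurable[OF assms(1)]
  have "integrable lborel (\<lambda>x. (norm (u x))\<^sup>2 + indicator (ball 0 R) x)"
    using assms by (intro Bochner_Integration.integrable_add square_integrable_norm_sq integrable_indicator_ball)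
  then show ?thesis
  proof (rule Bochner_Integration.integrable_bound)
    show "AE x in lborel. norm (u x) \<le> norm ((norm (u x))\<^sup>2 + indicator (ball 0 R) x :: real)"
      using assms(2)
    proof eventually_elim
      case (elim x)
      have "norm (u x) \<le> (norm (u x))\<^sup>2 + 1"
        using sum_squares_bound[of "norm (u x)" 1] by (simp, smt (verit) norm_ge_zero)
      with elim show ?case by (cases "x \<in> ball 0 R") (auto simp: indicator_def)
    qed
  qed simp
qed

section \<open>Continuity of translation in \<open>L\<^sup>2\<close>\<close>

text \<open>The squared \<open>L\<^sup>2\<close> modulus of continuity. It is exactly what the Gaussian regularization of the
  Plancherel identity loses, see \<open>fourier_regularized\<close>.\<close>

definition shift_defect :: "('a::euclidean_space \<Rightarrow> complex) \<Rightarrow> 'a \<Rightarrow> real" where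
  "shift_defect u z = (LINT x|lborel. (norm (u (x + z) - u x))\<^sup>2)"

lemma shift_defect_bound:
  assumes u: "square_integrable u" and g: "square_integrable g"
  shows "shift_defect u z \<le> 2 * shift_defect g z + 8 * (LINT x|lborel. (norm (u x - g x))\<^sup>2)"
proof -
  let ?d = "\<lambda>x. u x - g x"
  note d = square_integrable_diff[OF u g]
  have i1: "integrable lborel (\<lambda>x. (norm (g (x + z) - g x))\<^sup>2)"
    by (intro square_integrable_norm_sq square_integrable_diff square_integrable_shift g)
  have i2: "integrable lborel (\<lambda>x. (norm (?d (x + z)))\<^sup>2)"
    by (intro square_integrable_norm_sq square_integrable_shift(1)[OF d])
  have i3: "integrable lborel (\<lambda>x. (norm (?d x))\<^sup>2)"
    by (intro square_integrable_norm_sq d)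
  have "shift_defect u z \<le> (LINT x|lborel. 2 * (norm (g (x + z) - g x))\<^sup>2 + (4 * (norm (?d (x + z)))\<^sup>2 + 4 * (norm (?d x))\<^sup>2))"
    unfolding shift_defect_def
  proof (rule integral_mono)
    show "integrable lborel (\<lambda>x. (norm (u (x + z) - u x))\<^sup>2)"
      by (intro square_integrable_norm_sq square_integrable_diff square_integrable_shift u)
    show "integrable lborel (\<lambda>x. 2 * (norm (g (x + z) - g x))\<^sup>2 + (4 * (norm (?d (x + z)))\<^sup>2 + 4 * (norm (?d x))\<^sup>2))"
      by (intro Bochner_Integration.integrable_add integrable_mult_right i1 i2 i3)
    fix x
    have eq: "u (x + z) - u x = (g (x + z) - g x) + (?d (x + z) - ?d x)" by simp
    show "(norm (u (x + z) - u x))\<^sup>2 \<le> 2 * (norm (g (x + z) - g x))\<^sup>2 + (4 * (norm (?d (x + z)))\<^sup>2 + 4 * (norm (?d x))\<^sup>2)"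
      using norm_add_sq_le[of "g (x + z) - g x" "?d (x + z) - ?d x"] norm_diff_sq_le[of "?d (x + z)" "?d x"]
      unfolding eq[symmetric] by linarith
  qed
  also have "\<dots> = 2 * shift_defect g z + (4 * (LINT x|lborel. (norm (?d (x + z)))\<^sup>2) + 4 * (LINT x|lborel. (norm (?d x))\<^sup>2))"
    unfolding shift_defect_def using i1 i2 i3 by simp
  finally show ?thesis
    using square_integrable_shift(2)[OF d, of z] by simp
qed

lemma shift_defect_le:
  assumes u: "square_integrable u"
  shows "shift_defect u z \<le> 4 * (LINT x|lborel. (norm (u x))\<^sup>2)"
proof -
  note us = square_integrable_shift[OF u, of z]
  have "shift_defect u z \<le> (LINT x|lborel. 2 * (norm (u (x + z)))\<^sup>2 + 2 * (norm (u x))\<^sup>2)"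
    unfolding shift_defect_def
    by (intro integral_mono Bochner_Integration.integrable_add integrable_mult_right square_integrable_norm_sq
        square_integrable_diff us u norm_diff_sq_le)
  also have "\<dots> = 4 * (LINT x|lborel. (norm (u x))\<^sup>2)"
    using square_integrable_norm_sq[OF us(1)] square_integrable_norm_sq[OF u] us(2) by simp
  finally show ?thesis .
qed

lemma shift_defect_nonneg: "shift_defect u z \<ge> 0"
  by (simp add: shift_defect_def)

lemma compact_support_square_integrable:
  fixes g :: "'a::euclidean_space \<Rightarrow> complex"
  assumes [measurable]: "g \<in> borel_measurable borel" and M: "\<And>x. norm (g x) \<le> M" and R: "\<And>x. x \<notin> ball 0 R \<Longrightarrow> g x = 0"
  shows "square_integrable g"
proof -
  have "integrable lborel (\<lambda>x. M\<^sup>2 * indicator (ball 0 R :: 'a set) x)"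
    by simp
  then have "integrable lborel (\<lambda>x. (norm (g x))\<^sup>2)"
  proof (rule Bochner_Integration.integrable_bound)
    show "AE x in lborel. norm ((norm (g x))\<^sup>2) \<le> norm (M\<^sup>2 * indicator (ball 0 R) x :: real)"
    proof (rule AE_I2)
      fix x :: 'a
      have "(norm (g x))\<^sup>2 \<le> M\<^sup>2" by (intro power_mono M) auto
      then show "norm ((norm (g x))\<^sup>2) \<le> norm (M\<^sup>2 * indicator (ball 0 R) x :: real)"
        using R[of x] by (cases "x \<in> ball 0 R") (auto simp: indicator_def)
    qed
  qed simp
  then show ?thesis by (simp add: square_integrable_def)
qed

text \<open>For compactly supported continuous functions dominated convergence applies; density extends the
  result to \<open>L\<^sup>2\<close>.\<close>

lemma shift_defect_tendsto_continuous:
  fixes g :: "'a::euclidean_space \<Rightarrow> complex"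
  assumes cont: "continuous_on UNIV g" and M: "\<And>x. norm (g x) \<le> M" and R: "\<And>x. x \<notin> ball 0 R \<Longrightarrow> g x = 0"
    and z: "z \<longlonglongrightarrow> 0"
  shows "(\<lambda>n. shift_defect g (z n)) \<longlonglongrightarrow> 0"
proof -
  have [measurable]: "g \<in> borel_measurable borel"
    using cont by (rule borel_measurable_continuous_onI)
  have bdd: "bounded (range z)"
    using z convergent_imp_bounded by blast
  then obtain Z where Z: "\<And>n. norm (z n) \<le> Z"
    by (auto simp: bounded_iff)
  let ?w = "\<lambda>x. (2 * M)\<^sup>2 * indicator (ball 0 (R + Z) :: 'a set) x :: real"
  have "(\<lambda>n. LINT x|lborel. (norm (g (x + z n) - g x))\<^sup>2) \<longlonglongrightarrow> (LINT x|(lborel::'a measure). (0 :: real))"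
  proof (rule integral_dominated_convergence[where w = ?w])
    show "integrable lborel ?w"
      by simp
    show "AE x in lborel. (\<lambda>n. (norm (g (x + z n) - g x))\<^sup>2) \<longlonglongrightarrow> 0"
    proof (rule AE_I2)
      fix x
      have "(\<lambda>n. x + z n) \<longlonglongrightarrow> x + 0" by (intro tendsto_intros z)
      then have "(\<lambda>n. g (x + z n)) \<longlonglongrightarrow> g x"
        using cont by (intro isCont_tendsto_compose[of _ g]) (auto simp: continuous_on_eq_continuous_at)
      then have "(\<lambda>n. (norm (g (x + z n) - g x))\<^sup>2) \<longlonglongrightarrow> (norm (g x - g x))\<^sup>2"
        by (intro tendsto_intros)
      then show "(\<lambda>n. (norm (g (x + z n) - g x))\<^sup>2) \<longlonglongrightarrow> 0" by simp
    qed
    show "AE x in lborel. norm ((norm (g (x + z n) - g x))\<^sup>2) \<le> ?w x" for n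
    proof (rule AE_I2)
      fix x
      have 1: "norm (g (x + z n) - g x) \<le> 2 * M"
        using norm_triangle_ineq4[of "g (x + z n)" "g x"] M[of x] M[of "x + z n"] by linarith
      then have 2: "(norm (g (x + z n) - g x))\<^sup>2 \<le> (2 * M)\<^sup>2" by (intro power_mono) auto
      have 3: "g (x + z n) = 0" "g x = 0" if "x \<notin> ball 0 (R + Z)"
      proof -
        have "norm x \<ge> R + Z" using that by auto
        moreover have "norm x \<le> norm (x + z n) + norm (z n)"
          using norm_triangle_ineq4[of "x + z n" "z n"] by simp
        ultimately show "g (x + z n) = 0" "g x = 0"
          using Z[of n] norm_ge_zero[of "z n"] by (auto intro!: R simp del: norm_ge_zero)
      qed
      show "norm ((norm (g (x + z n) - g x))\<^sup>2) \<le> ?w x"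
        using 2 3 by (cases "x \<in> ball 0 (R + Z)") (auto simp: indicator_def)
    qed
  qed simp_all
  then show ?thesis by (simp add: shift_defect_def)
qed

definition clamp_norm :: "real \<Rightarrow> complex \<Rightarrow> complex" where
  "clamp_norm M z = of_real (M / max M (norm z)) * z"

lemma clamp_norm_le: "M > 0 \<Longrightarrow> norm (clamp_norm M z) \<le> M" "M > 0 \<Longrightarrow> norm (clamp_norm M z) \<le> norm z"
  and clamp_norm_id: "M > 0 \<Longrightarrow> norm z \<le> M \<Longrightarrow> clamp_norm M z = z"
  and clamp_norm_continuous: "M > 0 \<Longrightarrow> continuous_on UNIV (clamp_norm M)"
proof -
  assume M: "M > 0"
  have "norm (clamp_norm M z) = M * (norm z / max M (norm z))"
    using M by (simp add: clamp_norm_def norm_mult norm_divide)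
  moreover have "norm z / max M (norm z) \<le> 1" using M by (simp add: divide_le_eq max_def)
  ultimately show "norm (clamp_norm M z) \<le> M" using M mult_left_mono[of _ 1 M] by (simp only: mult_1_right)
  have "norm (clamp_norm M z) = (M / max M (norm z)) * norm z"
    using M by (simp add: clamp_norm_def norm_mult norm_divide)
  also have "\<dots> \<le> 1 * norm z" using M by (intro mult_right_mono) (auto simp: divide_le_eq max_def)
  finally show "norm (clamp_norm M z) \<le> norm z" by simp
  show "norm z \<le> M \<Longrightarrow> clamp_norm M z = z" using M by (simp add: clamp_norm_def)
  have "max M (norm z) \<noteq> 0" for z :: complex using M by (auto simp: max_def)
  then show "continuous_on UNIV (clamp_norm M)"
    unfolding clamp_norm_def by (intro continuous_intros) auto
qed

definition cutoff :: "real \<Rightarrow> 'a::euclidean_space \<Rightarrow> real" where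
  "cutoff R x = max 0 (min 1 (R - norm x))"

lemma cutoff_bounds: "0 \<le> cutoff R x" "cutoff R x \<le> 1"
  and cutoff_outside: "x \<notin> ball 0 R \<Longrightarrow> cutoff R x = 0"
  and cutoff_inside: "norm x \<le> R - 1 \<Longrightarrow> cutoff R x = 1"
  and cutoff_continuous: "continuous_on UNIV (cutoff R)"
  by (auto simp: cutoff_def intro!: continuous_intros)

text \<open>Truncation is built from continuous factors, so that it maps continuous functions to continuous
  functions.\<close>

definition truncation :: "nat \<Rightarrow> ('a::euclidean_space \<Rightarrow> complex) \<Rightarrow> 'a \<Rightarrow> complex" where
  "truncation n u x = of_real (cutoff (Suc n) x) * clamp_norm (Suc n) (u x)"

lemma truncation_measurable:
  assumes [measurable]: "u \<in> borel_measurable borel"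
  shows "truncation n u \<in> borel_measurable borel"
proof -
  have [measurable]: "cutoff (real (Suc n)) \<in> borel_measurable borel"
    by (intro borel_measurable_continuous_onI cutoff_continuous)
  have [measurable]: "clamp_norm (real (Suc n)) \<in> borel_measurable borel"
    by (intro borel_measurable_continuous_onI clamp_norm_continuous) simp
  show ?thesis unfolding truncation_def[abs_def] by measurable
qed

lemma truncation_le: "norm (truncation n u x) \<le> Suc n" "norm (truncation n u x) \<le> norm (u x)"
proof -
  have *: "norm (truncation n u x) \<le> 1 * norm (clamp_norm (Suc n) (u x))"
    unfolding truncation_def norm_mult
    by (intro mult_right_mono) (auto simp: cutoff_bounds)
  show "norm (truncation n u x) \<le> Suc n" "norm (truncation n u x) \<le> norm (u x)"
    using * clamp_norm_le[of "Suc n" "u x"] by (auto intro: order_trans)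
qed

lemma truncation_outside: "x \<notin> ball 0 (Suc n) \<Longrightarrow> truncation n u x = 0"
  unfolding truncation_def by (subst cutoff_outside) auto

lemma truncation_continuous:
  assumes "continuous_on UNIV u"
  shows "continuous_on UNIV (truncation n u)"
  unfolding truncation_def
  by (intro continuous_intros cutoff_continuous continuous_on_compose2[OF clamp_norm_continuous assms]) auto

lemma truncation_tendsto: "(\<lambda>n. truncation n u x) \<longlonglongrightarrow> u x"
proof (rule tendsto_eventually, rule eventually_mono)
  show "eventually (\<lambda>n. n \<ge> nat \<lceil>norm x\<rceil> + nat \<lceil>norm (u x)\<rceil>) sequentially"
    by (rule eventually_ge_at_top)
  fix n assume n: "n \<ge> nat \<lceil>norm x\<rceil> + nat \<lceil>norm (u x)\<rceil>"
  have "norm x \<le> n" "norm (u x) \<le> n" using n by linarith+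
  then show "truncation n u x = u x"
    unfolding truncation_def by (subst cutoff_inside, simp, subst clamp_norm_id) auto
qed

lemma truncation_tendsto_L2:
  assumes u: "square_integrable u"
  shows "(\<lambda>n. LINT x|lborel. (norm (u x - truncation n u x))\<^sup>2) \<longlonglongrightarrow> 0"
proof -
  note [measurable] = square_integrable_measurable[OF u] truncation_measurable[OF square_integrable_measurable[OF u]]
  have "(\<lambda>n. LINT x|lborel. (norm (u x - truncation n u x))\<^sup>2) \<longlonglongrightarrow> (LINT x|(lborel::'a measure). (0::real))"
  proof (rule integral_dominated_convergence[where w = "\<lambda>x. 4 * (norm (u x))\<^sup>2"])
    show "integrable lborel (\<lambda>x. 4 * (norm (u x))\<^sup>2)"
      using square_integrable_norm_sq[OF u] by simp
    show "AE x in lborel. (\<lambda>n. (norm (u x - truncation n u x))\<^sup>2) \<longlonglongrightarrow> 0"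
    proof (rule AE_I2)
      fix x
      have "(\<lambda>n. (norm (u x - truncation n u x))\<^sup>2) \<longlonglongrightarrow> (norm (u x - u x))\<^sup>2"
        by (intro tendsto_intros truncation_tendsto)
      then show "(\<lambda>n. (norm (u x - truncation n u x))\<^sup>2) \<longlonglongrightarrow> 0" by simp
    qed
    show "AE x in lborel. norm ((norm (u x - truncation n u x))\<^sup>2) \<le> 4 * (norm (u x))\<^sup>2" for n
    proof (rule AE_I2)
      fix x
      have "(norm (truncation n u x))\<^sup>2 \<le> (norm (u x))\<^sup>2"
        by (intro power_mono truncation_le) auto
      then show "norm ((norm (u x - truncation n u x))\<^sup>2) \<le> 4 * (norm (u x))\<^sup>2"
        using norm_diff_sq_le[of "u x" "truncation n u x"] by (simp only: real_norm_def abs_power2 abs_of_nonneg zero_le_power2)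
    qed
  qed measurable
  then show ?thesis by simp
qed

text \<open>A Borel function is almost everywhere the limit of continuous functions, without any domination.
  Truncating the function first and then the approximants supplies the dominating function.\<close>

lemma continuous_dense_L2:
  fixes u :: "'a::euclidean_space \<Rightarrow> complex"
  assumes u: "square_integrable u" and e: "e > 0"
  obtains g M R where "continuous_on UNIV g" "\<And>x. norm (g x) \<le> M" "\<And>x. x \<notin> ball 0 R \<Longrightarrow> g x = 0"
    "(LINT x|lborel. (norm (u x - g x))\<^sup>2) < e"
proof -
  note [measurable] = square_integrable_measurable[OF u] truncation_measurable[OF square_integrable_measurable[OF u]]
  have "eventually (\<lambda>n. (LINT x|lborel. (norm (u x - truncation n u x))\<^sup>2) < e / 4) sequentially"
    using order_tendstoD(2)[OF truncation_tendsto_L2[OF u], of "e/4"] e by simp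
  then obtain n where n: "(LINT x|lborel. (norm (u x - truncation n u x))\<^sup>2) < e / 4"
    by (auto simp: eventually_sequentially)
  have "u measurable_on UNIV"
    by (rule lebesgue_measurable_imp_measurable_on)
       (auto intro: measurable_completion)
  then obtain N G where N: "negligible N" and G: "\<And>k. continuous_on UNIV (G k)"
    and lim: "\<And>x. x \<notin> N \<Longrightarrow> (\<lambda>k. G k x) \<longlonglongrightarrow> u x"
    unfolding measurable_on_def by auto
  have "AE x in lebesgue. x \<notin> N"
    using N by (auto simp: negligible_iff_null_sets intro!: AE_I'[of N])
  then have AEN: "AE x in lborel. x \<notin> N"
    by (simp add: AE_completion_iff)
  define t where "t k = truncation n (G k)" for k
  have t_cont: "continuous_on UNIV (t k)" for k
    unfolding t_def by (rule truncation_continuous[OF G])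
  have [measurable]: "t k \<in> borel_measurable borel" for k
    by (intro borel_measurable_continuous_onI t_cont)
  let ?w = "\<lambda>x. (2 * real (Suc n))\<^sup>2 * indicator (ball 0 (Suc n) :: 'a set) x :: real"
  have "(\<lambda>k. LINT x|lborel. (norm (truncation n u x - t k x))\<^sup>2) \<longlonglongrightarrow> (LINT x|(lborel::'a measure). (0::real))"
  proof (rule integral_dominated_convergence[where w = ?w])
    show "integrable lborel ?w"
      by simp
    show "AE x in lborel. (\<lambda>k. (norm (truncation n u x - t k x))\<^sup>2) \<longlonglongrightarrow> 0"
      using AEN
    proof eventually_elim
      case (elim x)
      have "(\<lambda>k. clamp_norm (Suc n) (G k x)) \<longlonglongrightarrow> clamp_norm (Suc n) (u x)"
        using clamp_norm_continuous[of "Suc n"] lim[OF elim]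
        by (intro isCont_tendsto_compose[of _ "clamp_norm (Suc n)"]) (auto simp: continuous_on_eq_continuous_at)
      then have "(\<lambda>k. (norm (truncation n u x - t k x))\<^sup>2) \<longlonglongrightarrow> (norm (truncation n u x - truncation n u x))\<^sup>2"
        unfolding t_def truncation_def by (intro tendsto_intros)
      then show ?case by simp
    qed
    show "AE x in lborel. norm ((norm (truncation n u x - t k x))\<^sup>2) \<le> ?w x" for k
    proof (rule AE_I2)
      fix x
      have "norm (truncation n u x - t k x) \<le> 2 * Suc n"
        using norm_triangle_ineq4[of "truncation n u x" "t k x"] truncation_le(1)[of n u x] truncation_le(1)[of n "G k" x]
        by (simp add: t_def)
      then have "(norm (truncation n u x - t k x))\<^sup>2 \<le> (2 * real (Suc n))\<^sup>2" by (intro power_mono) auto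
      then show "norm ((norm (truncation n u x - t k x))\<^sup>2) \<le> ?w x"
        using truncation_outside[of x n]
        by (cases "x \<in> ball 0 (Suc n)") (auto simp: indicator_def t_def simp del: of_nat_Suc)
    qed
  qed measurable
  then have "eventually (\<lambda>k. (LINT x|lborel. (norm (truncation n u x - t k x))\<^sup>2) < e / 4) sequentially"
    using order_tendstoD(2)[of _ 0 _ "e/4"] e by simp
  then obtain k where k: "(LINT x|lborel. (norm (truncation n u x - t k x))\<^sup>2) < e / 4"
    by (auto simp: eventually_sequentially)
  have tb: "norm (t k x) \<le> Suc n" and ts: "x \<notin> ball 0 (Suc n) \<Longrightarrow> t k x = 0" for x
    unfolding t_def by (rule truncation_le truncation_outside; assumption?)+
  have st: "square_integrable (t k)" and su: "square_integrable (truncation n u)"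
    by (rule compact_support_square_integrable[OF _ tb ts]; simp)
       (rule compact_support_square_integrable[OF _ truncation_le(1) truncation_outside]; simp)
  have i: "integrable lborel (\<lambda>x. (norm (u x - truncation n u x))\<^sup>2)"
       "integrable lborel (\<lambda>x. (norm (truncation n u x - t k x))\<^sup>2)"
    by (intro square_integrable_norm_sq square_integrable_diff u su st)+
  have "(LINT x|lborel. (norm (u x - t k x))\<^sup>2) \<le> (LINT x|lborel. 2 * (norm (u x - truncation n u x))\<^sup>2 + 2 * (norm (truncation n u x - t k x))\<^sup>2)"
  proof (rule integral_mono)
    show "integrable lborel (\<lambda>x. (norm (u x - t k x))\<^sup>2)"
      by (intro square_integrable_norm_sq square_integrable_diff u st)
    show "(norm (u x - t k x))\<^sup>2 \<le> 2 * (norm (u x - truncation n u x))\<^sup>2 + 2 * (norm (truncation n u x - t k x))\<^sup>2" for x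
      using norm_add_sq_le[of "u x - truncation n u x" "truncation n u x - t k x"] by simp
  qed (use i in simp)
  also have "\<dots> < e" using i n k by simp
  finally show thesis
    using that[OF t_cont tb ts] by blast
qed

lemma shift_defect_tendsto:
  assumes u: "square_integrable u" and z: "z \<longlonglongrightarrow> 0"
  shows "(\<lambda>n. shift_defect u (z n)) \<longlonglongrightarrow> 0"
proof (rule LIMSEQ_I)
  fix r :: real assume r: "r > 0"
  obtain g M R where g: "continuous_on UNIV g" "\<And>x. norm (g x) \<le> M" "\<And>x. x \<notin> ball 0 R \<Longrightarrow> g x = 0"
    and close: "(LINT x|lborel. (norm (u x - g x))\<^sup>2) < r / 16"
    using continuous_dense_L2[OF u, of "r/16"] r by auto
  have sg: "square_integrable g"
    by (rule compact_support_square_integrable[OF borel_measurable_continuous_onI g(2,3)]) (use g(1) in auto)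
  have "eventually (\<lambda>n. shift_defect g (z n) < r / 4) sequentially"
    by (rule order_tendstoD(2)[OF shift_defect_tendsto_continuous[OF g z]]) (use r in simp_all)
  then obtain n0 where n0: "\<And>n. n \<ge> n0 \<Longrightarrow> shift_defect g (z n) < r / 4"
    by (auto simp: eventually_sequentially)
  show "\<exists>no. \<forall>n\<ge>no. norm (shift_defect u (z n) - 0) < r"
  proof (intro exI allI impI)
    fix n assume "n \<ge> n0"
    then show "norm (shift_defect u (z n) - 0) < r"
      using shift_defect_bound[OF u sg, of "z n"] n0[of n] close shift_defect_nonneg[of u "z n"] by simp
  qed
qed

section \<open>The Plancherel identity\<close>

lemma integrable_pair_bound:
  fixes f :: "'a::euclidean_space \<times> 'b::euclidean_space \<Rightarrow> complex" and g :: "'a \<Rightarrow> real" and h :: "'b \<Rightarrow> real"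
  assumes [measurable]: "f \<in> borel_measurable (lborel \<Otimes>\<^sub>M lborel)"
    and g: "integrable lborel g" and h: "integrable lborel h"
    and le: "\<And>x y. norm (f (x, y)) \<le> g x * h y"
  shows "integrable (lborel \<Otimes>\<^sub>M lborel) f"
proof (rule lborel_pair.Fubini_integrable)
  have f: "integrable lborel (\<lambda>y. f (x, y))" for x
    by (rule Bochner_Integration.integrable_bound[OF integrable_mult_right[OF h, of "g x"]])
       (auto intro!: AE_I2 order_trans[OF le])
  show "AE x in lborel. integrable lborel (\<lambda>y. f (x, y))"
    using f by simp
  show "integrable lborel (\<lambda>x. LINT y|lborel. norm (f (x, y)))"
  proof (rule Bochner_Integration.integrable_bound[OF integrable_mult_left[OF g, of "LINT y|lborel. h y"]])
    show "AE x in lborel. norm (LINT y|lborel. norm (f (x, y))) \<le> norm (g x * (LINT y|lborel. h y))"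
    proof (rule AE_I2)
      fix x
      have "(LINT y|lborel. norm (f (x, y))) \<le> (LINT y|lborel. g x * h y)"
        using f h le by (intro integral_mono) auto
      then show "norm (LINT y|lborel. norm (f (x, y))) \<le> norm (g x * (LINT y|lborel. h y))"
        by simp
    qed
  qed measurable
qed measurable

lemma fourier_integral_measurable [measurable]:
  assumes [measurable]: "u \<in> borel_measurable borel"
  shows "fourier_integral u \<in> borel_measurable borel"
  unfolding fourier_integral_def[abs_def] by measurable

lemma fourier_integrand_integrable:
  fixes u :: "'a::euclidean_space \<Rightarrow> complex"
  assumes "integrable lborel u"
  shows "integrable lborel (\<lambda>x. u x * exp (- \<i> * of_real (x \<bullet> \<xi>)))"
proof -
  have [measurable]: "u \<in> borel_measurable borel" using assms by auto
  show ?thesis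
    by (rule Bochner_Integration.integrable_bound[OF assms]) (auto simp: norm_mult)
qed

lemma fourier_integral_bound:
  fixes u :: "'a::euclidean_space \<Rightarrow> complex"
  assumes "integrable lborel u"
  shows "norm (fourier_integral u \<xi>) \<le> (2 * pi) powr (- real DIM('a) / 2) * (LINT x|lborel. norm (u x))"
proof -
  have "norm (LINT x|lborel. u x * exp (- \<i> * of_real (x \<bullet> \<xi>))) \<le> (LINT x|lborel. norm (u x * exp (- \<i> * of_real (x \<bullet> \<xi>))))"
    by (rule integral_norm_bound)
  also have "\<dots> = (LINT x|lborel. norm (u x))"
    by (simp add: norm_mult)
  finally show ?thesis
    unfolding fourier_integral_def norm_mult by (simp add: mult_left_mono)
qed

lemma scaled_gauss_ft:
  fixes z :: "'a::euclidean_space"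
  assumes d: "d > 0"
  shows "integrable lborel (\<lambda>\<xi>::'a. exp (- (d * norm \<xi>)\<^sup>2 / 2))"
    and "(LINT \<xi>|lborel. of_real (exp (- (d * norm \<xi>)\<^sup>2 / 2)) * exp (\<i> * of_real (z \<bullet> \<xi>))) =
      of_real ((1 / d) ^ DIM('a) * gauss (z /\<^sub>R d) / ((2 * pi) powr (- real DIM('a) / 2))\<^sup>2)"
proof -
  define c where "c = (2 * pi) powr (- real DIM('a) / 2)"
  have c: "c > 0" by (simp add: c_def)
  have e: "exp (- (norm x)\<^sup>2 / 2) = gauss x / c" for x :: 'a
    unfolding gauss_eq c_def by simp
  have "integrable lborel (\<lambda>\<xi>::'a. gauss (0 + d *\<^sub>R \<xi>) / c)"
    using integrable_lborel_affine[OF _ integrable_gauss, of d 0] d by (intro integrable_divide) simp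
  then show "integrable lborel (\<lambda>\<xi>::'a. exp (- (d * norm \<xi>)\<^sup>2 / 2))"
    using d by (simp add: e[symmetric])
  have "(LINT \<xi>|lborel. of_real (exp (- (d * norm \<xi>)\<^sup>2 / 2)) * exp (\<i> * of_real (z \<bullet> \<xi>)))
     = \<bar>1 / d\<bar> ^ DIM('a) *\<^sub>R (LINT \<eta>|lborel. of_real (exp (- (d * norm (0 + (1/d) *\<^sub>R \<eta>))\<^sup>2 / 2)) * exp (\<i> * of_real (z \<bullet> (0 + (1/d) *\<^sub>R \<eta>))))"
    using d by (intro lborel_integral_affine) auto
  also have "(\<lambda>\<eta>. of_real (exp (- (d * norm (0 + (1/d) *\<^sub>R \<eta>))\<^sup>2 / 2)) * exp (\<i> * of_real (z \<bullet> (0 + (1/d) *\<^sub>R \<eta>))))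
     = (\<lambda>\<eta>. (of_real (1 / c) :: complex) * (of_real (gauss \<eta>) * exp (\<i> * of_real ((z /\<^sub>R d) \<bullet> \<eta>))))"
  proof
    fix \<eta> :: 'a
    have 1: "d * norm (0 + (1/d) *\<^sub>R \<eta>) = norm \<eta>" using d by simp
    have 2: "z \<bullet> (0 + (1/d) *\<^sub>R \<eta>) = (z /\<^sub>R d) \<bullet> \<eta>" by (simp add: inverse_eq_divide)
    show "of_real (exp (- (d * norm (0 + (1/d) *\<^sub>R \<eta>))\<^sup>2 / 2)) * exp (\<i> * of_real (z \<bullet> (0 + (1/d) *\<^sub>R \<eta>)))
      = (of_real (1 / c) :: complex) * (of_real (gauss \<eta>) * exp (\<i> * of_real ((z /\<^sub>R d) \<bullet> \<eta>)))"
      unfolding 1 2 e by simp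
  qed
  also have "(LINT \<eta>|lborel. (of_real (1 / c) :: complex) * (of_real (gauss \<eta>) * exp (\<i> * of_real ((z /\<^sub>R d) \<bullet> \<eta>))))
     = of_real (1 / c) * of_real (gauss (z /\<^sub>R d) / c)"
    by (simp only: integral_mult_right_zero gauss_ft e)
  finally show "(LINT \<xi>|lborel. of_real (exp (- (d * norm \<xi>)\<^sup>2 / 2)) * exp (\<i> * of_real (z \<bullet> \<xi>))) =
      of_real ((1 / d) ^ DIM('a) * gauss (z /\<^sub>R d) / ((2 * pi) powr (- real DIM('a) / 2))\<^sup>2)"
    unfolding c_def[symmetric] using d by (simp add: power2_eq_square scaleR_conv_of_real)
qed

text \<open>The parallelogram law turns the autocorrelation at \<open>z\<close> into the translation defect.\<close>

lemma Re_correlation: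
  assumes u: "square_integrable u"
  shows "Re (LINT x|lborel. u x * cnj (u (x + z))) = (LINT x|lborel. (norm (u x))\<^sup>2) - shift_defect u z / 2"
proof -
  note us = square_integrable_shift[OF u, of z]
  have i: "integrable lborel (\<lambda>x. u x * cnj (u (x + z)))"
    by (rule square_integrable_mult_cnj[OF u us(1)])
  have "shift_defect u z = (LINT x|lborel. (norm (u (x + z)))\<^sup>2 + (norm (u x))\<^sup>2 - 2 * Re (u x * cnj (u (x + z))))"
    unfolding shift_defect_def
    by (intro Bochner_Integration.integral_cong refl)
       (simp only: cmod_power2, simp add: power2_eq_square algebra_simps)
  also have "\<dots> = (LINT x|lborel. (norm (u (x + z)))\<^sup>2) + (LINT x|lborel. (norm (u x))\<^sup>2) - 2 * Re (LINT x|lborel. u x * cnj (u (x + z)))"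
    using i square_integrable_norm_sq[OF us(1)] square_integrable_norm_sq[OF u]
    by (simp del: times_complex.sel)
  finally show ?thesis using us(2) by (simp add: field_simps)
qed

text \<open>With a Gaussian weight the frequency integral converges absolutely, so that Fubini exchanges it with
  the two space integrals. The weight turns into a narrow Gaussian in \<open>x - y\<close>, and what remains is a
  Gaussian average of autocorrelations of \<open>u\<close> at small shifts.\<close>

lemma fourier_regularized:
  fixes u :: "'a::euclidean_space \<Rightarrow> complex"
  assumes i: "integrable lborel u" and u: "square_integrable u" and d: "d > 0"
  shows "integrable lborel (\<lambda>\<xi>. exp (- (d * norm \<xi>)\<^sup>2 / 2) * (norm (fourier_integral u \<xi>))\<^sup>2)"
    and "(LINT \<xi>|lborel. exp (- (d * norm \<xi>)\<^sup>2 / 2) * (norm (fourier_integral u \<xi>))\<^sup>2) =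
      (LINT x|lborel. (norm (u x))\<^sup>2) - (LINT w|lborel. gauss w * shift_defect u (d *\<^sub>R w)) / 2"
    and "integrable lborel (\<lambda>w. gauss w * shift_defect u (d *\<^sub>R w))"
proof -
  define c where "c = (2 * pi) powr (- real DIM('a) / 2)"
  have c: "c > 0" by (simp add: c_def)
  define E where "E \<xi> = exp (- (d * norm \<xi>)\<^sup>2 / 2)" for \<xi> :: 'a
  have E: "integrable lborel E" "\<And>\<xi>. E \<xi> > 0"
    using scaled_gauss_ft(1)[OF d] by (auto simp: E_def[abs_def])
  define e where "e x \<xi> = exp (- \<i> * of_real (x \<bullet> \<xi>))" for x \<xi> :: 'a
  have ne: "norm (e x \<xi>) = 1" for x \<xi> by (simp add: e_def)
  let ?F = "fourier_integral u"
  have F: "?F \<xi> = of_real c * (LINT x|lborel. u x * e x \<xi>)" for \<xi>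
    by (simp add: fourier_integral_def c_def e_def)
  define B where "B = c * (LINT x|lborel. norm (u x))"
  have B: "norm (?F \<xi>) \<le> B" for \<xi>
    using fourier_integral_bound[OF i] by (simp add: B_def c_def)
  have B0: "B \<ge> 0" using order_trans[OF norm_ge_zero B] .
  note [measurable] = square_integrable_measurable[OF u]
  have [measurable]: "E \<in> borel_measurable borel" unfolding E_def[abs_def] by measurable
  have [measurable]: "case_prod e \<in> borel_measurable (borel \<Otimes>\<^sub>M borel)"
    unfolding e_def[abs_def] by measurable
  have [measurable]: "(\<lambda>p. e (f p) (g p)) \<in> borel_measurable M" if "f \<in> borel_measurable M" "g \<in> borel_measurable M" for f g and M :: "'b measure"
    unfolding e_def using that by measurable
  have "integrable lborel (\<lambda>\<xi>. B\<^sup>2 * E \<xi>)" using E(1) by simp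
  then show I1: "integrable lborel (\<lambda>\<xi>. exp (- (d * norm \<xi>)\<^sup>2 / 2) * (norm (?F \<xi>))\<^sup>2)"
    unfolding E_def[symmetric]
  proof (rule Bochner_Integration.integrable_bound)
    show "AE \<xi> in lborel. norm (E \<xi> * (norm (?F \<xi>))\<^sup>2) \<le> norm (B\<^sup>2 * E \<xi>)"
      using E(2) by (intro AE_I2) (simp add: abs_mult mult.commute mult_right_mono power_mono[OF B] less_imp_le)
  qed measurable
  have "(LINT \<xi>|lborel. of_real (E \<xi>) * (?F \<xi> * cnj (?F \<xi>))) =
     (LINT \<xi>|lborel. (LINT x|lborel. (of_real c * of_real (E \<xi>) * cnj (?F \<xi>)) * (u x * e x \<xi>)))"
    by (subst integral_mult_right_zero) (simp add: F mult_ac)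
  also have "\<dots> = (LINT x|lborel. (LINT \<xi>|lborel. (of_real c * of_real (E \<xi>) * cnj (?F \<xi>)) * (u x * e x \<xi>)))"
  proof (rule lborel_pair.Fubini_integral, rule integrable_pair_bound)
    show "(\<lambda>(x, \<xi>). (of_real c * of_real (E \<xi>) * cnj (?F \<xi>)) * (u x * e x \<xi>)) \<in> borel_measurable (lborel \<Otimes>\<^sub>M lborel)"
      unfolding e_def by measurable
    show "integrable lborel (\<lambda>x. norm (u x))" "integrable lborel (\<lambda>\<xi>. (c * B) * E \<xi>)"
      using i E(1) by auto
    fix x \<xi>
    have "norm ((of_real c * of_real (E \<xi>) * cnj (?F \<xi>)) * (u x * e x \<xi>)) = norm (u x) * (c * E \<xi> * norm (?F \<xi>))"
      using c E(2)[of \<xi>] by (simp add: norm_mult ne mult_ac)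
    also have "\<dots> \<le> norm (u x) * (c * E \<xi> * B)"
      using c E(2)[of \<xi>] B[of \<xi>] by (intro mult_left_mono) auto
    finally show "norm (case (x, \<xi>) of (x, \<xi>) \<Rightarrow> (of_real c * of_real (E \<xi>) * cnj (?F \<xi>)) * (u x * e x \<xi>)) \<le> norm (u x) * ((c * B) * E \<xi>)"
      by (simp add: mult_ac)
  qed
  also have "\<dots> = (LINT x|lborel. u x * (LINT w|lborel. of_real (gauss w) * cnj (u (x + d *\<^sub>R w))))"
  proof (intro Bochner_Integration.integral_cong refl)
    fix x
    have "(LINT \<xi>|lborel. (of_real c * of_real (E \<xi>) * cnj (?F \<xi>)) * (u x * e x \<xi>)) =
       u x * (of_real (c * c) * (LINT \<xi>|lborel. (LINT y|lborel. (of_real (E \<xi>) * e x \<xi>) * (cnj (u y) * cnj (e y \<xi>)))))"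
    proof -
      have "(LINT y|lborel. (of_real (E \<xi>) * e x \<xi>) * (cnj (u y) * cnj (e y \<xi>))) = (of_real (E \<xi>) * e x \<xi>) * cnj (LINT y|lborel. u y * e y \<xi>)" for \<xi>
        by (subst integral_mult_right_zero) (simp flip: Bochner_Integration.integral_cnj)
      then show ?thesis
        by (simp only: F integral_mult_right_zero[symmetric]) (simp add: mult_ac)
    qed
    also have "(LINT \<xi>|lborel. (LINT y|lborel. (of_real (E \<xi>) * e x \<xi>) * (cnj (u y) * cnj (e y \<xi>)))) =
       (LINT y|lborel. (LINT \<xi>|lborel. (of_real (E \<xi>) * e x \<xi>) * (cnj (u y) * cnj (e y \<xi>))))"
    proof (rule lborel_pair.Fubini_integral, rule integrable_pair_bound)
      show "(\<lambda>(y, \<xi>). (of_real (E \<xi>) * e x \<xi>) * (cnj (u y) * cnj (e y \<xi>))) \<in> borel_measurable (lborel \<Otimes>\<^sub>M lborel)"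
        unfolding e_def by measurable
      show "integrable lborel (\<lambda>y. norm (u y))" "integrable lborel E"
        using i E(1) by auto
      show "norm (case (y, \<xi>) of (y, \<xi>) \<Rightarrow> (of_real (E \<xi>) * e x \<xi>) * (cnj (u y) * cnj (e y \<xi>))) \<le> norm (u y) * E \<xi>" for y \<xi>
        using E(2)[of \<xi>] by (simp add: norm_mult ne)
    qed
    also have "\<dots> = (LINT y|lborel. cnj (u y) * of_real ((1 / d) ^ DIM('a) * gauss ((y - x) /\<^sub>R d) / c\<^sup>2))"
    proof (intro Bochner_Integration.integral_cong refl)
      fix y
      have "e x \<xi> * cnj (e y \<xi>) = exp (\<i> * of_real ((y - x) \<bullet> \<xi>))" for \<xi>
        unfolding e_def by (simp add: exp_cnj exp_add[symmetric] inner_diff_left algebra_simps)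
      then have "(LINT \<xi>|lborel. (of_real (E \<xi>) * e x \<xi>) * (cnj (u y) * cnj (e y \<xi>))) =
         (LINT \<xi>|lborel. cnj (u y) * (of_real (E \<xi>) * exp (\<i> * of_real ((y - x) \<bullet> \<xi>))))"
        by (intro Bochner_Integration.integral_cong refl) (metis (no_types, opaque_lifting) mult.assoc mult.left_commute)
      also have "\<dots> = cnj (u y) * of_real ((1 / d) ^ DIM('a) * gauss ((y - x) /\<^sub>R d) / c\<^sup>2)"
        unfolding c_def by (subst integral_mult_right_zero, unfold E_def, subst scaled_gauss_ft(2)[OF d], rule refl)
      finally show "(LINT \<xi>|lborel. (of_real (E \<xi>) * e x \<xi>) * (cnj (u y) * cnj (e y \<xi>))) = \<dots>" .
    qed
    also have "\<dots> = \<bar>d\<bar> ^ DIM('a) *\<^sub>R (LINT w|lborel. cnj (u (x + d *\<^sub>R w)) * of_real ((1 / d) ^ DIM('a) * gauss (((x + d *\<^sub>R w) - x) /\<^sub>R d) / c\<^sup>2))"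
      using d by (intro lborel_integral_affine) auto
    also have "\<dots> = of_real (1 / (c * c)) * (LINT w|lborel. of_real (gauss w) * cnj (u (x + d *\<^sub>R w)))"
    proof -
      have "cnj (u (x + d *\<^sub>R w)) * of_real ((1 / d) ^ DIM('a) * gauss (((x + d *\<^sub>R w) - x) /\<^sub>R d) / c\<^sup>2) =
        of_real ((1 / d) ^ DIM('a) / (c * c)) * (of_real (gauss w) * cnj (u (x + d *\<^sub>R w)))" for w
        using d by (simp add: power2_eq_square)
      then show ?thesis
        using d by (simp only: integral_mult_right_zero) (simp add: scaleR_conv_of_real power_divide)
    qed
    finally show "(LINT \<xi>|lborel. (of_real c * of_real (E \<xi>) * cnj (?F \<xi>)) * (u x * e x \<xi>)) =
       u x * (LINT w|lborel. of_real (gauss w) * cnj (u (x + d *\<^sub>R w)))"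
      using c by simp
  qed
  also have "\<dots> = (LINT x|lborel. (LINT w|lborel. of_real (gauss w) * (u x * cnj (u (x + d *\<^sub>R w)))))"
    by (simp only: integral_mult_right_zero[symmetric]) (simp add: mult_ac)
  finally have L1: "(LINT \<xi>|lborel. of_real (E \<xi>) * (?F \<xi> * cnj (?F \<xi>))) =
     (LINT x|lborel. (LINT w|lborel. of_real (gauss w) * (u x * cnj (u (x + d *\<^sub>R w)))))" .
  define N where "N = (LINT x|lborel. (norm (u x))\<^sup>2)"
  have N0: "N \<ge> 0" by (simp add: N_def)
  define K where "K = (\<lambda>(w, x). complex_of_real (gauss w) * (u x * cnj (u (x + d *\<^sub>R w))))"
  have [measurable]: "K \<in> borel_measurable (lborel \<Otimes>\<^sub>M lborel)"
    unfolding K_def by measurable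
  have c1: "integrable lborel (\<lambda>x. u x * cnj (u (x + z)))" for z
    by (intro square_integrable_mult_cnj u square_integrable_shift(1)[OF u])
  have K: "integrable (lborel \<Otimes>\<^sub>M lborel) K"
  proof (rule lborel_pair.Fubini_integrable)
    show "AE w in lborel. integrable lborel (\<lambda>x. K (w, x))"
      using c1 by (auto simp: K_def)
    show "integrable lborel (\<lambda>w. LINT x|lborel. norm (K (w, x)))"
    proof (rule Bochner_Integration.integrable_bound[OF integrable_mult_left[OF integrable_gauss, of "2 * N"]])
      show "AE w in lborel. norm (LINT x|lborel. norm (K (w, x))) \<le> norm (gauss w * (2 * N))"
      proof (rule AE_I2)
        fix w :: 'a
        have "(LINT x|lborel. norm (u x * cnj (u (x + d *\<^sub>R w)))) \<le> (LINT x|lborel. (norm (u x))\<^sup>2 + (norm (u (x + d *\<^sub>R w)))\<^sup>2)"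
        proof (rule integral_mono)
          show "integrable lborel (\<lambda>x. (norm (u x))\<^sup>2 + (norm (u (x + d *\<^sub>R w)))\<^sup>2)"
            by (intro Bochner_Integration.integrable_add square_integrable_norm_sq u square_integrable_shift(1)[OF u])
          show "norm (u x * cnj (u (x + d *\<^sub>R w))) \<le> (norm (u x))\<^sup>2 + (norm (u (x + d *\<^sub>R w)))\<^sup>2" for x
            using norm_mult_le_sum_sq[of "u x" "cnj (u (x + d *\<^sub>R w))"] by simp
        qed (intro integrable_norm c1)
        also have "\<dots> = 2 * N"
          using square_integrable_norm_sq[OF square_integrable_shift(1)[OF u]] square_integrable_norm_sq[OF u] square_integrable_shift(2)[OF u]
          by (simp add: N_def)
        finally have "gauss w * (LINT x|lborel. norm (u x * cnj (u (x + d *\<^sub>R w)))) \<le> gauss w * (2 * N)"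
          by (intro mult_left_mono) (simp_all add: less_imp_le[OF gauss_pos])
        then show "norm (LINT x|lborel. norm (K (w, x))) \<le> norm (gauss w * (2 * N))"
          unfolding K_def prod.case norm_mult[of "complex_of_real (gauss w)"] integral_mult_right_zero
          using gauss_pos[of w] N0 by (simp add: abs_mult)
      qed
    qed measurable
  qed measurable
  then have K': "integrable (lborel \<Otimes>\<^sub>M lborel) (case_prod (\<lambda>w x. K (w, x)))" by simp
  have "(LINT x|lborel. (LINT w|lborel. K (w, x))) = (LINT w|lborel. (LINT x|lborel. K (w, x)))"
    by (rule lborel_pair.Fubini_integral[OF K'])
  then have L2: "(LINT \<xi>|lborel. of_real (E \<xi>) * (?F \<xi> * cnj (?F \<xi>))) = (LINT w|lborel. (LINT x|lborel. K (w, x)))"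
    using L1 by (simp add: K_def)
  have Kw: "Re (LINT x|lborel. K (w, x)) = gauss w * (N - shift_defect u (d *\<^sub>R w) / 2)" for w
    using Re_correlation[OF u, of "d *\<^sub>R w"] by (simp add: K_def N_def)
  have IK: "integrable lborel (\<lambda>w. LINT x|lborel. K (w, x))"
    by (rule lborel_pair.integrable_fst[OF K'])
  have "integrable lborel (\<lambda>w. Re (LINT x|lborel. K (w, x)))"
    using IK by simp
  then have IG: "integrable lborel (\<lambda>w. gauss w * (N - shift_defect u (d *\<^sub>R w) / 2))"
    by (simp only: Kw)
  have "integrable lborel (\<lambda>w. 2 * (gauss w * N - gauss w * (N - shift_defect u (d *\<^sub>R w) / 2)))"
    by (intro integrable_mult_right Bochner_Integration.integrable_diff integrable_mult_left integrable_gauss IG)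
  then show IS: "integrable lborel (\<lambda>w. gauss w * shift_defect u (d *\<^sub>R w))"
    by (simp add: algebra_simps)
  have "complex_of_real (LINT \<xi>|lborel. E \<xi> * (norm (?F \<xi>))\<^sup>2) = (LINT \<xi>|lborel. of_real (E \<xi>) * (?F \<xi> * cnj (?F \<xi>)))"
    unfolding integral_complex_of_real[symmetric]
    by (intro Bochner_Integration.integral_cong refl) (simp only: of_real_mult complex_norm_square)
  also have "\<dots> = (LINT w|lborel. (LINT x|lborel. K (w, x)))" by (rule L2)
  finally have "complex_of_real (LINT \<xi>|lborel. E \<xi> * (norm (?F \<xi>))\<^sup>2) = (LINT w|lborel. (LINT x|lborel. K (w, x)))" .
  then have "(LINT \<xi>|lborel. E \<xi> * (norm (?F \<xi>))\<^sup>2) = Re (LINT w|lborel. (LINT x|lborel. K (w, x)))"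
    by (metis Re_complex_of_real)
  also have "\<dots> = (LINT w|lborel. gauss w * (N - shift_defect u (d *\<^sub>R w) / 2))"
    by (subst integral_Re[OF IK, symmetric]) (simp only: Kw)
  also have "\<dots> = (LINT w|lborel. gauss w * N - (gauss w * shift_defect u (d *\<^sub>R w)) / 2)"
    by (simp add: algebra_simps)
  also have "\<dots> = N - (LINT w|lborel. gauss w * shift_defect u (d *\<^sub>R w)) / 2"
    by (subst Bochner_Integration.integral_diff[OF integrable_mult_left[OF integrable_gauss] integrable_divide[OF IS]])
       (simp add: integral_gauss)
  finally show "(LINT \<xi>|lborel. exp (- (d * norm \<xi>)\<^sup>2 / 2) * (norm (?F \<xi>))\<^sup>2) =
      (LINT x|lborel. (norm (u x))\<^sup>2) - (LINT w|lborel. gauss w * shift_defect u (d *\<^sub>R w)) / 2"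
    by (simp add: E_def N_def)
qed

text \<open>Letting the Gaussian weight increase to \<open>1\<close>: the left side of \<open>fourier_regularized\<close> converges
  monotonically, while on the right the averaged translation defect vanishes.\<close>

theorem
  fixes u :: "'a::euclidean_space \<Rightarrow> complex"
  assumes i: "integrable lborel u" and u: "square_integrable u"
  shows plancherel_square_integrable: "square_integrable (fourier_integral u)"
    and plancherel: "(LINT \<xi>|lborel. (norm (fourier_integral u \<xi>))\<^sup>2) = (LINT x|lborel. (norm (u x))\<^sup>2)"
proof -
  note [measurable] = square_integrable_measurable[OF u]
  define N where "N = (LINT x|lborel. (norm (u x))\<^sup>2)"
  define d where "d n = 1 / real (Suc n)" for n
  have d: "d n > 0" for n by (simp add: d_def)
  have d0: "d \<longlonglongrightarrow> 0"
    unfolding d_def using LIMSEQ_inverse_real_of_nat by (simp add: inverse_eq_divide)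
  let ?f = "\<lambda>n \<xi>. exp (- (d n * norm \<xi>)\<^sup>2 / 2) * (norm (fourier_integral u \<xi>))\<^sup>2"
  have "(\<lambda>n. LINT w|lborel. gauss w * shift_defect u (d n *\<^sub>R w)) \<longlonglongrightarrow> (LINT w|(lborel :: 'a measure). (0 :: real))"
  proof (rule integral_dominated_convergence[where w = "\<lambda>w. gauss w * (4 * N)"])
    show "integrable lborel (\<lambda>w::'a. gauss w * (4 * N))"
      by (intro integrable_mult_left integrable_gauss)
    show "(\<lambda>w. gauss w * shift_defect u (d n *\<^sub>R w)) \<in> borel_measurable lborel" for n
      using fourier_regularized(3)[OF i u d] by (rule borel_measurable_integrable)
    show "AE w in lborel. (\<lambda>n. gauss w * shift_defect u (d n *\<^sub>R w)) \<longlonglongrightarrow> 0"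
    proof (rule AE_I2)
      fix w :: 'a
      have "(\<lambda>n. d n *\<^sub>R w) \<longlonglongrightarrow> 0 *\<^sub>R w" by (intro tendsto_intros d0)
      then have "(\<lambda>n. gauss w * shift_defect u (d n *\<^sub>R w)) \<longlonglongrightarrow> gauss w * 0"
        by (intro tendsto_intros shift_defect_tendsto[OF u]) simp
      then show "(\<lambda>n. gauss w * shift_defect u (d n *\<^sub>R w)) \<longlonglongrightarrow> 0" by simp
    qed
    show "AE w in lborel. norm (gauss w * shift_defect u (d n *\<^sub>R w)) \<le> gauss w * (4 * N)" for n
      using shift_defect_le[OF u] shift_defect_nonneg[of u]
      by (intro AE_I2) (simp add: abs_mult abs_of_pos[OF gauss_pos] N_def mult_left_mono less_imp_le[OF gauss_pos])
  qed measurable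
  then have "(\<lambda>n. N - (LINT w|lborel. gauss w * shift_defect u (d n *\<^sub>R w)) / 2) \<longlonglongrightarrow> N - 0 / 2"
    by (intro tendsto_intros) simp_all
  then have lim: "(\<lambda>n. LINT \<xi>|lborel. ?f n \<xi>) \<longlonglongrightarrow> N"
    using fourier_regularized(2)[OF i u d] by (simp add: N_def)
  have mono: "AE \<xi> in lborel. mono (\<lambda>n. ?f n \<xi>)"
  proof (rule AE_I2, rule monoI)
    fix \<xi> :: 'a and m n :: nat assume "m \<le> n"
    then have "d n \<le> d m" by (simp add: d_def frac_le)
    then have "(d n * norm \<xi>)\<^sup>2 \<le> (d m * norm \<xi>)\<^sup>2"
      using d[of n] by (intro power_mono mult_right_mono) auto
    then show "?f m \<xi> \<le> ?f n \<xi>" by (intro mult_right_mono) auto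
  qed
  have ptw: "AE \<xi> in lborel. (\<lambda>n. ?f n \<xi>) \<longlonglongrightarrow> (norm (fourier_integral u \<xi>))\<^sup>2"
  proof (rule AE_I2)
    fix \<xi> :: 'a
    have "(\<lambda>n. ?f n \<xi>) \<longlonglongrightarrow> exp (- (0 * norm \<xi>)\<^sup>2 / 2) * (norm (fourier_integral u \<xi>))\<^sup>2"
      by (intro tendsto_intros d0) auto
    then show "(\<lambda>n. ?f n \<xi>) \<longlonglongrightarrow> (norm (fourier_integral u \<xi>))\<^sup>2" by simp
  qed
  have meas: "(\<lambda>\<xi>. (norm (fourier_integral u \<xi>))\<^sup>2) \<in> borel_measurable lborel" by measurable
  note conv = integral_monotone_convergence[OF fourier_regularized(1)[OF i u d] mono ptw lim meas]
    integrable_monotone_convergence[OF fourier_regularized(1)[OF i u d] mono ptw lim meas]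
  show "square_integrable (fourier_integral u)"
    using conv(2) by (simp add: square_integrable_def)
  show "(LINT \<xi>|lborel. (norm (fourier_integral u \<xi>))\<^sup>2) = (LINT x|lborel. (norm (u x))\<^sup>2)"
    using conv(1) by (simp add: N_def)
qed

section \<open>Functions with bounded support\<close>

text \<open>The squared \<open>L\<^sup>2\<close> norm, applied both to functions of position and to their transforms.\<close>

definition mass :: "('a::euclidean_space \<Rightarrow> complex) \<Rightarrow> real" where
  "mass u = (LINT x|lborel. (norm (u x))\<^sup>2)"

lemma mass_nonneg: "mass u \<ge> 0" by (simp add: mass_def)

lemma mass_cmult: "mass (\<lambda>x. c * u x) = (norm c)\<^sup>2 * mass u"
  by (simp add: mass_def norm_mult power_mult_distrib)

lemma mass_add_cmult:
  assumes f: "square_integrable f" and g: "square_integrable g"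
  shows "mass (\<lambda>x. f x + c * g x) = mass f + 2 * Re (cnj c * (LINT x|lborel. f x * cnj (g x))) + (norm c)\<^sup>2 * mass g"
proof -
  have i: "integrable lborel (\<lambda>x. cnj c * (f x * cnj (g x)))"
    by (intro integrable_mult_right square_integrable_mult_cnj f g)
  have "mass (\<lambda>x. f x + c * g x) = (LINT x|lborel. (norm (f x))\<^sup>2 + 2 * Re (cnj c * (f x * cnj (g x))) + (norm c)\<^sup>2 * (norm (g x))\<^sup>2)"
    unfolding mass_def
    by (intro Bochner_Integration.integral_cong refl)
       (simp only: cmod_power2, simp add: power2_eq_square algebra_simps)
  also have "\<dots> = mass f + 2 * Re (LINT x|lborel. cnj c * (f x * cnj (g x))) + (norm c)\<^sup>2 * mass g"
    using i square_integrable_norm_sq[OF f] square_integrable_norm_sq[OF g]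
    by (simp add: mass_def del: times_complex.sel)
  finally show ?thesis by (simp only: integral_mult_right_zero)
qed

lemma mass_eq_0_AE:
  assumes "square_integrable u" "mass u = 0"
  shows "AE x in lborel. u x = 0"
  using assms square_integrable_norm_sq[OF assms(1)]
  by (simp add: mass_def integral_nonneg_eq_0_iff_AE)

lemma mass_cong_AE:
  assumes "square_integrable u" "square_integrable v" "AE x in lborel. u x = v x"
  shows "mass u = mass v"
  unfolding mass_def using assms by (intro integral_cong_AE) (auto simp: square_integrable_def elim: eventually_mono)

text \<open>Completing the square against the mean value of \<open>\<bar>u\<bar>\<close> on the ball.\<close>

lemma L1_le_L2:
  fixes u :: "'a::euclidean_space \<Rightarrow> complex"
  assumes u: "square_integrable u" and supp: "AE x in lborel. x \<notin> ball 0 R \<longrightarrow> u x = 0" and R: "R > 0"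
  shows "(LINT x|lborel. norm (u x))\<^sup>2 \<le> measure lborel (ball 0 R :: 'a set) * mass u"
proof -
  define V where "V = measure lborel (ball 0 R :: 'a set)"
  have V: "V > 0" using content_ball_pos[OF R, of "0::'a"] by (simp add: V_def)
  note i = bounded_support_integrable[OF u supp]
  note [measurable] = square_integrable_measurable[OF u]
  define m where "m = (LINT x|lborel. norm (u x)) / V"
  have "0 \<le> (LINT x|lborel. (norm (u x))\<^sup>2 - 2 * m * norm (u x) + m\<^sup>2 * indicator (ball 0 R) x)"
  proof (rule integral_nonneg_AE)
    show "AE x in lborel. 0 \<le> (norm (u x))\<^sup>2 - 2 * m * norm (u x) + m\<^sup>2 * indicator (ball 0 R) x"
      using supp
    proof eventually_elim
      case (elim x)
      show ?case
      proof (cases "x \<in> ball 0 R")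
        case True
        have "0 \<le> (norm (u x) - m)\<^sup>2" by simp
        then show ?thesis using True by (simp add: power2_diff algebra_simps)
      qed (use elim in simp)
    qed
  qed
  also have "\<dots> = mass u - 2 * m * (LINT x|lborel. norm (u x)) + m\<^sup>2 * V"
    using square_integrable_norm_sq[OF u] i by (simp add: mass_def V_def)
  also have "\<dots> = mass u - (LINT x|lborel. norm (u x))\<^sup>2 / V"
    using V by (simp add: m_def power2_eq_square field_simps)
  finally show ?thesis
    using V by (simp add: V_def[symmetric] field_simps)
qed

lemma fourier_integral_add_cmult:
  assumes "integrable lborel u" "integrable lborel v"
  shows "fourier_integral (\<lambda>x. u x + c * v x) \<xi> = fourier_integral u \<xi> + c * fourier_integral v \<xi>"
proof -
  note i = fourier_integrand_integrable[OF assms(1), of \<xi>] fourier_integrand_integrable[OF assms(2), of \<xi>]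
  have "(LINT x|lborel. (u x + c * v x) * exp (- \<i> * of_real (x \<bullet> \<xi>)))
     = (LINT x|lborel. u x * exp (- \<i> * of_real (x \<bullet> \<xi>)) + c * (v x * exp (- \<i> * of_real (x \<bullet> \<xi>))))"
    by (intro Bochner_Integration.integral_cong refl) (simp add: algebra_simps)
  also have "\<dots> = (LINT x|lborel. u x * exp (- \<i> * of_real (x \<bullet> \<xi>))) + c * (LINT x|lborel. v x * exp (- \<i> * of_real (x \<bullet> \<xi>)))"
    by (subst Bochner_Integration.integral_add[OF i(1) integrable_mult_right[OF i(2)]]) (simp only: integral_mult_right_zero)
  finally show ?thesis by (simp add: fourier_integral_def algebra_simps)
qed

lemma fourier_integral_cmult: "fourier_integral (\<lambda>x. c * u x) \<xi> = c * fourier_integral u \<xi>"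
proof -
  have "(LINT x|lborel. (c * u x) * exp (- \<i> * of_real (x \<bullet> \<xi>))) = c * (LINT x|lborel. u x * exp (- \<i> * of_real (x \<bullet> \<xi>)))"
    by (subst integral_mult_right_zero[symmetric]) (simp only: mult.assoc)
  then show ?thesis by (simp add: fourier_integral_def)
qed

lemma fourier_integral_diff:
  assumes "integrable lborel u" "integrable lborel v"
  shows "fourier_integral (\<lambda>x. u x - v x) \<xi> = fourier_integral u \<xi> - fourier_integral v \<xi>"
  using fourier_integral_add_cmult[OF assms, of "-1"] by simp

lemma fourier_integral_cong_AE:
  assumes [measurable]: "u \<in> borel_measurable borel" "v \<in> borel_measurable borel" and "AE x in lborel. u x = v x"
  shows "fourier_integral u = fourier_integral v"
  unfolding fourier_integral_def
  by (intro ext arg_cong2[where f = "(*)"] refl integral_cong_AE) (use assms(3) in \<open>auto elim: eventually_mono\<close>)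

lemma fourier_integral_lipschitz:
  fixes u :: "'a::euclidean_space \<Rightarrow> complex"
  assumes i: "integrable lborel u" and supp: "AE x in lborel. x \<notin> ball 0 R \<longrightarrow> u x = 0"
  shows "norm (fourier_integral u \<xi> - fourier_integral u \<eta>) \<le>
    (2 * pi) powr (- real DIM('a) / 2) * (R * (LINT x|lborel. norm (u x))) * norm (\<xi> - \<eta>)"
proof -
  let ?e = "\<lambda>x \<xi>. exp (- \<i> * of_real (x \<bullet> \<xi>))"
  have e: "norm (?e x \<xi> - ?e x \<eta>) \<le> norm x * norm (\<xi> - \<eta>)" for x :: 'a
  proof -
    have "?e x \<xi> - ?e x \<eta> = ?e x \<eta> * (exp (\<i> * of_real (- (x \<bullet> (\<xi> - \<eta>)))) - 1)"
      by (simp add: algebra_simps exp_add[symmetric] inner_diff_right)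
    then have "norm (?e x \<xi> - ?e x \<eta>) = 2 * \<bar>sin (- (x \<bullet> (\<xi> - \<eta>)) / 2)\<bar>"
      by (simp only: norm_mult dist_exp_i_1) simp
    also have "\<dots> \<le> \<bar>x \<bullet> (\<xi> - \<eta>)\<bar>"
      using abs_sin_x_le_abs_x[of "- (x \<bullet> (\<xi> - \<eta>)) / 2"] by simp
    also have "\<dots> \<le> norm x * norm (\<xi> - \<eta>)" by (rule Cauchy_Schwarz_ineq2)
    finally show ?thesis .
  qed
  have [measurable]: "u \<in> borel_measurable borel" using i by auto
  have "fourier_integral u \<xi> - fourier_integral u \<eta> =
     of_real ((2 * pi) powr (- real DIM('a) / 2)) * (LINT x|lborel. u x * (?e x \<xi> - ?e x \<eta>))"
    unfolding fourier_integral_def right_diff_distrib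
    by (simp only: Bochner_Integration.integral_diff[OF fourier_integrand_integrable[OF i] fourier_integrand_integrable[OF i]] right_diff_distrib)
  moreover have "norm (LINT x|lborel. u x * (?e x \<xi> - ?e x \<eta>)) \<le> (LINT x|lborel. norm (u x) * (R * norm (\<xi> - \<eta>)))"
  proof (rule order_trans[OF integral_norm_bound integral_mono_AE])
    show "integrable lborel (\<lambda>x. norm (u x * (?e x \<xi> - ?e x \<eta>)))"
      unfolding right_diff_distrib
      by (intro integrable_norm Bochner_Integration.integrable_diff fourier_integrand_integrable i)
    show "integrable lborel (\<lambda>x. norm (u x) * (R * norm (\<xi> - \<eta>)))"
      using i by simp
    show "AE x in lborel. norm (u x * (?e x \<xi> - ?e x \<eta>)) \<le> norm (u x) * (R * norm (\<xi> - \<eta>))"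
      using supp
    proof eventually_elim
      case (elim x)
      show ?case
      proof (cases "x \<in> ball 0 R")
        case True
        then have "norm x * norm (\<xi> - \<eta>) \<le> R * norm (\<xi> - \<eta>)" by (intro mult_right_mono) auto
        then have "norm (?e x \<xi> - ?e x \<eta>) \<le> R * norm (\<xi> - \<eta>)" using e[of x] by linarith
        then show ?thesis unfolding norm_mult by (intro mult_left_mono) auto
      qed (use elim in simp)
    qed
  qed
  ultimately show ?thesis
    by (simp add: norm_mult mult_left_mono mult_ac)
qed

text \<open>Truncations to large balls do not change \<open>u\<close>, so the defining limit is eventually constant.\<close>

lemma fourier_eq_fourier_integral:
  fixes u :: "'a::euclidean_space \<Rightarrow> complex"
  assumes u: "square_integrable u" and supp: "AE x in lborel. x \<notin> ball 0 R \<longrightarrow> u x = 0"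
  shows "AE \<xi> in lborel. fourier u \<xi> = fourier_integral u \<xi>" and "square_integrable (fourier u)"
proof -
  note [measurable] = square_integrable_measurable[OF u]
  note i = bounded_support_integrable[OF u supp]
  have trunc: "fourier_integral (\<lambda>x. indicator (ball 0 r) x * u x) = fourier_integral u" if "r \<ge> R" for r
  proof (rule fourier_integral_cong_AE)
    show "AE x in lborel. indicator (ball 0 r) x * u x = u x"
      using supp by eventually_elim (use that in \<open>auto simp: indicator_def\<close>)
    have [measurable]: "ball 0 r \<in> sets borel" by simp
    show "(\<lambda>x. indicator (ball 0 r) x * u x) \<in> borel_measurable borel" by measurable
  qed (rule square_integrable_measurable[OF u])
  have ev: "eventually (\<lambda>r. (\<integral>\<^sup>+\<xi>. ennreal ((norm (fourier_integral (\<lambda>x. indicator (ball 0 r) x * u x) \<xi> - v \<xi>))\<^sup>2) \<partial>lborel)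
     = (\<integral>\<^sup>+\<xi>. ennreal ((norm (fourier_integral u \<xi> - v \<xi>))\<^sup>2) \<partial>lborel)) at_top" for v
    using eventually_ge_at_top[of R] by eventually_elim (simp add: trunc)
  have "is_fourier_transform u (fourier_integral u)"
    unfolding is_fourier_transform_def
    by (intro conjI plancherel_square_integrable i u tendsto_eventually)
       (use ev[of "fourier_integral u"] in simp)
  then have F: "is_fourier_transform u (fourier u)"
    unfolding fourier_def by (rule someI[of "is_fourier_transform u"])
  then show sF: "square_integrable (fourier u)" by (simp add: is_fourier_transform_def)
  note [measurable] = square_integrable_measurable[OF sF]
  have "((\<lambda>r::real. (\<integral>\<^sup>+\<xi>. ennreal ((norm (fourier_integral u \<xi> - fourier u \<xi>))\<^sup>2) \<partial>lborel)) \<longlongrightarrow> 0) at_top"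
    by (rule tendsto_cong[OF ev, THEN iffD1]) (use F in \<open>simp add: is_fourier_transform_def\<close>)
  then have "(\<integral>\<^sup>+\<xi>. ennreal ((norm (fourier_integral u \<xi> - fourier u \<xi>))\<^sup>2) \<partial>lborel) = 0"
    by (simp add: tendsto_const_iff)
  then have "AE \<xi> in lborel. ennreal ((norm (fourier_integral u \<xi> - fourier u \<xi>))\<^sup>2) = 0"
    by (subst (asm) nn_integral_0_iff_AE) auto
  then show "AE \<xi> in lborel. fourier u \<xi> = fourier_integral u \<xi>"
    by eventually_elim simp
qed

section \<open>The form domain\<close>

text \<open>The transform times the square root of the symbol \<open>\<bar>\<xi>\<bar>\<^sup>\<alpha>\<close>. The quadratic form of the operator thereby
  becomes a squared \<open>L\<^sup>2\<close> norm, and facts about \<open>mass\<close> (expansion, Fatou) apply to it.\<close>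

definition weighted_ft :: "real \<Rightarrow> ('a::euclidean_space \<Rightarrow> complex) \<Rightarrow> 'a \<Rightarrow> complex" where
  "weighted_ft \<alpha> u \<xi> = of_real (norm \<xi> powr (\<alpha> / 2)) * fourier_integral u \<xi>"

definition form_domain :: "real \<Rightarrow> 'a::euclidean_space set \<Rightarrow> ('a \<Rightarrow> complex) set" where
  "form_domain \<alpha> \<Omega> = {u. square_integrable u \<and> (AE x in lborel. x \<notin> \<Omega> \<longrightarrow> u x = 0) \<and>
     square_integrable (weighted_ft \<alpha> u)}"

abbreviation energy :: "real \<Rightarrow> ('a::euclidean_space \<Rightarrow> complex) \<Rightarrow> real" where
  "energy \<alpha> u \<equiv> mass (weighted_ft \<alpha> u)"

lemma weighted_ft_measurable [measurable]:
  assumes [measurable]: "u \<in> borel_measurable borel"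
  shows "weighted_ft \<alpha> u \<in> borel_measurable borel"
  unfolding weighted_ft_def[abs_def] by measurable

lemma norm_weighted_ft: "(norm (weighted_ft \<alpha> u \<xi>))\<^sup>2 = norm \<xi> powr \<alpha> * (norm (fourier_integral u \<xi>))\<^sup>2"
proof -
  have "(norm \<xi> powr (\<alpha> / 2))\<^sup>2 = norm \<xi> powr \<alpha>"
    by (simp add: power2_eq_square powr_add[symmetric])
  then show ?thesis by (simp add: weighted_ft_def norm_mult power_mult_distrib)
qed

lemma bessel_weight_bounds:
  fixes t :: real
  assumes "t \<ge> 0" "\<alpha> > 0"
  shows "t powr \<alpha> \<le> (1 + t\<^sup>2) powr (\<alpha> / 2)" "1 \<le> (1 + t\<^sup>2) powr (\<alpha> / 2)"
    "(1 + t\<^sup>2) powr (\<alpha> / 2) \<le> 2 powr (\<alpha> / 2) * (1 + t powr \<alpha>)"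
proof -
  have t: "(t\<^sup>2) powr (\<alpha> / 2) = t powr \<alpha>"
    using assms by (cases "t = 0") (auto simp: powr_powr simp flip: powr_numeral)
  show "t powr \<alpha> \<le> (1 + t\<^sup>2) powr (\<alpha> / 2)"
    unfolding t[symmetric] using assms by (intro powr_mono2) auto
  have "1 powr (\<alpha> / 2) \<le> (1 + t\<^sup>2) powr (\<alpha> / 2)" using assms by (intro powr_mono2) auto
  then show "1 \<le> (1 + t\<^sup>2) powr (\<alpha> / 2)" by simp
  show "(1 + t\<^sup>2) powr (\<alpha> / 2) \<le> 2 powr (\<alpha> / 2) * (1 + t powr \<alpha>)"
  proof (cases "t \<le> 1")
    case True
    then have "(1 + t\<^sup>2) powr (\<alpha> / 2) \<le> 2 powr (\<alpha> / 2)"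
      using assms power_le_one[of t 2] by (intro powr_mono2) auto
    also have "\<dots> \<le> 2 powr (\<alpha> / 2) * (1 + t powr \<alpha>)" by simp
    finally show ?thesis .
  next
    case False
    then have "1 \<le> t\<^sup>2" by simp
    then have "(1 + t\<^sup>2) powr (\<alpha> / 2) \<le> (2 * t\<^sup>2) powr (\<alpha> / 2)"
      using assms by (intro powr_mono2) auto
    also have "\<dots> = 2 powr (\<alpha> / 2) * t powr \<alpha>" by (simp add: powr_mult t)
    also have "\<dots> \<le> 2 powr (\<alpha> / 2) * (1 + t powr \<alpha>)" by simp
    finally show ?thesis .
  qed
qed

lemma support_ball:
  assumes "\<Omega> \<subseteq> ball 0 R" "AE x in lborel. x \<notin> \<Omega> \<longrightarrow> u x = 0"
  shows "AE x in lborel. x \<notin> ball 0 R \<longrightarrow> u x = 0"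
  using assms(2) by eventually_elim (use assms(1) in auto)

lemma sobolev0_eq_form_domain:
  fixes \<Omega> :: "'a::euclidean_space set"
  assumes \<Omega>: "\<Omega> \<subseteq> ball 0 R" and \<alpha>: "\<alpha> > 0"
  shows "sobolev0 (\<alpha> / 2) \<Omega> = form_domain \<alpha> \<Omega>"
proof -
  have "(integrable lborel (\<lambda>\<xi>. (1 + (norm \<xi>)\<^sup>2) powr (\<alpha> / 2) * (norm (fourier u \<xi>))\<^sup>2)) = square_integrable (weighted_ft \<alpha> u)"
    if u: "square_integrable u" and supp: "AE x in lborel. x \<notin> \<Omega> \<longrightarrow> u x = 0" for u :: "'a \<Rightarrow> complex"
  proof -
    note supp' = support_ball[OF \<Omega> supp]
    note i = bounded_support_integrable[OF u supp']
    note f = fourier_eq_fourier_integral[OF u supp']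
    note [measurable] = square_integrable_measurable[OF u] square_integrable_measurable[OF f(2)]
    let ?w = "\<lambda>\<xi>::'a. (1 + (norm \<xi>)\<^sup>2) powr (\<alpha> / 2)"
    note b = bessel_weight_bounds[OF norm_ge_zero \<alpha>]
    have "integrable lborel (\<lambda>\<xi>. ?w \<xi> * (norm (fourier u \<xi>))\<^sup>2) = integrable lborel (\<lambda>\<xi>. ?w \<xi> * (norm (fourier_integral u \<xi>))\<^sup>2)"
      by (rule integrable_cong_AE) (use f(1) in \<open>auto elim: eventually_mono\<close>)
    also have "\<dots> = integrable lborel (\<lambda>\<xi>. (norm (weighted_ft \<alpha> u \<xi>))\<^sup>2)"
    proof
      assume "integrable lborel (\<lambda>\<xi>. ?w \<xi> * (norm (fourier_integral u \<xi>))\<^sup>2)"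
      then show "integrable lborel (\<lambda>\<xi>. (norm (weighted_ft \<alpha> u \<xi>))\<^sup>2)"
        by (rule Bochner_Integration.integrable_bound) (auto simp: norm_weighted_ft abs_mult intro!: mult_right_mono b)
    next
      assume w: "integrable lborel (\<lambda>\<xi>. (norm (weighted_ft \<alpha> u \<xi>))\<^sup>2)"
      have "integrable lborel (\<lambda>\<xi>. 2 powr (\<alpha> / 2) * ((norm (fourier_integral u \<xi>))\<^sup>2 + (norm (weighted_ft \<alpha> u \<xi>))\<^sup>2))"
        by (intro integrable_mult_right Bochner_Integration.integrable_add w
            square_integrable_norm_sq[OF plancherel_square_integrable] i u)
      then show "integrable lborel (\<lambda>\<xi>. ?w \<xi> * (norm (fourier_integral u \<xi>))\<^sup>2)"
      proof (rule Bochner_Integration.integrable_bound)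
        show "AE \<xi> in lborel. norm (?w \<xi> * (norm (fourier_integral u \<xi>))\<^sup>2) \<le>
          norm (2 powr (\<alpha> / 2) * ((norm (fourier_integral u \<xi>))\<^sup>2 + (norm (weighted_ft \<alpha> u \<xi>))\<^sup>2))"
        proof (rule AE_I2)
          fix \<xi> :: 'a
          have "?w \<xi> * (norm (fourier_integral u \<xi>))\<^sup>2 \<le> (2 powr (\<alpha> / 2) * (1 + norm \<xi> powr \<alpha>)) * (norm (fourier_integral u \<xi>))\<^sup>2"
            by (intro mult_right_mono b) auto
          also have "\<dots> = 2 powr (\<alpha> / 2) * ((norm (fourier_integral u \<xi>))\<^sup>2 + (norm (weighted_ft \<alpha> u \<xi>))\<^sup>2)"
            by (simp add: norm_weighted_ft algebra_simps)
          finally show "norm (?w \<xi> * (norm (fourier_integral u \<xi>))\<^sup>2) \<le>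
            norm (2 powr (\<alpha> / 2) * ((norm (fourier_integral u \<xi>))\<^sup>2 + (norm (weighted_ft \<alpha> u \<xi>))\<^sup>2))"
            by (simp add: abs_mult)
        qed
      qed measurable
    qed
    also have "\<dots> = square_integrable (weighted_ft \<alpha> u)"
      by (simp add: square_integrable_def)
    finally show ?thesis .
  qed
  then show ?thesis
    by (auto simp: sobolev0_def sobolev_def form_domain_def)
qed

lemma form_domainD:
  assumes "u \<in> form_domain \<alpha> \<Omega>"
  shows "square_integrable u" "AE x in lborel. x \<notin> \<Omega> \<longrightarrow> u x = 0" "square_integrable (weighted_ft \<alpha> u)"
  using assms by (auto simp: form_domain_def)

lemma form_domain_integrable:
  assumes "u \<in> form_domain \<alpha> \<Omega>" "\<Omega> \<subseteq> ball 0 R"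
  shows "integrable lborel u"
  by (rule bounded_support_integrable[OF form_domainD(1)[OF assms(1)] support_ball[OF assms(2) form_domainD(2)[OF assms(1)]]])

lemma form_domain_add_cmult:
  assumes \<Omega>: "\<Omega> \<subseteq> ball 0 R" and u: "u \<in> form_domain \<alpha> \<Omega>" and v: "v \<in> form_domain \<alpha> \<Omega>"
  shows "weighted_ft \<alpha> (\<lambda>x. u x + c * v x) = (\<lambda>\<xi>. weighted_ft \<alpha> u \<xi> + c * weighted_ft \<alpha> v \<xi>)"
    and "(\<lambda>x. u x + c * v x) \<in> form_domain \<alpha> \<Omega>"
proof -
  show *: "weighted_ft \<alpha> (\<lambda>x. u x + c * v x) = (\<lambda>\<xi>. weighted_ft \<alpha> u \<xi> + c * weighted_ft \<alpha> v \<xi>)"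
    unfolding weighted_ft_def
    by (simp add: fourier_integral_add_cmult[OF form_domain_integrable[OF u \<Omega>] form_domain_integrable[OF v \<Omega>]] algebra_simps)
  have "AE x in lborel. x \<notin> \<Omega> \<longrightarrow> u x + c * v x = 0"
    using form_domainD(2)[OF u] form_domainD(2)[OF v] by eventually_elim auto
  then show "(\<lambda>x. u x + c * v x) \<in> form_domain \<alpha> \<Omega>"
    unfolding form_domain_def mem_Collect_eq *
    by (intro conjI square_integrable_add square_integrable_cmult form_domainD[OF u] form_domainD[OF v])
qed

lemma form_domain_cmult:
  assumes u: "u \<in> form_domain \<alpha> \<Omega>"
  shows "weighted_ft \<alpha> (\<lambda>x. c * u x) = (\<lambda>\<xi>. c * weighted_ft \<alpha> u \<xi>)" "(\<lambda>x. c * u x) \<in> form_domain \<alpha> \<Omega>"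
proof -
  show *: "weighted_ft \<alpha> (\<lambda>x. c * u x) = (\<lambda>\<xi>. c * weighted_ft \<alpha> u \<xi>)"
    by (intro ext) (simp add: weighted_ft_def fourier_integral_cmult mult_ac)
  have "AE x in lborel. x \<notin> \<Omega> \<longrightarrow> c * u x = 0"
    using form_domainD(2)[OF u] by eventually_elim auto
  then show "(\<lambda>x. c * u x) \<in> form_domain \<alpha> \<Omega>"
    unfolding form_domain_def mem_Collect_eq *
    by (intro conjI square_integrable_cmult form_domainD[OF u])
qed

section \<open>Completeness\<close>

lemma nn_integral_norm_sq:
  assumes "square_integrable f"
  shows "(\<integral>\<^sup>+x. ennreal ((norm (f x))\<^sup>2) \<partial>lborel) = ennreal (mass f)"
  unfolding mass_def by (intro nn_integral_eq_integral square_integrable_norm_sq assms) auto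

lemma fatou_mass:
  fixes f :: "nat \<Rightarrow> 'a::euclidean_space \<Rightarrow> complex"
  assumes f: "\<And>n. square_integrable (f n)" and [measurable]: "g \<in> borel_measurable borel"
    and lim: "AE x in lborel. (\<lambda>n. f n x) \<longlonglongrightarrow> g x"
    and le: "eventually (\<lambda>n. mass (f n) \<le> C) sequentially" and C: "C \<ge> 0"
  shows "square_integrable g" "mass g \<le> C"
proof -
  note [measurable] = square_integrable_measurable[OF f]
  have "(\<integral>\<^sup>+x. ennreal ((norm (g x))\<^sup>2) \<partial>lborel) = (\<integral>\<^sup>+x. liminf (\<lambda>n. ennreal ((norm (f n x))\<^sup>2)) \<partial>lborel)"
  proof (rule nn_integral_cong_AE)
    show "AE x in lborel. ennreal ((norm (g x))\<^sup>2) = liminf (\<lambda>n. ennreal ((norm (f n x))\<^sup>2))"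
      using lim
    proof eventually_elim
      case (elim x)
      have "(\<lambda>n. ennreal ((norm (f n x))\<^sup>2)) \<longlonglongrightarrow> ennreal ((norm (g x))\<^sup>2)"
        by (intro tendsto_ennrealI tendsto_intros elim)
      then show ?case by (rule lim_imp_Liminf[OF sequentially_bot, symmetric])
    qed
  qed
  also have "\<dots> \<le> liminf (\<lambda>n. \<integral>\<^sup>+x. ennreal ((norm (f n x))\<^sup>2) \<partial>lborel)"
    by (rule nn_integral_liminf) measurable
  also have "\<dots> = liminf (\<lambda>n. ennreal (mass (f n)))"
    by (simp add: nn_integral_norm_sq[OF f])
  also have "\<dots> \<le> liminf (\<lambda>n::nat. ennreal C)"
    using le by (intro Liminf_mono) (auto elim!: eventually_mono intro: ennreal_leI)
  also have "\<dots> = ennreal C" by (simp add: Liminf_const)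
  finally have le: "(\<integral>\<^sup>+x. ennreal ((norm (g x))\<^sup>2) \<partial>lborel) \<le> ennreal C" .
  then have "integrable lborel (\<lambda>x. (norm (g x))\<^sup>2)"
    by (intro integrableI_bounded) (auto intro: order.strict_trans1)
  then show g: "square_integrable g" by (simp add: square_integrable_def)
  show "mass g \<le> C"
    using le C by (simp add: nn_integral_norm_sq[OF g])
qed

text \<open>On a bounded set an \<open>L\<^sup>2\<close> Cauchy sequence is \<open>L\<^sup>1\<close> Cauchy, which supplies an almost everywhere
  convergent subsequence; Fatou's lemma identifies its limit as the \<open>L\<^sup>2\<close> limit.\<close>

lemma L2_complete:
  fixes u :: "nat \<Rightarrow> 'a::euclidean_space \<Rightarrow> complex"
  assumes u: "\<And>n. square_integrable (u n)" and \<Omega>: "\<Omega> \<subseteq> ball 0 R" and R: "R > 0"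
    and supp: "\<And>n. AE x in lborel. x \<notin> \<Omega> \<longrightarrow> u n x = 0"
    and cauchy: "\<And>e. e > 0 \<Longrightarrow> \<exists>N. \<forall>k\<ge>N. \<forall>l\<ge>N. mass (\<lambda>x. u k x - u l x) < e"
  obtains v where "square_integrable v" "AE x in lborel. x \<notin> \<Omega> \<longrightarrow> v x = 0"
    "(\<lambda>n. mass (\<lambda>x. u n x - v x)) \<longlonglongrightarrow> 0"
proof -
  note [measurable] = square_integrable_measurable[OF u]
  note supp' = support_ball[OF \<Omega> supp]
  define V where "V = measure lborel (ball 0 R :: 'a set)"
  have V: "V > 0" using content_ball_pos[OF R, of "0::'a"] by (simp add: V_def)
  have i: "integrable lborel (u n)" for n
    by (rule bounded_support_integrable[OF u supp'])
  have "\<exists>N. \<forall>k\<ge>N. \<forall>l\<ge>N. (LINT x|lborel. norm (u k x - u l x)) < e" if e: "e > 0" for e :: real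
  proof -
    have "e\<^sup>2 / V > 0" using e V by simp
    then obtain N where N: "\<And>k l. k \<ge> N \<Longrightarrow> l \<ge> N \<Longrightarrow> mass (\<lambda>x. u k x - u l x) < e\<^sup>2 / V"
      using cauchy by blast
    have "(LINT x|lborel. norm (u k x - u l x)) < e" if kl: "k \<ge> N" "l \<ge> N" for k l
    proof -
      have "AE x in lborel. x \<notin> ball 0 R \<longrightarrow> u k x - u l x = 0"
        using supp'[of k] supp'[of l] by eventually_elim auto
      then have "(LINT x|lborel. norm (u k x - u l x))\<^sup>2 \<le> V * mass (\<lambda>x. u k x - u l x)"
        unfolding V_def by (intro L1_le_L2 square_integrable_diff u R)
      also have "\<dots> < V * (e\<^sup>2 / V)" using N[OF kl] V by (intro mult_strict_left_mono)
      also have "\<dots> = e\<^sup>2" using V by simp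
      finally show ?thesis by (rule power_less_imp_less_base) (use e in simp)
    qed
    then show ?thesis by blast
  qed
  then obtain r where r: "strict_mono r" "AE x in lborel. Cauchy (\<lambda>n. u (r n) x)"
    by (rule cauchy_L1_AE_cauchy_subseq[OF i])
  define v where "v x = lim (\<lambda>n. u (r n) x)" for x
  have [measurable]: "v \<in> borel_measurable borel"
    unfolding v_def[abs_def] by measurable
  have lim: "AE x in lborel. (\<lambda>n. u (r n) x) \<longlonglongrightarrow> v x"
    using r(2) by eventually_elim (simp add: v_def Cauchy_convergent convergent_LIMSEQ_iff[symmetric])
  have tail: "square_integrable (\<lambda>x. u k x - v x) \<and> mass (\<lambda>x. u k x - v x) \<le> e"
    if k: "\<And>l. l \<ge> N \<Longrightarrow> mass (\<lambda>x. u k x - u l x) < e" and e: "e > 0" for k N e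
  proof -
    have "eventually (\<lambda>n. n \<ge> N) sequentially" by (rule eventually_ge_at_top)
    then have ev: "eventually (\<lambda>n. mass (\<lambda>x. u k x - u (r n) x) \<le> e) sequentially"
    proof eventually_elim
      case (elim n)
      then have "r n \<ge> N" using seq_suble[OF r(1), of n] by linarith
      then show ?case using k[of "r n"] by simp
    qed
    have li: "AE x in lborel. (\<lambda>n. u k x - u (r n) x) \<longlonglongrightarrow> u k x - v x"
      using lim by eventually_elim (intro tendsto_intros)
    have mv: "(\<lambda>x. u k x - v x) \<in> borel_measurable borel" by measurable
    show ?thesis
      using fatou_mass[OF square_integrable_diff[OF u u] mv li ev] e by simp
  qed
  show thesis
  proof
    obtain N where "\<forall>k\<ge>N. \<forall>l\<ge>N. mass (\<lambda>x. u k x - u l x) < 1" using cauchy[of 1] by auto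
    then have "square_integrable (\<lambda>x. u N x - v x)" using tail[of N N 1] by simp
    from square_integrable_diff[OF u[of N] this] show "square_integrable v" by simp
    have "AE x in lborel. \<forall>n. x \<notin> \<Omega> \<longrightarrow> u n x = 0"
      unfolding AE_all_countable using supp by blast
    then show "AE x in lborel. x \<notin> \<Omega> \<longrightarrow> v x = 0"
      using lim by eventually_elim (auto intro: LIMSEQ_unique)
    show "(\<lambda>n. mass (\<lambda>x. u n x - v x)) \<longlonglongrightarrow> 0"
    proof (rule LIMSEQ_I)
      fix e :: real assume e: "e > 0"
      then obtain N where N: "\<forall>k\<ge>N. \<forall>l\<ge>N. mass (\<lambda>x. u k x - u l x) < e / 2"
        using cauchy[of "e / 2"] by auto
      have "norm (mass (\<lambda>x. u n x - v x) - 0) < e" if "n \<ge> N" for n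
        using tail[of N n "e / 2"] N that e mass_nonneg[of "\<lambda>x. u n x - v x"] by simp
      then show "\<exists>N. \<forall>n\<ge>N. norm (mass (\<lambda>x. u n x - v x) - 0) < e" by blast
    qed
  qed
qed

section \<open>Existence of a ground state\<close>

text \<open>A diagonal subsequence converges on a countable dense set, and the common Lipschitz constant extends
  the convergence to every point.\<close>

lemma pointwise_convergent_subsequence:
  fixes f :: "nat \<Rightarrow> 'a::euclidean_space \<Rightarrow> complex"
  assumes B: "\<And>n x. norm (f n x) \<le> B" and L: "\<And>n x y. norm (f n x - f n y) \<le> L * norm (x - y)" and L0: "L \<ge> 0"
  obtains k g where "strict_mono (k :: nat \<Rightarrow> nat)" "\<And>x. (\<lambda>n. f (k n) x) \<longlonglongrightarrow> g x"
proof -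
  obtain D :: "'a set" where D: "countable D" "\<And>X. open X \<Longrightarrow> X \<noteq> {} \<Longrightarrow> \<exists>d\<in>D. d \<in> X"
    using countable_dense_setE by auto
  obtain k where k: "strict_mono k" "\<And>x. x \<in> D \<Longrightarrow> \<exists>l. (\<lambda>n. f (k n) x) \<longlonglongrightarrow> l"
    by (rule function_convergent_subsequence[OF D(1), of f B]) (use B in blast)+
  have "Cauchy (\<lambda>n. f (k n) x)" for x
  proof (rule metric_CauchyI)
    fix e :: real assume e: "e > 0"
    have "e / (3 * (L + 1)) > 0" using e L0 by (intro divide_pos_pos) auto
    then have "ball x (e / (3 * (L + 1))) \<noteq> {}" by (metis centre_in_ball empty_iff)
    then obtain d where d: "d \<in> D" "dist x d < e / (3 * (L + 1))"
      using D(2)[OF open_ball] by (auto simp: mem_ball)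
    have Ld: "L * norm (x - d) < e / 3"
    proof -
      have "L * norm (x - d) \<le> (L + 1) * norm (x - d)" by (intro mult_right_mono) auto
      also have "\<dots> < (L + 1) * (e / (3 * (L + 1)))"
        using d(2) L0 by (intro mult_strict_left_mono) (auto simp: dist_norm)
      also have "\<dots> = e / 3" using L0 by (simp add: field_simps)
      finally show ?thesis .
    qed
    have "Cauchy (\<lambda>n. f (k n) d)" using k(2)[OF d(1)] LIMSEQ_imp_Cauchy by blast
    then obtain N where N: "\<And>m n. m \<ge> N \<Longrightarrow> n \<ge> N \<Longrightarrow> dist (f (k m) d) (f (k n) d) < e / 3"
      using metric_CauchyD[of _ "e / 3"] e by fastforce
    have "dist (f (k m) x) (f (k n) x) < e" if "m \<ge> N" "n \<ge> N" for m n
    proof -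
      have "dist (f (k m) x) (f (k n) x) \<le> norm (f (k m) x - f (k m) d) + dist (f (k m) d) (f (k n) d) + norm (f (k n) x - f (k n) d)"
        using dist_triangle[of "f (k m) x" "f (k n) x" "f (k m) d"] dist_triangle[of "f (k m) d" "f (k n) x" "f (k n) d"]
        unfolding dist_norm[of "f (k m) x" "f (k m) d", symmetric] dist_norm[of "f (k n) x" "f (k n) d", symmetric] 
          dist_commute[of "f (k n) x" "f (k n) d"] by linarith
      then show ?thesis
        using N[OF that] L[of "k m" x d] L[of "k n" x d] Ld by linarith
    qed
    then show "\<exists>M. \<forall>m\<ge>M. \<forall>n\<ge>M. dist (f (k m) x) (f (k n) x) < e" by blast
  qed
  then have "\<forall>x. \<exists>l. (\<lambda>n. f (k n) x) \<longlonglongrightarrow> l"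
    by (simp add: Cauchy_convergent_iff convergent_def)
  then obtain g where "\<And>x. (\<lambda>n. f (k n) x) \<longlonglongrightarrow> g x" by metis
  with k(1) show thesis by (rule that)
qed

lemma fourier_integral_sq_le_mass:
  fixes u :: "'a::euclidean_space \<Rightarrow> complex"
  assumes u: "square_integrable u" and supp: "AE x in lborel. x \<notin> ball 0 R \<longrightarrow> u x = 0" and R: "R > 0"
  shows "(norm (fourier_integral u \<xi>))\<^sup>2 \<le>
    ((2 * pi) powr (- real DIM('a) / 2))\<^sup>2 * measure lborel (ball 0 R :: 'a set) * mass u"
proof -
  have "(norm (fourier_integral u \<xi>))\<^sup>2 \<le> ((2 * pi) powr (- real DIM('a) / 2) * (LINT x|lborel. norm (u x)))\<^sup>2"
    by (intro power_mono fourier_integral_bound bounded_support_integrable[OF u supp]) auto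
  also have "\<dots> = ((2 * pi) powr (- real DIM('a) / 2))\<^sup>2 * (LINT x|lborel. norm (u x))\<^sup>2"
    by (rule power_mult_distrib)
  also have "\<dots> \<le> ((2 * pi) powr (- real DIM('a) / 2))\<^sup>2 * (measure lborel (ball 0 R :: 'a set) * mass u)"
    by (intro mult_left_mono L1_le_L2 assms) auto
  finally show ?thesis by (simp add: mult.assoc)
qed

text \<open>Rellich compactness. A bound on the mass of functions supported in a fixed ball makes their
  transforms uniformly bounded and equi-Lipschitz, hence pointwise convergent along a subsequence;
  a bound on the energy leaves little mass at high frequencies. So the transforms converge in
  \<open>L\<^sup>2\<close>, and by Plancherel the functions do.\<close>

lemma rellich:
  fixes u :: "nat \<Rightarrow> 'a::euclidean_space \<Rightarrow> complex"
  assumes \<Omega>: "\<Omega> \<subseteq> ball 0 R" and R: "R > 0" and \<alpha>: "\<alpha> > 0"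
    and u: "\<And>n. u n \<in> form_domain \<alpha> \<Omega>" and M: "\<And>n. mass (u n) \<le> M" and \<Lambda>: "\<And>n. energy \<alpha> (u n) \<le> \<Lambda>"
  obtains k v where "strict_mono (k :: nat \<Rightarrow> nat)" "square_integrable v" "AE x in lborel. x \<notin> \<Omega> \<longrightarrow> v x = 0"
    "(\<lambda>n. mass (\<lambda>x. u (k n) x - v x)) \<longlonglongrightarrow> 0"
proof -
  note sq = form_domainD(1)[OF u] and supp = support_ball[OF \<Omega> form_domainD(2)[OF u]] and wq = form_domainD(3)[OF u]
  note i = form_domain_integrable[OF u \<Omega>]
  note [measurable] = square_integrable_measurable[OF sq]
  define c where "c = (2 * pi) powr (- real DIM('a) / 2)"
  define V where "V = measure lborel (ball 0 R :: 'a set)"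
  have V: "V > 0" using content_ball_pos[OF R, of "0::'a"] by (simp add: V_def)
  have c: "c > 0" by (simp add: c_def)
  have M0: "M \<ge> 0" using M[of 0] mass_nonneg[of "u 0"] by linarith
  have L1: "(LINT x|lborel. norm (u n x)) \<le> sqrt (V * M)" for n
  proof (rule real_le_rsqrt)
    have "(LINT x|lborel. norm (u n x))\<^sup>2 \<le> V * mass (u n)"
      unfolding V_def by (rule L1_le_L2[OF sq supp R])
    also have "\<dots> \<le> V * M" using V M by (intro mult_left_mono) auto
    finally show "(LINT x|lborel. norm (u n x))\<^sup>2 \<le> V * M" .
  qed
  let ?F = "\<lambda>n. fourier_integral (u n)"
  define B where "B = c * sqrt (V * M)"
  have B: "norm (?F n \<xi>) \<le> B" for n \<xi>
    using order_trans[OF fourier_integral_bound[OF i] mult_left_mono[OF L1]] c by (simp add: B_def c_def)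
  have B0: "B \<ge> 0" using c V M0 by (simp add: B_def)
  obtain k g where k: "strict_mono k" and g: "\<And>\<xi>. (\<lambda>n. ?F (k n) \<xi>) \<longlonglongrightarrow> g \<xi>"
  proof (rule pointwise_convergent_subsequence[of ?F B "c * (R * sqrt (V * M))"])
    show "norm (?F n \<xi> - ?F n \<eta>) \<le> c * (R * sqrt (V * M)) * norm (\<xi> - \<eta>)" for n \<xi> \<eta>
    proof (rule order_trans[OF fourier_integral_lipschitz[OF i supp]])
      show "(2 * pi) powr (- real DIM('a) / 2) * (R * (LINT x|lborel. norm (u n x))) * norm (\<xi> - \<eta>) \<le> c * (R * sqrt (V * M)) * norm (\<xi> - \<eta>)"
        unfolding c_def[symmetric] using c R L1 by (intro mult_right_mono mult_left_mono) auto
    qed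
    show "0 \<le> c * (R * sqrt (V * M))" using c R V M0 by simp
  qed (use B in auto)
  have [measurable]: "g \<in> borel_measurable borel"
    by (rule borel_measurable_LIMSEQ_metric[OF _ g]) measurable
  have gB: "norm (g \<xi>) \<le> B" for \<xi>
    by (rule LIMSEQ_le_const2[OF tendsto_norm[OF g]]) (use B in auto)
  define a where "a \<rho> n = (LINT \<xi>|lborel. indicator (ball 0 \<rho>) \<xi> * (norm (?F (k n) \<xi> - g \<xi>))\<^sup>2)" for \<rho> n
  have diffB: "indicator (ball 0 \<rho>) \<xi> * (norm (?F n \<xi> - g \<xi>))\<^sup>2 \<le> (2 * B)\<^sup>2 * indicator (ball 0 \<rho>) \<xi>" for \<rho> n \<xi>
  proof -
    have "norm (?F n \<xi> - g \<xi>) \<le> 2 * B"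
      using norm_triangle_ineq4[of "?F n \<xi>" "g \<xi>"] B[of n \<xi>] gB[of \<xi>] by linarith
    then have "(norm (?F n \<xi> - g \<xi>))\<^sup>2 \<le> (2 * B)\<^sup>2" by (intro power_mono) auto
    then show ?thesis by (simp add: indicator_def)
  qed
  have wB: "integrable lborel (\<lambda>\<xi>::'a. (2 * B)\<^sup>2 * indicator (ball 0 \<rho>) \<xi> :: real)" for \<rho>
    by (intro integrable_mult_right integrable_indicator_ball)
  have ai: "integrable lborel (\<lambda>\<xi>. indicator (ball 0 \<rho>) \<xi> * (norm (?F n \<xi> - g \<xi>))\<^sup>2)" for \<rho> n
  proof (rule Bochner_Integration.integrable_bound[OF wB[of \<rho>]])
    have [measurable]: "ball 0 \<rho> \<in> sets borel" by simp
    show "(\<lambda>\<xi>. indicator (ball 0 \<rho>) \<xi> * (norm (?F n \<xi> - g \<xi>))\<^sup>2) \<in> borel_measurable lborel" by measurable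
  qed (use diffB in auto)
  have a: "a \<rho> \<longlonglongrightarrow> 0" for \<rho>
  proof -
    have "(\<lambda>n. LINT \<xi>|lborel. indicator (ball 0 \<rho>) \<xi> * (norm (?F (k n) \<xi> - g \<xi>))\<^sup>2) \<longlonglongrightarrow> (LINT \<xi>|(lborel :: 'a measure). (0 :: real))"
    proof (rule integral_dominated_convergence[OF _ _ wB[of \<rho>]])
      show "AE \<xi> in lborel. (\<lambda>n. indicator (ball 0 \<rho>) \<xi> * (norm (?F (k n) \<xi> - g \<xi>))\<^sup>2) \<longlonglongrightarrow> 0"
      proof (rule AE_I2)
        fix \<xi>
        have "(\<lambda>n. indicator (ball 0 \<rho>) \<xi> * (norm (?F (k n) \<xi> - g \<xi>))\<^sup>2) \<longlonglongrightarrow> indicator (ball 0 \<rho>) \<xi> * (norm (g \<xi> - g \<xi>))\<^sup>2"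
          by (intro tendsto_intros g)
        then show "(\<lambda>n. indicator (ball 0 \<rho>) \<xi> * (norm (?F (k n) \<xi> - g \<xi>))\<^sup>2) \<longlonglongrightarrow> 0" by simp
      qed
      show "AE \<xi> in lborel. norm (indicator (ball 0 \<rho>) \<xi> * (norm (?F (k n) \<xi> - g \<xi>))\<^sup>2) \<le> (2 * B)\<^sup>2 * indicator (ball 0 \<rho>) \<xi>" for n
        using diffB by auto
    qed (use ai in auto)
    then show ?thesis by (simp add: a_def[abs_def])
  qed
  have key: "mass (\<lambda>x. u (k m) x - u (k n) x) \<le> 2 * a \<rho> m + 2 * a \<rho> n + (1 / \<rho> powr \<alpha>) * (4 * \<Lambda>)" if \<rho>: "\<rho> > 0" for m n \<rho>
  proof -
    let ?D = "\<lambda>\<xi>. ?F (k m) \<xi> - ?F (k n) \<xi>"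
    let ?W = "\<lambda>n. weighted_ft \<alpha> (u (k n))"
    have wi: "integrable lborel (\<lambda>\<xi>. (norm (?W n \<xi>))\<^sup>2)" for n
      by (intro square_integrable_norm_sq wq)
    let ?b = "\<lambda>\<xi>. 2 * (indicator (ball 0 \<rho>) \<xi> * (norm (?F (k m) \<xi> - g \<xi>))\<^sup>2) + 2 * (indicator (ball 0 \<rho>) \<xi> * (norm (?F (k n) \<xi> - g \<xi>))\<^sup>2)
        + (1 / \<rho> powr \<alpha>) * (2 * (norm (?W m \<xi>))\<^sup>2 + 2 * (norm (?W n \<xi>))\<^sup>2)"
    have "mass (\<lambda>x. u (k m) x - u (k n) x) = (LINT \<xi>|lborel. (norm (fourier_integral (\<lambda>x. u (k m) x - u (k n) x) \<xi>))\<^sup>2)"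
      unfolding mass_def
      by (rule plancherel[symmetric]) (intro Bochner_Integration.integrable_diff i square_integrable_diff sq)+
    also have "\<dots> = (LINT \<xi>|lborel. (norm (?D \<xi>))\<^sup>2)"
      by (simp add: fourier_integral_diff[OF i i])
    also have "\<dots> \<le> (LINT \<xi>|lborel. ?b \<xi>)"
    proof (rule integral_mono)
      show "integrable lborel (\<lambda>\<xi>. (norm (?D \<xi>))\<^sup>2)"
        by (intro square_integrable_norm_sq square_integrable_diff plancherel_square_integrable i sq)
      show "integrable lborel ?b"
        by (intro Bochner_Integration.integrable_add integrable_mult_right ai wi)
      fix \<xi> :: 'a
      show "(norm (?D \<xi>))\<^sup>2 \<le> ?b \<xi>"
      proof (cases "\<xi> \<in> ball 0 \<rho>")
        case True
        have "?D \<xi> = (?F (k m) \<xi> - g \<xi>) - (?F (k n) \<xi> - g \<xi>)" by simp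
        then have "(norm (?D \<xi>))\<^sup>2 \<le> 2 * (norm (?F (k m) \<xi> - g \<xi>))\<^sup>2 + 2 * (norm (?F (k n) \<xi> - g \<xi>))\<^sup>2"
          using norm_diff_sq_le by metis
        moreover have "0 \<le> (1 / \<rho> powr \<alpha>) * (2 * (norm (?W m \<xi>))\<^sup>2 + 2 * (norm (?W n \<xi>))\<^sup>2)" by simp
        moreover have "indicator (ball 0 \<rho>) \<xi> = (1 :: real)" using True by simp
        ultimately show ?thesis by (simp only: mult_1_left add_increasing2)
      next
        case False
        then have "\<rho> powr \<alpha> \<le> norm \<xi> powr \<alpha>" using \<rho> \<alpha> by (intro powr_mono2) auto
        then have "1 \<le> (1 / \<rho> powr \<alpha>) * norm \<xi> powr \<alpha>" using \<rho> by simp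
        then have "1 * (norm (?D \<xi>))\<^sup>2 \<le> ((1 / \<rho> powr \<alpha>) * norm \<xi> powr \<alpha>) * (norm (?D \<xi>))\<^sup>2"
          by (rule mult_right_mono) simp
        also have "\<dots> \<le> ((1 / \<rho> powr \<alpha>) * norm \<xi> powr \<alpha>) * (2 * (norm (?F (k m) \<xi>))\<^sup>2 + 2 * (norm (?F (k n) \<xi>))\<^sup>2)"
          by (intro mult_left_mono norm_diff_sq_le) simp
        also have "\<dots> = (1 / \<rho> powr \<alpha>) * (2 * (norm (?W m \<xi>))\<^sup>2 + 2 * (norm (?W n \<xi>))\<^sup>2)"
          by (simp add: norm_weighted_ft algebra_simps)
        finally show ?thesis using False by simp
      qed
    qed
    also have "\<dots> = 2 * a \<rho> m + 2 * a \<rho> n + (1 / \<rho> powr \<alpha>) * (2 * energy \<alpha> (u (k m)) + 2 * energy \<alpha> (u (k n)))"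
      using ai wi by (simp add: a_def mass_def)
    also have "\<dots> \<le> 2 * a \<rho> m + 2 * a \<rho> n + (1 / \<rho> powr \<alpha>) * (4 * \<Lambda>)"
      using \<Lambda>[of "k m"] \<Lambda>[of "k n"] by (intro add_left_mono mult_left_mono) auto
    finally show ?thesis .
  qed
  have "\<exists>N. \<forall>m\<ge>N. \<forall>n\<ge>N. mass (\<lambda>x. u (k m) x - u (k n) x) < e" if e: "e > 0" for e
  proof -
    have L0: "\<Lambda> \<ge> 0" using \<Lambda>[of 0] mass_nonneg[of "weighted_ft \<alpha> (u 0)"] by linarith
    define \<rho> where "\<rho> = (8 * \<Lambda> / e + 1) powr (1 / \<alpha>)"
    have pos: "8 * \<Lambda> / e + 1 > 0" using L0 e by (intro add_nonneg_pos) auto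
    then have \<rho>: "\<rho> > 0" by (simp add: \<rho>_def)
    have "\<rho> powr \<alpha> = 8 * \<Lambda> / e + 1"
      using \<alpha> pos by (simp add: \<rho>_def powr_powr)
    then have "4 * \<Lambda> < e / 2 * \<rho> powr \<alpha>" using L0 e by (simp add: field_simps)
    then have "4 * \<Lambda> / \<rho> powr \<alpha> < e / 2" using \<rho> by (subst pos_divide_less_eq) auto
    then have tail: "(1 / \<rho> powr \<alpha>) * (4 * \<Lambda>) < e / 2" by simp
    have "eventually (\<lambda>n. a \<rho> n < e / 8) sequentially"
      by (rule order_tendstoD(2)[OF a]) (use e in simp)
    then obtain N where N: "\<And>n. n \<ge> N \<Longrightarrow> a \<rho> n < e / 8" by (auto simp: eventually_sequentially)
    have "mass (\<lambda>x. u (k m) x - u (k n) x) < e" if "m \<ge> N" "n \<ge> N" for m n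
      using key[OF \<rho>, of m n] N[OF that(1)] N[OF that(2)] tail by linarith
    then show ?thesis by blast
  qed
  then obtain v where "square_integrable v" "AE x in lborel. x \<notin> \<Omega> \<longrightarrow> v x = 0" "(\<lambda>n. mass (\<lambda>x. u (k n) x - v x)) \<longlonglongrightarrow> 0"
    by (rule L2_complete[OF sq \<Omega> R form_domainD(2)[OF u]])
  with k show thesis by (rule that)
qed

text \<open>The reverse triangle inequality in the form 
  \<open>\<bar>mass f - mass g\<bar> \<le> mass (f - g) / t + t (2 mass f + 2 mass g)\<close> for every \<open>t > 0\<close>, which needs no square roots of integrals.\<close>

lemma mass_continuous:
  assumes u: "\<And>n. square_integrable (u n)" and v: "square_integrable v"
    and lim: "(\<lambda>n. mass (\<lambda>x. u n x - v x)) \<longlonglongrightarrow> 0" and C: "\<And>n. mass (u n) = C"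
  shows "mass v = C"
proof -
  have bound: "\<bar>mass f - mass g\<bar> \<le> mass (\<lambda>x. f x - g x) / t + t * (2 * mass f + 2 * mass g)"
    if f: "square_integrable f" and g: "square_integrable g" and t: "t > 0" for f g :: "'a \<Rightarrow> complex" and t
  proof -
    note fi = square_integrable_norm_sq[OF f] and gi = square_integrable_norm_sq[OF g]
      and di = square_integrable_norm_sq[OF square_integrable_diff[OF f g]]
    have "mass f - mass g = (LINT x|lborel. (norm (f x))\<^sup>2 - (norm (g x))\<^sup>2)"
      using fi gi by (simp add: mass_def)
    then have "\<bar>mass f - mass g\<bar> \<le> (LINT x|lborel. \<bar>(norm (f x))\<^sup>2 - (norm (g x))\<^sup>2\<bar>)"
      using integral_norm_bound[of lborel "\<lambda>x. (norm (f x))\<^sup>2 - (norm (g x))\<^sup>2"] by simp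
    also have "\<dots> \<le> (LINT x|lborel. (norm (f x - g x))\<^sup>2 / t + t * (2 * (norm (f x))\<^sup>2 + 2 * (norm (g x))\<^sup>2))"
    proof (rule integral_mono)
      show "integrable lborel (\<lambda>x. \<bar>(norm (f x))\<^sup>2 - (norm (g x))\<^sup>2\<bar>)" using fi gi by simp
      show "integrable lborel (\<lambda>x. (norm (f x - g x))\<^sup>2 / t + t * (2 * (norm (f x))\<^sup>2 + 2 * (norm (g x))\<^sup>2))"
        using fi gi di by (intro Bochner_Integration.integrable_add integrable_mult_right integrable_divide)
      fix x
      define p where "p = norm (f x - g x)"
      define s where "s = norm (f x) + norm (g x)"
      have "(norm (f x))\<^sup>2 - (norm (g x))\<^sup>2 = (norm (f x) - norm (g x)) * s"
        by (simp add: s_def power2_eq_square algebra_simps)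
      then have "\<bar>(norm (f x))\<^sup>2 - (norm (g x))\<^sup>2\<bar> = \<bar>norm (f x) - norm (g x)\<bar> * s"
        by (simp add: abs_mult s_def)
      also have "\<dots> \<le> p * s"
        unfolding p_def by (intro mult_right_mono norm_triangle_ineq3) (simp add: s_def)
      also have "p * s \<le> p\<^sup>2 / t + t * s\<^sup>2"
      proof -
        have "0 \<le> (p - t * s)\<^sup>2 + p * (t * s)" using t by (simp add: p_def s_def)
        then have "t * (p * s) \<le> p\<^sup>2 + t * (t * s\<^sup>2)" by (simp add: power2_eq_square algebra_simps)
        also have "\<dots> = t * (p\<^sup>2 / t + t * s\<^sup>2)" using t by (simp add: algebra_simps)
        finally show ?thesis using t by (simp only: mult_le_cancel_left_pos)
      qed
      also have "\<dots> \<le> p\<^sup>2 / t + t * (2 * (norm (f x))\<^sup>2 + 2 * (norm (g x))\<^sup>2)"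
        using t sum_squares_bound[of "norm (f x)" "norm (g x)"]
        by (intro add_left_mono mult_left_mono) (auto simp: s_def power2_sum)
      finally show "\<bar>(norm (f x))\<^sup>2 - (norm (g x))\<^sup>2\<bar> \<le> (norm (f x - g x))\<^sup>2 / t + t * (2 * (norm (f x))\<^sup>2 + 2 * (norm (g x))\<^sup>2)"
        by (simp add: p_def)
    qed
    also have "\<dots> = mass (\<lambda>x. f x - g x) / t + t * (2 * mass f + 2 * mass g)"
      using fi gi di by (simp add: mass_def)
    finally show ?thesis .
  qed
  have le: "\<bar>C - mass v\<bar> \<le> t * (2 * C + 2 * mass v)" if t: "t > 0" for t
  proof (rule LIMSEQ_le_const)
    have "(\<lambda>n. mass (\<lambda>x. u n x - v x) / t + t * (2 * C + 2 * mass v)) \<longlonglongrightarrow> 0 / t + t * (2 * C + 2 * mass v)"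
      using t by (intro tendsto_intros lim) auto
    then show "(\<lambda>n. mass (\<lambda>x. u n x - v x) / t + t * (2 * C + 2 * mass v)) \<longlonglongrightarrow> t * (2 * C + 2 * mass v)" by simp
    show "\<exists>N. \<forall>n\<ge>N. \<bar>C - mass v\<bar> \<le> mass (\<lambda>x. u n x - v x) / t + t * (2 * C + 2 * mass v)"
      using bound[OF u v t] by (simp add: C)
  qed
  have "\<bar>C - mass v\<bar> \<le> 0"
  proof (rule field_le_epsilon)
    fix e :: real assume e: "e > 0"
    define K where "K = 2 * C + 2 * mass v"
    have K: "K \<ge> 0" using mass_nonneg[of "u 0"] mass_nonneg[of v] by (simp add: K_def C)
    have "\<bar>C - mass v\<bar> \<le> (e / (K + 1)) * K"
      using le[of "e / (K + 1)"] e K by (simp add: K_def)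
    also have "\<dots> \<le> e" using e K by (simp add: field_simps)
    finally show "\<bar>C - mass v\<bar> \<le> 0 + e" by simp
  qed
  then show ?thesis by simp
qed

text \<open>The direct method. A minimizing sequence of unit mass converges in \<open>L\<^sup>2\<close> along a subsequence by
  \<open>rellich\<close>, so the limit keeps unit mass; its transforms converge pointwise, and Fatou's lemma shows
  that the energy does not jump up.\<close>

theorem ground_state_exists:
  fixes \<Omega> :: "'a::euclidean_space set"
  assumes \<Omega>: "\<Omega> \<subseteq> ball 0 R" and R: "R > 0" and \<alpha>: "\<alpha> > 0"
    and w: "w \<in> form_domain \<alpha> \<Omega>" "mass w > 0"
  obtains u where "u \<in> form_domain \<alpha> \<Omega>" "mass u = 1"
    "\<And>v. v \<in> form_domain \<alpha> \<Omega> \<Longrightarrow> energy \<alpha> u * mass v \<le> energy \<alpha> v"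
proof -
  define S where "S = {energy \<alpha> v |v. v \<in> form_domain \<alpha> \<Omega> \<and> mass v = 1}"
  define lam where "lam = Inf S"
  have scale: "\<exists>v'. v' \<in> form_domain \<alpha> \<Omega> \<and> mass v' = 1 \<and> energy \<alpha> v' = energy \<alpha> v / mass v"
    if v: "v \<in> form_domain \<alpha> \<Omega>" "mass v > 0" for v
  proof -
    let ?c = "complex_of_real (1 / sqrt (mass v))"
    have n: "(norm ?c)\<^sup>2 = 1 / mass v" using v(2) by (simp add: norm_divide power_divide)
    have "mass (\<lambda>x. ?c * v x) = 1" unfolding mass_cmult n using v(2) by simp
    moreover have "energy \<alpha> (\<lambda>x. ?c * v x) = energy \<alpha> v / mass v"
      unfolding form_domain_cmult(1)[OF v(1)] mass_cmult n by simp
    ultimately show ?thesis using form_domain_cmult(2)[OF v(1), of ?c] by blast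
  qed
  have ne: "S \<noteq> {}" using scale[OF w] by (auto simp: S_def)
  have bdd: "bdd_below S" by (rule bdd_belowI[of _ 0]) (auto simp: S_def mass_nonneg)
  have low: "lam * mass v \<le> energy \<alpha> v" if v: "v \<in> form_domain \<alpha> \<Omega>" for v
  proof (cases "mass v > 0")
    case True
    then obtain v' where "v' \<in> form_domain \<alpha> \<Omega>" "mass v' = 1" "energy \<alpha> v' = energy \<alpha> v / mass v"
      using scale[OF v] by blast
    then have "energy \<alpha> v / mass v \<in> S" unfolding S_def by force
    then have "lam \<le> energy \<alpha> v / mass v" unfolding lam_def using bdd by (rule cInf_lower)
    then show ?thesis using True by (simp add: field_simps)
  next
    case False
    then have "mass v = 0" using mass_nonneg[of v] by simp
    then show ?thesis by (simp add: mass_nonneg)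
  qed
  have "\<exists>v. v \<in> form_domain \<alpha> \<Omega> \<and> mass v = 1 \<and> energy \<alpha> v < lam + 1 / real (Suc n)" for n
  proof -
    have "Inf S < lam + 1 / real (Suc n)" by (simp add: lam_def)
    then obtain s where "s \<in> S" "s < lam + 1 / real (Suc n)"
      using cInf_lessD[OF ne] by blast
    then show ?thesis by (auto simp: S_def)
  qed
  then obtain u where u: "\<And>n. u n \<in> form_domain \<alpha> \<Omega>" "\<And>n. mass (u n) = 1" "\<And>n. energy \<alpha> (u n) < lam + 1 / real (Suc n)"
    by metis
  have ub: "energy \<alpha> (u n) \<le> lam + 1" for n
  proof -
    have "1 / real (Suc n) \<le> 1" by simp
    then show ?thesis using u(3)[of n] by linarith
  qed
  obtain k v where k: "strict_mono k" and v: "square_integrable v" "AE x in lborel. x \<notin> \<Omega> \<longrightarrow> v x = 0"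
    and lim: "(\<lambda>n. mass (\<lambda>x. u (k n) x - v x)) \<longlonglongrightarrow> 0"
    by (rule rellich[OF \<Omega> R \<alpha> u(1) eq_refl[OF u(2)] ub])
  note [measurable] = square_integrable_measurable[OF v(1)]
  note supp = support_ball[OF \<Omega> v(2)]
  have m1: "mass v = 1"
    by (rule mass_continuous[OF form_domainD(1)[OF u(1)] v(1) lim u(2)])
  define K where "K = ((2 * pi) powr (- real DIM('a) / 2))\<^sup>2 * measure lborel (ball 0 R :: 'a set)"
  have Flim: "(\<lambda>n. fourier_integral (u (k n)) \<xi>) \<longlonglongrightarrow> fourier_integral v \<xi>" for \<xi>
  proof -
    have le: "(norm (fourier_integral (u (k n)) \<xi> - fourier_integral v \<xi>))\<^sup>2 \<le> K * mass (\<lambda>x. u (k n) x - v x)" for n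
    proof -
      have "AE x in lborel. x \<notin> ball 0 R \<longrightarrow> u (k n) x - v x = 0"
        using supp support_ball[OF \<Omega> form_domainD(2)[OF u(1)[of "k n"]]] by eventually_elim auto
      from fourier_integral_sq_le_mass[OF square_integrable_diff[OF form_domainD(1)[OF u(1)[of "k n"]] v(1)] this R, of \<xi>]
      show ?thesis
        by (simp add: K_def fourier_integral_diff[OF form_domain_integrable[OF u(1) \<Omega>] bounded_support_integrable[OF v(1) supp]])
    qed
    have "(\<lambda>n. K * mass (\<lambda>x. u (k n) x - v x)) \<longlonglongrightarrow> K * 0" by (intro tendsto_intros lim)
    then have K0: "(\<lambda>n. K * mass (\<lambda>x. u (k n) x - v x)) \<longlonglongrightarrow> 0" by simp
    have "(\<lambda>n. (norm (fourier_integral (u (k n)) \<xi> - fourier_integral v \<xi>))\<^sup>2) \<longlonglongrightarrow> 0"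
      by (rule tendsto_sandwich[OF _ _ tendsto_const K0]) (use le in simp_all)
    then have "(\<lambda>n. norm (fourier_integral (u (k n)) \<xi> - fourier_integral v \<xi>)) \<longlonglongrightarrow> 0"
      by (simp add: power_tendsto_0_iff)
    then show ?thesis by (simp add: tendsto_norm_zero_iff LIM_zero_iff)
  qed
  have wlim: "AE \<xi> in lborel. (\<lambda>n. weighted_ft \<alpha> (u (k n)) \<xi>) \<longlonglongrightarrow> weighted_ft \<alpha> v \<xi>"
    unfolding weighted_ft_def by (intro AE_I2 tendsto_intros Flim)
  have l0: "lam \<ge> 0" unfolding lam_def by (rule cInf_greatest[OF ne]) (auto simp: S_def mass_nonneg)
  have fat: "square_integrable (weighted_ft \<alpha> v) \<and> energy \<alpha> v \<le> lam + e" if e: "e > 0" for e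
  proof -
    obtain N where N: "1 / real (Suc N) < e" using nat_approx_posE[OF e] .
    have "eventually (\<lambda>n. n \<ge> N) sequentially" by (rule eventually_ge_at_top)
    then have ev: "eventually (\<lambda>n. energy \<alpha> (u (k n)) \<le> lam + e) sequentially"
    proof eventually_elim
      case (elim n)
      then have "N \<le> k n" using seq_suble[OF k, of n] by linarith
      then have "1 / real (Suc (k n)) \<le> 1 / real (Suc N)" by (intro divide_left_mono) auto
      then show ?case using u(3)[of "k n"] N by linarith
    qed
    show ?thesis
      using fatou_mass[OF form_domainD(3)[OF u(1)] weighted_ft_measurable wlim ev] e l0 by simp
  qed
  have vd: "v \<in> form_domain \<alpha> \<Omega>" using v fat[of 1] by (simp add: form_domain_def)
  have "energy \<alpha> v \<le> lam" by (rule field_le_epsilon) (use fat in blast)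
  moreover have "lam \<le> energy \<alpha> v" using low[OF vd] m1 by simp
  ultimately have "energy \<alpha> v = lam" by simp
  with that[OF vd m1] low show thesis by blast
qed

lemma frac_laplacian_form_eq:
  assumes \<Omega>: "\<Omega> \<subseteq> ball 0 R" and u: "u \<in> form_domain \<alpha> \<Omega>" and v: "v \<in> form_domain \<alpha> \<Omega>"
  shows "frac_laplacian_form \<alpha> u v = (LINT \<xi>|lborel. weighted_ft \<alpha> u \<xi> * cnj (weighted_ft \<alpha> v \<xi>))"
proof -
  note fu = fourier_eq_fourier_integral[OF form_domainD(1)[OF u] support_ball[OF \<Omega> form_domainD(2)[OF u]]]
  note fv = fourier_eq_fourier_integral[OF form_domainD(1)[OF v] support_ball[OF \<Omega> form_domainD(2)[OF v]]]
  note [measurable] = square_integrable_measurable[OF fu(2)] square_integrable_measurable[OF fv(2)]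
    square_integrable_measurable[OF form_domainD(1)[OF u]] square_integrable_measurable[OF form_domainD(1)[OF v]]
  have p: "complex_of_real (norm \<xi> powr \<alpha>) = of_real (norm \<xi> powr (\<alpha> / 2)) * of_real (norm \<xi> powr (\<alpha> / 2))" for \<xi> :: 'a
    by (simp add: powr_add[symmetric] flip: of_real_mult)
  show ?thesis
    unfolding frac_laplacian_form_def
  proof (rule integral_cong_AE)
    show "AE \<xi> in lborel. of_real (norm \<xi> powr \<alpha>) * fourier u \<xi> * cnj (fourier v \<xi>) = weighted_ft \<alpha> u \<xi> * cnj (weighted_ft \<alpha> v \<xi>)"
      using fu(1) fv(1) by eventually_elim (simp add: weighted_ft_def p mult_ac)
  qed measurable
qed

text \<open>The Euler--Lagrange equation: perturb the minimizer in the direction \<open>- s D v\<close>, where \<open>D\<close> is the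
  defect of the weak equation tested against \<open>v\<close>.\<close>

theorem ground_state_eigenfunction:
  fixes \<Omega> :: "'a::euclidean_space set"
  assumes \<Omega>: "\<Omega> \<subseteq> ball 0 R" and \<alpha>: "\<alpha> > 0"
    and u: "u \<in> form_domain \<alpha> \<Omega>" "mass u = 1"
    and min: "\<And>v. v \<in> form_domain \<alpha> \<Omega> \<Longrightarrow> energy \<alpha> u * mass v \<le> energy \<alpha> v"
  shows "frac_laplacian_eigenfunction \<Omega> \<alpha> (energy \<alpha> u) u"
  unfolding frac_laplacian_eigenfunction_def sobolev0_eq_form_domain[OF \<Omega> \<alpha>]
proof (intro conjI ballI)
  show "u \<in> form_domain \<alpha> \<Omega>" by (rule u)
  show "\<not> (AE x in lborel. u x = 0)"
  proof
    assume "AE x in lborel. u x = 0"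
    then have "mass u = mass (\<lambda>_::'a. 0)"
      by - (rule mass_cong_AE[OF form_domainD(1)[OF u(1)]], auto simp: square_integrable_def)
    with u(2) show False by (simp add: mass_def)
  qed
  fix v assume v: "v \<in> form_domain \<alpha> \<Omega>"
  define l where "l = energy \<alpha> u"
  define B where "B = (LINT \<xi>|lborel. weighted_ft \<alpha> u \<xi> * cnj (weighted_ft \<alpha> v \<xi>))"
  define I where "I = (LINT x|lborel. u x * cnj (v x))"
  define D where "D = B - of_real l * I"
  define G where "G = energy \<alpha> v - l * mass v"
  have G: "G \<ge> 0" using min[OF v] by (simp add: G_def l_def)
  have quad: "0 \<le> 2 * Re (cnj t * D) + (norm t)\<^sup>2 * G" for t
  proof -
    have "l * mass (\<lambda>x. u x + t * v x) \<le> energy \<alpha> (\<lambda>x. u x + t * v x)"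
      unfolding l_def by (rule min[OF form_domain_add_cmult(2)[OF \<Omega> u(1) v]])
    also have "energy \<alpha> (\<lambda>x. u x + t * v x) = l + 2 * Re (cnj t * B) + (norm t)\<^sup>2 * energy \<alpha> v"
      unfolding form_domain_add_cmult(1)[OF \<Omega> u(1) v] l_def B_def
      by (rule mass_add_cmult[OF form_domainD(3)[OF u(1)] form_domainD(3)[OF v]])
    also have "mass (\<lambda>x. u x + t * v x) = 1 + 2 * Re (cnj t * I) + (norm t)\<^sup>2 * mass v"
      unfolding u(2)[symmetric] I_def by (rule mass_add_cmult[OF form_domainD(1)[OF u(1)] form_domainD(1)[OF v]])
    finally show ?thesis
      by (simp add: D_def G_def algebra_simps)
  qed
  define s where "s = 1 / (1 + G)"
  have s: "s > 0" "s * G < 1" using G by (auto simp: s_def)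
  have "0 \<le> 2 * Re (cnj (- of_real s * D) * D) + (norm (- of_real s * D))\<^sup>2 * G" by (rule quad)
  also have "cnj (- of_real s * D) * D = of_real (- s * (norm D)\<^sup>2)"
    unfolding of_real_mult complex_norm_square by simp
  also have "2 * Re (of_real (- s * (norm D)\<^sup>2)) + (norm (- of_real s * D))\<^sup>2 * G = (norm D)\<^sup>2 * s * (s * G - 2)"
    using s by (simp add: norm_mult power_mult_distrib power2_eq_square algebra_simps)
  finally have "0 \<le> ((norm D)\<^sup>2 * s) * (s * G - 2)" .
  then have "(norm D)\<^sup>2 = 0"
    using s mult_pos_neg[of "(norm D)\<^sup>2 * s" "s * G - 2"] by (cases "norm D = 0") auto
  then have "D = 0" by simp
  then show "frac_laplacian_form \<alpha> u v = of_real (energy \<alpha> u) * (LINT x|lborel. u x * cnj (v x))"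
    unfolding frac_laplacian_form_eq[OF \<Omega> u(1) v] by (simp add: D_def B_def I_def l_def)
qed

text \<open>The infimum defining the eigenvalue runs over actual eigenfunctions, so a trial function bounds it only
  because the ground state is one. Eigenvalues are nonnegative, which keeps the infimum from being a
  default value.\<close>

theorem first_eigenvalue_le:
  fixes \<Omega> :: "'a::euclidean_space set"
  assumes \<Omega>: "\<Omega> \<subseteq> ball 0 R" and R: "R > 0" and \<alpha>: "\<alpha> > 0"
    and w: "w \<in> form_domain \<alpha> \<Omega>" "mass w > 0"
  shows "frac_laplacian_eigenvalue \<Omega> \<alpha> 1 * mass w \<le> energy \<alpha> w"
proof -
  obtain u where u: "u \<in> form_domain \<alpha> \<Omega>" "mass u = 1"
    and min: "\<And>v. v \<in> form_domain \<alpha> \<Omega> \<Longrightarrow> energy \<alpha> u * mass v \<le> energy \<alpha> v"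
    by (rule ground_state_exists[OF \<Omega> R \<alpha> w]) blast
  have eig: "frac_laplacian_eigenfunction \<Omega> \<alpha> (energy \<alpha> u) u"
    by (rule ground_state_eigenfunction[OF \<Omega> \<alpha> u min])
  let ?S = "{\<mu>. \<exists>u \<nu>. (\<forall>i<1::nat. frac_laplacian_eigenfunction \<Omega> \<alpha> (\<nu> i) (u i) \<and> \<nu> i \<le> \<mu>) \<and> lin_indep_ae 1 u}"
  have "lin_indep_ae 1 (\<lambda>_. u)"
  proof -
    have "c 0 = 0" if "AE x in lborel. c 0 * u x = 0" for c :: "nat \<Rightarrow> complex"
      using that eig by (auto simp: frac_laplacian_eigenfunction_def)
    then show ?thesis by (simp add: lin_indep_ae_def)
  qed
  then have mem: "energy \<alpha> u \<in> ?S"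
    using eig by (intro CollectI exI[of _ "\<lambda>_. u"] exI[of _ "\<lambda>_. energy \<alpha> u"]) simp
  have pos: "\<nu> \<ge> 0" if f: "frac_laplacian_eigenfunction \<Omega> \<alpha> \<nu> f" for \<nu> f
  proof -
    have fd: "f \<in> form_domain \<alpha> \<Omega>" and nz: "\<not> (AE x in lborel. f x = 0)"
      and eq: "frac_laplacian_form \<alpha> f f = of_real \<nu> * (LINT x|lborel. f x * cnj (f x))"
      using f by (auto simp: frac_laplacian_eigenfunction_def sobolev0_eq_form_domain[OF \<Omega> \<alpha>])
    \<comment> \<open>Testing the eigenvalue equation with the eigenfunction itself.\<close>
    have sq: "(LINT x|lborel. g x * cnj (g x)) = of_real (mass g)" for g :: "'a \<Rightarrow> complex"
      unfolding mass_def integral_complex_of_real[symmetric]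
      by (intro Bochner_Integration.integral_cong refl) (simp only: complex_norm_square)
    have "complex_of_real (energy \<alpha> f) = of_real (\<nu> * mass f)"
      using eq unfolding frac_laplacian_form_eq[OF \<Omega> fd fd] sq by simp
    then have "energy \<alpha> f = \<nu> * mass f" by (simp only: of_real_eq_iff)
    moreover have "mass f > 0"
      using mass_eq_0_AE[OF form_domainD(1)[OF fd]] nz mass_nonneg[of f] by force
    ultimately show ?thesis
      using mass_nonneg[of "weighted_ft \<alpha> f"] by (simp add: zero_le_mult_iff)
  qed
  have "bdd_below ?S"
    by (rule bdd_belowI[of _ 0]) (auto intro: order_trans[OF pos])
  then have "frac_laplacian_eigenvalue \<Omega> \<alpha> 1 \<le> energy \<alpha> u"
    unfolding frac_laplacian_eigenvalue_def using mem by (intro cInf_lower)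
  then have "frac_laplacian_eigenvalue \<Omega> \<alpha> 1 * mass w \<le> energy \<alpha> u * mass w"
    using w(2) by (intro mult_right_mono) auto
  also have "\<dots> \<le> energy \<alpha> w" by (rule min[OF w(1)])
  finally show ?thesis .
qed

section \<open>A bound on a logarithmic mean suffices\<close>

lemma power_quotient_bounds:
  fixes y s :: real
  assumes y: "y > 0" and s: "0 < s" "s < 1"
  shows "ln y \<le> (y powr s - 1) / s" "(y powr s - 1) / s \<le> y - 1"
proof -
  have "s * ln y \<le> y powr s - 1"
    using ln_le_minus_one[of "y powr s"] y by (simp add: ln_powr)
  then show "ln y \<le> (y powr s - 1) / s" using s by (simp add: field_simps)
  have "y powr s * 1 powr (1 - s) \<le> s * y + (1 - s) * 1"
    using y s by (intro Youngs_inequality_0) auto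
  then show "(y powr s - 1) / s \<le> y - 1" using s by (simp add: field_simps)
qed

lemma power_quotient_tendsto_ln:
  fixes y :: real
  assumes y: "y > 0" and s: "s \<longlonglongrightarrow> 0" "\<And>n. s n \<noteq> 0"
  shows "(\<lambda>n. (y powr s n - 1) / s n) \<longlonglongrightarrow> ln y"
proof -
  have "((\<lambda>t. y powr t) has_real_derivative ln y) (at 0)"
    by (rule derivative_eq_intros refl | use y in simp)+
  then have "((\<lambda>h. (y powr (0 + h) - y powr 0) / h) \<longlongrightarrow> ln y) (at 0)"
    by (simp add: DERIV_def)
  moreover have "filterlim s (at 0) sequentially"
    using s by (simp add: filterlim_at)
  ultimately have "(\<lambda>n. (y powr (0 + s n) - y powr 0) / s n) \<longlonglongrightarrow> ln y"
    by (rule filterlim_compose)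
  then show ?thesis using y by simp
qed

text \<open>As \<open>s \<rightarrow> 0\<close>, \<open>(E y\<^sup>s - 1) / s\<close> tends to \<open>E ln y\<close> and \<open>(c\<^sup>s - 1) / s\<close> stays above \<open>ln c\<close>. The
  positive lower bound \<open>\<epsilon>\<close> for \<open>y\<close> makes the convergence dominated.\<close>

lemma exists_small_power:
  fixes p y r :: "'a::euclidean_space \<Rightarrow> real"
  assumes p: "integrable lborel p" "(LINT z|lborel. p z) = 1" "\<And>z. p z \<ge> 0"
    and y: "y \<in> borel_measurable borel" "\<And>z. y z \<ge> \<epsilon>" "\<epsilon> > 0" "integrable lborel (\<lambda>z. p z * y z)"
    and r: "integrable lborel (\<lambda>z. p z * r z)" "\<And>z. ln (y z) \<le> r z" "(LINT z|lborel. p z * r z) < ln c" and c: "c > 0"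
  obtains s where "0 < s" "s < 1" "integrable lborel (\<lambda>z. p z * y z powr s)"
    "(LINT z|lborel. p z * y z powr s) < c powr s"
proof -
  note [measurable] = y(1)
  have [measurable]: "p \<in> borel_measurable borel" using p(1) by auto
  have y0: "y z > 0" for z using y(2)[of z] y(3) by linarith
  define s where "s n = 1 / real (Suc (Suc n))" for n
  have s: "0 < s n" "s n < 1" for n by (auto simp: s_def)
  have s0: "s \<longlonglongrightarrow> 0"
    using LIMSEQ_Suc[OF LIMSEQ_inverse_real_of_nat] by (simp add: s_def[abs_def] inverse_eq_divide)
  let ?g = "\<lambda>n z. p z * ((y z powr s n - 1) / s n)"
  let ?w = "\<lambda>z. p z * (\<bar>ln \<epsilon>\<bar> + 1) + p z * y z"
  have w: "integrable lborel ?w"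
    by (intro Bochner_Integration.integrable_add integrable_mult_left p y(4))
  have bound: "\<bar>ln (y z)\<bar> \<le> \<bar>ln \<epsilon>\<bar> + 1 + y z" "\<bar>(y z powr s n - 1) / s n\<bar> \<le> \<bar>ln \<epsilon>\<bar> + 1 + y z" for z n
  proof -
    have 1: "ln \<epsilon> \<le> ln (y z)" using y(2)[of z] y(3) y0[of z] by simp
    have 2: "ln (y z) \<le> y z - 1" by (rule ln_le_minus_one[OF y0])
    note 3 = power_quotient_bounds[OF y0 s, of z n]
    show "\<bar>ln (y z)\<bar> \<le> \<bar>ln \<epsilon>\<bar> + 1 + y z" "\<bar>(y z powr s n - 1) / s n\<bar> \<le> \<bar>ln \<epsilon>\<bar> + 1 + y z"
      using 1 2 3 y0[of z] by linarith+
  qed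
  have le_w: "\<bar>p z * t\<bar> \<le> ?w z" if "\<bar>t\<bar> \<le> \<bar>ln \<epsilon>\<bar> + 1 + y z" for t z
  proof -
    have "p z * \<bar>t\<bar> \<le> p z * (\<bar>ln \<epsilon>\<bar> + 1 + y z)" using p(3) that by (intro mult_left_mono)
    then show ?thesis using p(3)[of z] by (simp add: abs_mult algebra_simps)
  qed
  have lim: "(\<lambda>n. LINT z|lborel. ?g n z) \<longlonglongrightarrow> (LINT z|lborel. p z * ln (y z))"
  proof (rule integral_dominated_convergence[OF _ _ w])
    show "AE z in lborel. (\<lambda>n. ?g n z) \<longlonglongrightarrow> p z * ln (y z)"
      using s by (intro AE_I2 tendsto_intros power_quotient_tendsto_ln y0 s0) (simp add: less_imp_neq[symmetric])
    show "AE z in lborel. norm (?g n z) \<le> ?w z" for n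
      using le_w[OF bound(2)] by simp
  qed measurable
  have "integrable lborel (\<lambda>z. p z * ln (y z))"
  proof (rule Bochner_Integration.integrable_bound[OF w])
    show "AE z in lborel. norm (p z * ln (y z)) \<le> norm (?w z)"
      unfolding real_norm_def by (intro AE_I2 order_trans[OF le_w[OF bound(1)] abs_ge_self])
  qed measurable
  then have "(LINT z|lborel. p z * ln (y z)) \<le> (LINT z|lborel. p z * r z)"
    using r(1,2) p(3) by (intro integral_mono mult_left_mono) auto
  also have "\<dots> < ln c" by (rule r(3))
  finally have "eventually (\<lambda>n. (LINT z|lborel. ?g n z) < ln c) sequentially"
    by (intro order_tendstoD(2)[OF lim])
  then obtain n where n: "(LINT z|lborel. ?g n z) < ln c" by (auto simp: eventually_sequentially)
  have gi: "integrable lborel (?g n)"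
  proof (rule Bochner_Integration.integrable_bound[OF w])
    show "AE z in lborel. norm (?g n z) \<le> norm (?w z)"
      unfolding real_norm_def by (intro AE_I2 order_trans[OF le_w[OF bound(2)] abs_ge_self])
  qed measurable
  have eq: "p z * y z powr s n = s n * ?g n z + p z" for z
    using s(1)[of n] by (simp add: field_simps)
  show thesis
  proof
    show "0 < s n" "s n < 1" by (rule s)+
    show "integrable lborel (\<lambda>z. p z * y z powr s n)"
      unfolding eq by (intro Bochner_Integration.integrable_add integrable_mult_right gi p)
    have "(LINT z|lborel. p z * y z powr s n) = s n * (LINT z|lborel. ?g n z) + 1"
      unfolding eq by (subst Bochner_Integration.integral_add[OF integrable_mult_right[OF gi] p(1)]) (simp only: integral_mult_right_zero p(2))
    also have "\<dots> < s n * ln c + 1" by (intro add_strict_right_mono mult_strict_left_mono n s)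
    also have "\<dots> \<le> c powr s n"
      using power_quotient_bounds(1)[OF c s, of n] s(1)[of n] by (simp add: field_simps)
    finally show "(LINT z|lborel. p z * y z powr s n) < c powr s n" .
  qed
qed

text \<open>The right-hand side is the two-point Radau quadrature of \<open>ln y = \<integral>\<^sub>0\<^sup>1 (y - 1) / (1 + t (y - 1)) dt\<close>; it
  touches the logarithm to third order at \<open>1\<close>, the difference having derivative
  \<open>(y - 1)\<^sup>3 / (y (1 + 2 y)\<^sup>2)\<close>.\<close>

lemma ln_le_radau:
  fixes y :: real
  assumes y: "y > 0"
  shows "ln y \<le> (y - 1) / 4 + 9 / 8 - 27 / (8 * (1 + 2 * y))"
proof -
  define f where "f y = (y - 1) / 4 + 9 / 8 - 27 / (8 * (1 + 2 * y)) - ln y" for y :: real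
  have D: "(f has_real_derivative (x - 1) ^ 3 / (x * (1 + 2 * x)\<^sup>2)) (at x)" if x: "x > 0" for x
  proof -
    have "(f has_real_derivative 1 / 4 + 27 * 16 / (8 * (1 + 2 * x))\<^sup>2 - 1 / x) (at x)"
      unfolding f_def using x
      by (auto intro!: derivative_eq_intros simp: power2_eq_square)
    also have "1 / 4 + 27 * 16 / (8 * (1 + 2 * x))\<^sup>2 - 1 / x = (x - 1) ^ 3 / (x * (1 + 2 * x)\<^sup>2)"
    proof -
      have "(8 * (1 + 2 * x))\<^sup>2 = 64 * (1 + 2 * x)\<^sup>2" by (simp only: power_mult_distrib) simp
      moreover have "(1 + 2 * x)\<^sup>2 > 0" using x by simp
      moreover have "x * (1 + 2 * x)\<^sup>2 + 27 * x - 4 * (1 + 2 * x)\<^sup>2 = 4 * (x - 1) ^ 3"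
        by (simp add: power2_eq_square power3_eq_cube algebra_simps)
      ultimately show ?thesis using x by (simp add: field_simps)
    qed
    finally show ?thesis .
  qed
  have "f 1 \<le> f y"
  proof (cases "y \<ge> 1")
    case True
    then show ?thesis
    proof (rule DERIV_nonneg_imp_nondecreasing)
      fix x assume "1 \<le> x" "x \<le> y"
      then show "\<exists>d. (f has_real_derivative d) (at x) \<and> d \<ge> 0"
        using D[of x] by (intro exI[of _ "(x - 1) ^ 3 / (x * (1 + 2 * x)\<^sup>2)"]) auto
    qed
  next
    case False
    then have "y \<le> 1" by simp
    then show ?thesis
    proof (rule DERIV_nonpos_imp_nonincreasing)
      fix x assume x: "y \<le> x" "x \<le> 1"
      then have "x > 0" using y by linarith
      moreover have "(x - 1) ^ 3 \<le> 0"
      proof -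
        have "0 \<le> (1 - x) ^ 3" using x by simp
        moreover have "(x - 1) ^ 3 = - ((1 - x) ^ 3)" by (simp add: power3_eq_cube algebra_simps)
        ultimately show ?thesis by simp
      qed
      ultimately show "\<exists>d. (f has_real_derivative d) (at x) \<and> d \<le> 0"
        using D[of x] by (intro exI[of _ "(x - 1) ^ 3 / (x * (1 + 2 * x)\<^sup>2)"]) (auto intro: divide_nonpos_nonneg)
    qed
  qed
  moreover have "f 1 = 0" by (simp add: f_def)
  ultimately show ?thesis by (simp add: f_def)
qed

section \<open>Functions of one variable on an interval\<close>

text \<open>Smooth profiles cut off to \<open>[-L, L]\<close>. Since the cutoff is sharp, derivatives are taken of \<open>P\<close> on the
  whole line and cut off afterwards.\<close>

definition on_ivl :: "real \<Rightarrow> (real \<Rightarrow> real) \<Rightarrow> real \<Rightarrow> complex" where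
  "on_ivl L P x = of_real (P x * indicator {-L..L} x)"

lemma on_ivl_measurable:
  assumes "continuous_on UNIV P"
  shows "on_ivl L P \<in> borel_measurable borel"
proof -
  have [measurable]: "P \<in> borel_measurable borel" by (intro borel_measurable_continuous_onI assms)
  show ?thesis unfolding on_ivl_def[abs_def] by measurable
qed

lemma on_ivl_square_integrable:
  assumes P: "continuous_on UNIV P"
  shows "square_integrable (on_ivl L P)"
proof -
  have "compact (P ` {-L..L})"
    by (intro compact_continuous_image continuous_on_subset[OF P]) auto
  then obtain M where M: "\<And>x. x \<in> {-L..L} \<Longrightarrow> \<bar>P x\<bar> \<le> M"
    using compact_imp_bounded by (force simp: bounded_iff)
  show ?thesis
  proof (rule compact_support_square_integrable[OF on_ivl_measurable[OF P]])
    show "norm (on_ivl L P x) \<le> \<bar>M\<bar>" for x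
      using M[of x] by (cases "x \<in> {-L..L}") (auto simp: on_ivl_def indicator_def)
    show "x \<notin> ball 0 (\<bar>L\<bar> + 1) \<Longrightarrow> on_ivl L P x = 0" for x
      by (auto simp: on_ivl_def indicator_def)
  qed
qed

lemma on_ivl_integrable:
  assumes P: "continuous_on UNIV P"
  shows "integrable lborel (on_ivl L P)"
  by (rule bounded_support_integrable[OF on_ivl_square_integrable[OF P], of "\<bar>L\<bar> + 1"])
     (auto simp: on_ivl_def indicator_def)

lemma integral_on_ivl:
  assumes L: "L \<ge> 0" and F: "\<And>x. (F has_real_derivative g x) (at x)" and g: "continuous_on UNIV g"
  shows "(LINT x|lborel. g x * indicator {-L..L} x) = F L - F (-L)"
  using L F g by (intro integral_FTC_Icc_real) (auto intro: has_field_derivative_at_within simp: continuous_on_eq_continuous_at)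

lemma mass_on_ivl:
  assumes "L \<ge> 0" "\<And>x. (F has_real_derivative (P x)\<^sup>2) (at x)" "continuous_on UNIV P"
  shows "mass (on_ivl L P) = F L - F (-L)"
proof -
  have "mass (on_ivl L P) = (LINT x|lborel. (P x)\<^sup>2 * indicator {-L..L} x)"
    unfolding mass_def by (intro Bochner_Integration.integral_cong refl) (auto simp: on_ivl_def indicator_def)
  also have "\<dots> = F L - F (-L)"
    using assms by (intro integral_on_ivl continuous_intros)
  finally show ?thesis .
qed

text \<open>Integration by parts; the boundary terms vanish because \<open>P\<close> is zero at the endpoints.\<close>

lemma fourier_integral_deriv_on_ivl:
  assumes L: "L \<ge> 0" and D: "\<And>x. (P has_real_derivative P' x) (at x)" and P': "continuous_on UNIV P'"
    and zero: "P L = 0" "P (-L) = 0"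
  shows "fourier_integral (on_ivl L P') \<xi> = \<i> * of_real \<xi> * fourier_integral (on_ivl L P) \<xi>"
proof -
  have P: "continuous_on UNIV P"
    by (intro continuous_at_imp_continuous_on ballI DERIV_isCont[OF D])
  let ?e = "\<lambda>x::real. exp (- \<i> * of_real (x * \<xi>))"
  have i1: "integrable lborel (\<lambda>x. on_ivl L P x * ?e x)" and i2: "integrable lborel (\<lambda>x. on_ivl L P' x * ?e x)"
    using fourier_integrand_integrable[OF on_ivl_integrable[OF P], of L \<xi>]
      fourier_integrand_integrable[OF on_ivl_integrable[OF P'], of L \<xi>] by simp_all
  let ?f = "\<lambda>x. of_real (P' x) * ?e x - \<i> * of_real \<xi> * (of_real (P x) * ?e x)"
  have "(LINT x|lborel. indicator {-L..L} x *\<^sub>R ?f x) = of_real (P L) * ?e L - of_real (P (-L)) * ?e (-L)"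
  proof (rule integral_FTC_Icc)
    show "-L \<le> L" using L by simp
    show "((\<lambda>x. of_real (P x) * ?e x) has_vector_derivative ?f x) (at x within {-L..L})" for x
    proof -
      have 1: "((\<lambda>x. complex_of_real (P x)) has_vector_derivative of_real (P' x)) (at x within {-L..L})"
        by (rule has_vector_derivative_of_real[OF D[of x, THEN has_field_derivative_at_within]])
      have "((\<lambda>z. exp (- \<i> * (z * of_real \<xi>))) has_field_derivative - \<i> * of_real \<xi> * exp (- \<i> * (of_real x * of_real \<xi>))) (at (of_real x))"
        by (auto intro!: derivative_eq_intros)
      then have 2: "(?e has_vector_derivative - \<i> * of_real \<xi> * ?e x) (at x within {-L..L})"
        using has_vector_derivative_real_field[of "\<lambda>z. exp (- \<i> * (z * of_real \<xi>))" _ x "{-L..L}"] by simp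
      show ?thesis
        using has_vector_derivative_mult[OF 1 2] by (simp add: algebra_simps)
    qed
    show "continuous_on {-L..L} ?f"
      by (intro continuous_intros continuous_on_subset[OF P] continuous_on_subset[OF P']) auto
  qed
  also have "\<dots> = 0" by (simp add: zero)
  also have "(LINT x|lborel. indicator {-L..L} x *\<^sub>R ?f x) =
      (LINT x|lborel. on_ivl L P' x * ?e x - \<i> * of_real \<xi> * (on_ivl L P x * ?e x))"
    by (intro Bochner_Integration.integral_cong refl) (auto simp: on_ivl_def indicator_def)
  also have "\<dots> = (LINT x|lborel. on_ivl L P' x * ?e x) - \<i> * of_real \<xi> * (LINT x|lborel. on_ivl L P x * ?e x)"
    by (subst Bochner_Integration.integral_diff[OF i2 integrable_mult_right[OF i1]]) (simp only: integral_mult_right_zero)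
  finally show ?thesis
    by (simp add: fourier_integral_def)
qed

lemma plancherel_Re_inner:
  fixes u v :: "'a::euclidean_space \<Rightarrow> complex"
  assumes u: "integrable lborel u" "square_integrable u" and v: "integrable lborel v" "square_integrable v"
  shows "Re (LINT \<xi>|lborel. fourier_integral u \<xi> * cnj (fourier_integral v \<xi>)) = Re (LINT x|lborel. u x * cnj (v x))"
proof -
  have uv: "integrable lborel (\<lambda>x. u x + 1 * v x)" "square_integrable (\<lambda>x. u x + 1 * v x)"
    using u v by (auto intro: square_integrable_add)
  have m: "mass (fourier_integral f) = mass f" if "integrable lborel f" "square_integrable f" for f :: "'a \<Rightarrow> complex"
    using plancherel[OF that] by (simp add: mass_def)
  have "fourier_integral (\<lambda>x. u x + 1 * v x) = (\<lambda>\<xi>. fourier_integral u \<xi> + 1 * fourier_integral v \<xi>)"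
    by (intro ext fourier_integral_add_cmult u v)
  then have "mass (\<lambda>\<xi>. fourier_integral u \<xi> + 1 * fourier_integral v \<xi>) = mass (\<lambda>x. u x + 1 * v x)"
    using m[OF uv] by simp
  then show ?thesis
    unfolding mass_add_cmult[OF u(2) v(2)] mass_add_cmult[OF plancherel_square_integrable[OF u] plancherel_square_integrable[OF v]]
      m[OF u] m[OF v] by simp
qed

lemma frequency_moment:
  assumes L: "L \<ge> 0" and D: "\<And>x. (P has_real_derivative P' x) (at x)" and P': "continuous_on UNIV P'"
    and zero: "P L = 0" "P (-L) = 0"
  shows "integrable lborel (\<lambda>\<xi>. \<xi>\<^sup>2 * (norm (fourier_integral (on_ivl L P) \<xi>))\<^sup>2)"
    and "(LINT \<xi>|lborel. \<xi>\<^sup>2 * (norm (fourier_integral (on_ivl L P) \<xi>))\<^sup>2) = mass (on_ivl L P')"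
proof -
  have eq: "\<xi>\<^sup>2 * (norm (fourier_integral (on_ivl L P) \<xi>))\<^sup>2 = (norm (fourier_integral (on_ivl L P') \<xi>))\<^sup>2" for \<xi>
    unfolding fourier_integral_deriv_on_ivl[OF assms] by (simp add: norm_mult power_mult_distrib)
  note p = on_ivl_integrable[OF P', of L] on_ivl_square_integrable[OF P', of L]
  show "integrable lborel (\<lambda>\<xi>. \<xi>\<^sup>2 * (norm (fourier_integral (on_ivl L P) \<xi>))\<^sup>2)"
    unfolding eq by (intro square_integrable_norm_sq plancherel_square_integrable p)
  show "(LINT \<xi>|lborel. \<xi>\<^sup>2 * (norm (fourier_integral (on_ivl L P) \<xi>))\<^sup>2) = mass (on_ivl L P')"
    unfolding eq mass_def by (rule plancherel[OF p])
qed

text \<open>A dual variational bound: \<open>\<bar>a\<bar>\<^sup>2 / k \<ge> 2 Re (a b\<^sup>*) - k \<bar>b\<bar>\<^sup>2\<close> pointwise, with \<open>k = \<kappa> + \<xi>\<^sup>2\<close>.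
  Its optimal \<open>w\<close> solves \<open>\<kappa> w - w'' = u\<close>.\<close>

lemma resolvent_lower_bound:
  assumes u: "integrable lborel u" "square_integrable u" and \<kappa>: "\<kappa> > 0"
    and L: "L \<ge> 0" and D: "\<And>x. (P has_real_derivative P' x) (at x)" and P': "continuous_on UNIV P'"
    and zero: "P L = 0" "P (-L) = 0"
  shows "integrable lborel (\<lambda>\<xi>. (norm (fourier_integral u \<xi>))\<^sup>2 / (\<kappa> + \<xi>\<^sup>2))"
    and "2 * Re (LINT x|lborel. u x * cnj (on_ivl L P x)) - \<kappa> * mass (on_ivl L P) - mass (on_ivl L P')
      \<le> (LINT \<xi>|lborel. (norm (fourier_integral u \<xi>))\<^sup>2 / (\<kappa> + \<xi>\<^sup>2))"
proof -
  have P: "continuous_on UNIV P"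
    by (intro continuous_at_imp_continuous_on ballI DERIV_isCont[OF D])
  note p = on_ivl_integrable[OF P, of L] on_ivl_square_integrable[OF P, of L]
  let ?U = "fourier_integral u" and ?W = "fourier_integral (on_ivl L P)"
  note U = plancherel_square_integrable[OF u] and W = plancherel_square_integrable[OF p]
  note [measurable] = square_integrable_measurable[OF U]
  have k: "\<kappa> + \<xi>\<^sup>2 > 0" for \<xi> using \<kappa> by (intro add_pos_nonneg) auto
  show I: "integrable lborel (\<lambda>\<xi>. (norm (?U \<xi>))\<^sup>2 / (\<kappa> + \<xi>\<^sup>2))"
  proof (rule Bochner_Integration.integrable_bound[OF integrable_divide[OF square_integrable_norm_sq[OF U], of \<kappa>]])
    show "AE \<xi> in lborel. norm ((norm (?U \<xi>))\<^sup>2 / (\<kappa> + \<xi>\<^sup>2)) \<le> norm ((norm (?U \<xi>))\<^sup>2 / \<kappa>)"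
      using \<kappa> k by (intro AE_I2) (simp add: abs_of_pos divide_left_mono)
  qed measurable
  have iUW: "integrable lborel (\<lambda>\<xi>. ?U \<xi> * cnj (?W \<xi>))" by (rule square_integrable_mult_cnj[OF U W])
  have iW: "integrable lborel (\<lambda>\<xi>. (norm (?W \<xi>))\<^sup>2)" by (rule square_integrable_norm_sq[OF W])
  note iM = frequency_moment[OF L D P' zero]
  have "2 * Re (LINT x|lborel. u x * cnj (on_ivl L P x)) - \<kappa> * mass (on_ivl L P) - mass (on_ivl L P') =
     2 * Re (LINT \<xi>|lborel. ?U \<xi> * cnj (?W \<xi>)) - \<kappa> * (LINT \<xi>|lborel. (norm (?W \<xi>))\<^sup>2) - (LINT \<xi>|lborel. \<xi>\<^sup>2 * (norm (?W \<xi>))\<^sup>2)"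
    by (simp add: plancherel_Re_inner[OF u p] plancherel[OF p] iM(2) mass_def)
  also have "\<dots> = (LINT \<xi>|lborel. 2 * Re (?U \<xi> * cnj (?W \<xi>)) - \<kappa> * (norm (?W \<xi>))\<^sup>2 - \<xi>\<^sup>2 * (norm (?W \<xi>))\<^sup>2)"
    using iUW iW iM(1) by (simp del: times_complex.sel)
  also have "\<dots> \<le> (LINT \<xi>|lborel. (norm (?U \<xi>))\<^sup>2 / (\<kappa> + \<xi>\<^sup>2))"
  proof (rule integral_mono[OF _ I])
    show "integrable lborel (\<lambda>\<xi>. 2 * Re (?U \<xi> * cnj (?W \<xi>)) - \<kappa> * (norm (?W \<xi>))\<^sup>2 - \<xi>\<^sup>2 * (norm (?W \<xi>))\<^sup>2)"
      using iUW iW iM(1) by (simp del: times_complex.sel)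
    fix \<xi>
    define q where "q = \<kappa> + \<xi>\<^sup>2"
    have q: "q > 0" using k by (simp add: q_def)
    have "Re (?U \<xi> * cnj (?W \<xi>)) \<le> norm (?U \<xi>) * norm (?W \<xi>)"
      using complex_Re_le_cmod[of "?U \<xi> * cnj (?W \<xi>)"] by (simp only: norm_mult complex_mod_cnj)
    moreover have "2 * (norm (?U \<xi>) * norm (?W \<xi>)) - q * (norm (?W \<xi>))\<^sup>2 \<le> (norm (?U \<xi>))\<^sup>2 / q"
    proof -
      have "0 \<le> (norm (?U \<xi>) - q * norm (?W \<xi>))\<^sup>2 / q" using q by simp
      also have "\<dots> = (norm (?U \<xi>))\<^sup>2 / q - 2 * (norm (?U \<xi>) * norm (?W \<xi>)) + q * (norm (?W \<xi>))\<^sup>2"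
        using q by (simp add: power2_eq_square field_simps)
      finally show ?thesis by linarith
    qed
    ultimately show "2 * Re (?U \<xi> * cnj (?W \<xi>)) - \<kappa> * (norm (?W \<xi>))\<^sup>2 - \<xi>\<^sup>2 * (norm (?W \<xi>))\<^sup>2 \<le> (norm (?U \<xi>))\<^sup>2 / (\<kappa> + \<xi>\<^sup>2)"
      unfolding q_def distrib_right by linarith
  qed
  finally show "2 * Re (LINT x|lborel. u x * cnj (on_ivl L P x)) - \<kappa> * mass (on_ivl L P) - mass (on_ivl L P')
      \<le> (LINT \<xi>|lborel. (norm (?U \<xi>))\<^sup>2 / (\<kappa> + \<xi>\<^sup>2))" .
qed

section \<open>The one-dimensional profile\<close>

text \<open>The profile of the trial function must concentrate its transform well. The constant profile has
  infinite second moment in frequency, while the first Dirichlet eigenfunction, the cosine, has a larger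
  logarithmic mean than this parabola.\<close>

abbreviation profile :: "real \<Rightarrow> complex" where
  "profile \<equiv> on_ivl 1 (\<lambda>x. 1 - x\<^sup>2)"

lemma
  shows profile_integrable: "integrable lborel profile"
    and profile_square_integrable: "square_integrable profile"
    and mass_profile: "mass profile = 16 / 15"
    and profile_moment_integrable: "integrable lborel (\<lambda>\<xi>. \<xi>\<^sup>2 * (norm (fourier_integral profile \<xi>))\<^sup>2)"
    and profile_moment: "(LINT \<xi>|lborel. \<xi>\<^sup>2 * (norm (fourier_integral profile \<xi>))\<^sup>2) = 8 / 3"
proof -
  have c: "continuous_on UNIV (\<lambda>x::real. 1 - x\<^sup>2)" "continuous_on UNIV (\<lambda>x::real. - 2 * x)"
    by (intro continuous_intros)+
  show "integrable lborel profile" "square_integrable profile"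
    by (intro on_ivl_integrable on_ivl_square_integrable c)+
  have "mass profile = (\<lambda>x. x - 2 * x ^ 3 / 3 + x ^ 5 / 5) 1 - (\<lambda>x. x - 2 * x ^ 3 / 3 + x ^ 5 / 5) (-1)"
    by (rule mass_on_ivl[OF _ _ c(1)])
       (auto intro!: derivative_eq_intros simp: power2_eq_square algebra_simps eval_nat_numeral)
  then show "mass profile = 16 / 15" by simp
  have D: "((\<lambda>x. 1 - x\<^sup>2) has_real_derivative - 2 * x) (at x)" for x :: real
    by (auto intro!: derivative_eq_intros)
  have "mass (on_ivl 1 (\<lambda>x. - 2 * x)) = (\<lambda>x. 4 * x ^ 3 / 3) 1 - (\<lambda>x. 4 * x ^ 3 / 3) (-1)"
    by (rule mass_on_ivl[OF _ _ c(2)])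
       (auto intro!: derivative_eq_intros simp: power2_eq_square algebra_simps eval_nat_numeral)
  then have "mass (on_ivl 1 (\<lambda>x. - 2 * x)) = 8 / 3" by simp
  then show "integrable lborel (\<lambda>\<xi>. \<xi>\<^sup>2 * (norm (fourier_integral profile \<xi>))\<^sup>2)"
    "(LINT \<xi>|lborel. \<xi>\<^sup>2 * (norm (fourier_integral profile \<xi>))\<^sup>2) = 8 / 3"
    using frequency_moment[OF _ D c(2), of 1] by simp_all
qed

text \<open>Even polynomials on \<open>[-5/2, 5/2]\<close> are expanded in powers of \<open>q = 1 - x\<^sup>2 / (5/2)\<^sup>2\<close>. These vanish at the
  endpoints, so integration by parts yields a two-term recursion for their primitives, and the exact
  rational integrals below come without expanding in powers of \<open>x\<close>.\<close>

definition q :: "real \<Rightarrow> real" where "q x = 1 - 4 * x\<^sup>2 / 25"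

primrec q_primitive :: "nat \<Rightarrow> real \<Rightarrow> real" where
  "q_primitive 0 x = x"
| "q_primitive (Suc k) x = (x * q x ^ Suc k + 2 * (real k + 1) * q_primitive k x) / (2 * real k + 3)"

lemma q_deriv: "(q has_real_derivative - 8 * x / 25) (at x)"
  unfolding q_def by (auto intro!: derivative_eq_intros)

lemma q_primitive_deriv: "(q_primitive k has_real_derivative q x ^ k) (at x)"
proof (induction k)
  case (Suc k)
  have "((\<lambda>x. (x * q x ^ Suc k + 2 * (real k + 1) * q_primitive k x) / (2 * real k + 3)) has_real_derivative
      (q x ^ Suc k + x * (real (Suc k) * q x ^ k * (- 8 * x / 25)) + 2 * (real k + 1) * q x ^ k) / (2 * real k + 3)) (at x)"
    by (rule derivative_eq_intros q_deriv Suc.IH refl | simp add: mult_ac add_ac)+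
  also have "(q x ^ Suc k + x * (real (Suc k) * q x ^ k * (- 8 * x / 25)) + 2 * (real k + 1) * q x ^ k) / (2 * real k + 3) = q x ^ Suc k"
  proof -
    have "q x ^ Suc k + x * (real (Suc k) * q x ^ k * (- 8 * x / 25)) + 2 * (real k + 1) * q x ^ k
       = q x ^ k * (q x + 2 * (real k + 1) * (1 - 4 * x\<^sup>2 / 25))"
      by (simp add: power2_eq_square algebra_simps)
    also have "\<dots> = (2 * real k + 3) * q x ^ Suc k"
      by (simp add: q_def[symmetric] algebra_simps)
    finally show ?thesis by (simp add: divide_eq_eq)
  qed
  finally show ?case by (simp only: q_primitive.simps[abs_def])
qed (simp add: DERIV_ident)

lemma q_primitive_uminus: "q_primitive k (- x) = - q_primitive k x"
proof (induction k)
  case (Suc k)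
  have "q (- x) = q x" by (simp add: q_def)
  then show ?case
    unfolding q_primitive.simps Suc.IH by (simp add: minus_divide_left)
qed simp

lemma q_values: "q (5/2) = 0" "q 1 = 21 / 25"
  by (simp_all add: q_def power2_eq_square)

lemma q_primitive_endpoint:
  shows "q_primitive (Suc 0) (5/2) = 5 / 3"
    and "q_primitive 2 (5/2) = 4 / 3"
    and "q_primitive 3 (5/2) = 8 / 7"
    and "q_primitive 4 (5/2) = 64 / 63"
    and "q_primitive 5 (5/2) = 640 / 693"
    and "q_primitive 6 (5/2) = 2560 / 3003"
    and "q_primitive 7 (5/2) = 1024 / 1287"
    and "q_primitive 8 (5/2) = 16384 / 21879"
    and "q_primitive 9 (5/2) = 32768 / 46189"
    and "q_primitive 10 (5/2) = 655360 / 969969"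
proof -
  show v1: "q_primitive (Suc 0) (5/2) = 5 / 3"
    using q_primitive.simps(2)[of 0 "5/2"] by (simp add: q_values power_divide)
  show v2: "q_primitive 2 (5/2) = 4 / 3"
    using q_primitive.simps(2)[of "Suc 0" "5/2"] v1 by (simp add: q_values power_divide numeral_2_eq_2)
  show v3: "q_primitive 3 (5/2) = 8 / 7"
    using q_primitive.simps(2)[of 2 "5/2"] v2 by (simp add: q_values power_divide)
  show v4: "q_primitive 4 (5/2) = 64 / 63"
    using q_primitive.simps(2)[of 3 "5/2"] v3 by (simp add: q_values power_divide)
  show v5: "q_primitive 5 (5/2) = 640 / 693"
    using q_primitive.simps(2)[of 4 "5/2"] v4 by (simp add: q_values power_divide)
  show v6: "q_primitive 6 (5/2) = 2560 / 3003"
    using q_primitive.simps(2)[of 5 "5/2"] v5 by (simp add: q_values power_divide)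
  show v7: "q_primitive 7 (5/2) = 1024 / 1287"
    using q_primitive.simps(2)[of 6 "5/2"] v6 by (simp add: q_values power_divide)
  show v8: "q_primitive 8 (5/2) = 16384 / 21879"
    using q_primitive.simps(2)[of 7 "5/2"] v7 by (simp add: q_values power_divide)
  show v9: "q_primitive 9 (5/2) = 32768 / 46189"
    using q_primitive.simps(2)[of 8 "5/2"] v8 by (simp add: q_values power_divide)
  show v10: "q_primitive 10 (5/2) = 655360 / 969969"
    using q_primitive.simps(2)[of 9 "5/2"] v9 by (simp add: q_values power_divide)
qed

lemma q_primitive_at_1:
  shows "q_primitive (Suc 0) 1 = 71 / 75"
    and "q_primitive 2 1 = 8423 / 9375"
    and "q_primitive 3 1 = 93491 / 109375"
    and "q_primitive 4 1 = 20059567 / 24609375"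
    and "q_primitive 5 1 = 5272190113 / 6767578125"
    and "q_primitive 6 1 = 547030985251 / 733154296875"
proof -
  show v1: "q_primitive (Suc 0) 1 = 71 / 75"
    using q_primitive.simps(2)[of 0 1] by (simp add: q_values power_divide)
  show v2: "q_primitive 2 1 = 8423 / 9375"
    using q_primitive.simps(2)[of "Suc 0" 1] v1 by (simp add: q_values power_divide numeral_2_eq_2)
  show v3: "q_primitive 3 1 = 93491 / 109375"
    using q_primitive.simps(2)[of 2 1] v2 by (simp add: q_values power_divide)
  show v4: "q_primitive 4 1 = 20059567 / 24609375"
    using q_primitive.simps(2)[of 3 1] v3 by (simp add: q_values power_divide)
  show v5: "q_primitive 5 1 = 5272190113 / 6767578125"
    using q_primitive.simps(2)[of 4 1] v4 by (simp add: q_values power_divide)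
  show v6: "q_primitive 6 1 = 547030985251 / 733154296875"
    using q_primitive.simps(2)[of 5 1] v5 by (simp add: q_values power_divide)
qed

text \<open>A polynomial approximation to the exponentially decaying solution \<open>w\<close> of \<open>9/4 w - w'' = 1 - x\<^sup>2\<close> (with
  right-hand side cut off to \<open>[-1, 1]\<close>). The interval and the coefficients were chosen by numerically
  maximizing the lower bound of \<open>resolvent_lower_bound\<close>.\<close>

definition probe :: "real \<Rightarrow> real" where
  "probe x = 11 / 250 * (q x + 5 * q x ^ 5)"

definition probe_deriv :: "real \<Rightarrow> real" where
  "probe_deriv x = 11 / 250 * (1 + 25 * q x ^ 4) * (- 8 * x / 25)"

lemma probe_deriv: "(probe has_real_derivative probe_deriv x) (at x)"
  unfolding probe_def probe_deriv_def
  by (rule derivative_eq_intros q_deriv refl | simp add: algebra_simps)+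

lemma continuous_q: "continuous_on A q"
  unfolding q_def by (intro continuous_intros) auto

lemma continuous_probe_deriv: "continuous_on UNIV probe_deriv" "continuous_on UNIV probe"
  unfolding probe_deriv_def probe_def by (intro continuous_intros continuous_q; simp)+

lemma mass_probe: "mass (on_ivl (5/2) probe) = 142703506 / 1377796875"
proof -
  let ?F = "\<lambda>x. 121 / 62500 * (q_primitive 2 x + 10 * q_primitive 6 x + 25 * q_primitive 10 x)"
  have "mass (on_ivl (5/2) probe) = ?F (5/2) - ?F (-(5/2))"
  proof (rule mass_on_ivl[OF _ _ continuous_probe_deriv(2)])
    show "(?F has_real_derivative (probe x)\<^sup>2) (at x)" for x
      unfolding probe_def
      by (rule derivative_eq_intros q_primitive_deriv refl | simp add: power2_eq_square algebra_simps eval_nat_numeral)+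
  qed simp
  also have "\<dots> = 142703506 / 1377796875"
    unfolding q_primitive_uminus One_nat_def q_primitive_endpoint q_primitive.simps(1) by simp
  finally show ?thesis .
qed

lemma mass_probe_deriv: "mass (on_ivl (5/2) probe_deriv) = 1540734316 / 20666953125"
proof -
  let ?F = "\<lambda>x. 121 / 62500 * (16 / 25) * (q_primitive 0 x - q_primitive 1 x + 50 * (q_primitive 4 x - q_primitive 5 x)
      + 625 * (q_primitive 8 x - q_primitive 9 x))"
  have "mass (on_ivl (5/2) probe_deriv) = ?F (5/2) - ?F (-(5/2))"
  proof (rule mass_on_ivl[OF _ _ continuous_probe_deriv(1)])
    fix x
    have "(?F has_real_derivative 121 / 62500 * (16 / 25) * (q x ^ 0 - q x ^ 1 + 50 * (q x ^ 4 - q x ^ 5) + 625 * (q x ^ 8 - q x ^ 9))) (at x)"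
      by (intro DERIV_cmult DERIV_add DERIV_diff q_primitive_deriv)
    also have "121 / 62500 * (16 / 25) * (q x ^ 0 - q x ^ 1 + 50 * (q x ^ 4 - q x ^ 5) + 625 * (q x ^ 8 - q x ^ 9)) = (probe_deriv x)\<^sup>2"
    proof -
      have "(- 8 * x / 25)\<^sup>2 = 16 / 25 * (1 - q x)" by (simp add: q_def power2_eq_square)
      then have "(probe_deriv x)\<^sup>2 = (11 / 250 * (1 + 25 * q x ^ 4))\<^sup>2 * (16 / 25 * (1 - q x))"
        unfolding probe_deriv_def by (simp only: power_mult_distrib)
      also have "\<dots> = 121 / 62500 * (16 / 25) * (q x ^ 0 - q x ^ 1 + 50 * (q x ^ 4 - q x ^ 5) + 625 * (q x ^ 8 - q x ^ 9))"
        by (simp add: power2_eq_square field_simps eval_nat_numeral)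
      finally show ?thesis by simp
    qed
    finally show "(?F has_real_derivative (probe_deriv x)\<^sup>2) (at x)" .
  qed simp
  also have "\<dots> = 1540734316 / 20666953125"
    unfolding q_primitive_uminus One_nat_def q_primitive_endpoint q_primitive.simps(1) by simp
  finally show ?thesis .
qed

lemma profile_probe: "Re (LINT x|lborel. profile x * cnj (on_ivl (5/2) probe x)) = 20600452492 / 66650390625"
proof -
  let ?g = "\<lambda>x. (1 - x\<^sup>2) * probe x"
  let ?F = "\<lambda>x. 11 / 250 * (25 / 4 * (q_primitive 2 x + 5 * q_primitive 6 x) - 21 / 4 * (q_primitive 1 x + 5 * q_primitive 5 x))"
  have "(LINT x|lborel. profile x * cnj (on_ivl (5/2) probe x)) = (LINT x|lborel. complex_of_real (?g x * indicator {-1..1} x))"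
    by (intro Bochner_Integration.integral_cong refl) (auto simp: on_ivl_def indicator_def)
  then have "Re (LINT x|lborel. profile x * cnj (on_ivl (5/2) probe x)) = (LINT x|lborel. ?g x * indicator {-1..1} x)"
    by (simp only: integral_complex_of_real Re_complex_of_real)
  also have "\<dots> = ?F 1 - ?F (-1)"
  proof (rule integral_on_ivl)
    fix x
    have "(?F has_real_derivative 11 / 250 * (25 / 4 * (q x ^ 2 + 5 * q x ^ 6) - 21 / 4 * (q x ^ 1 + 5 * q x ^ 5))) (at x)"
      by (intro DERIV_cmult DERIV_add DERIV_diff q_primitive_deriv)
    also have "11 / 250 * (25 / 4 * (q x ^ 2 + 5 * q x ^ 6) - 21 / 4 * (q x ^ 1 + 5 * q x ^ 5)) = ?g x"
    proof -
      \<comment> \<open>On \<open>[-1, 1]\<close> the profile itself is affine in \<open>q\<close>.\<close>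
      have "1 - x\<^sup>2 = 25 / 4 * q x - 21 / 4" by (simp add: q_def field_simps)
      then have "?g x = (25 / 4 * q x - 21 / 4) * (11 / 250 * (q x + 5 * q x ^ 5))" unfolding probe_def by simp
      then show ?thesis by (simp only:) (simp add: field_simps eval_nat_numeral)
    qed
    finally show "(?F has_real_derivative ?g x) (at x)" .
  qed (auto intro!: continuous_intros continuous_probe_deriv)
  also have "\<dots> = 20600452492 / 66650390625"
    unfolding q_primitive_uminus One_nat_def q_primitive_at_1 by simp
  finally show ?thesis .
qed

lemma profile_resolvent:
  shows "integrable lborel (\<lambda>\<xi>. (norm (fourier_integral profile \<xi>))\<^sup>2 / (9/4 + \<xi>\<^sup>2))"
    and "31057 / 100000 \<le> (LINT \<xi>|lborel. (norm (fourier_integral profile \<xi>))\<^sup>2 / (9/4 + \<xi>\<^sup>2))"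
proof -
  have e: "probe (5/2) = 0" "probe (- (5/2)) = 0" by (simp_all add: probe_def q_def power2_eq_square)
  have "(0::real) < 9 / 4" "(0::real) \<le> 5 / 2" by simp_all
  note b = resolvent_lower_bound[OF profile_integrable profile_square_integrable this probe_deriv continuous_probe_deriv(1) e]
  show "integrable lborel (\<lambda>\<xi>. (norm (fourier_integral profile \<xi>))\<^sup>2 / (9/4 + \<xi>\<^sup>2))" by (rule b(1))
  show "31057 / 100000 \<le> (LINT \<xi>|lborel. (norm (fourier_integral profile \<xi>))\<^sup>2 / (9/4 + \<xi>\<^sup>2))"
    using b(2) unfolding mass_probe mass_probe_deriv profile_probe by simp
qed

lemma
  fixes g :: "'a::euclidean_space \<Rightarrow> complex" and h :: "'b::euclidean_space \<Rightarrow> complex"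
  assumes g: "integrable lborel g" and h: "integrable lborel h"
  shows integrable_tensor: "integrable lborel (\<lambda>z. g (fst z) * h (snd z))"
    and integral_tensor: "(LINT z|lborel. g (fst z) * h (snd z)) = (LINT x|lborel. g x) * (LINT y|lborel. h y)"
proof -
  have [measurable]: "g \<in> borel_measurable borel" "h \<in> borel_measurable borel" using g h by auto
  have I: "integrable (lborel \<Otimes>\<^sub>M lborel) (case_prod (\<lambda>x y. g x * h y))"
  proof (rule integrable_pair_bound)
    show "integrable lborel (\<lambda>x. norm (g x))" "integrable lborel (\<lambda>x. norm (h x))" using g h by auto
  qed (auto simp: norm_mult)
  have eq: "case_prod (\<lambda>x y. g x * h y) = (\<lambda>z. g (fst z) * h (snd z))" by auto
  show "integrable lborel (\<lambda>z. g (fst z) * h (snd z))"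
    using I by (simp only: eq lborel_prod)
  have "(LINT x|lborel. (LINT y|lborel. g x * h y)) = (LINT z|lborel. g (fst z) * h (snd z))"
    using lborel_pair.integral_fst[OF I] by (simp only: eq lborel_prod)
  then show "(LINT z|lborel. g (fst z) * h (snd z)) = (LINT x|lborel. g x) * (LINT y|lborel. h y)"
    by (simp only: integral_mult_right_zero integral_mult_left_zero)
qed

lemma
  fixes g :: "'a::euclidean_space \<Rightarrow> real" and h :: "'b::euclidean_space \<Rightarrow> real"
  assumes g: "integrable lborel g" and h: "integrable lborel h"
  shows integrable_tensor_real: "integrable lborel (\<lambda>z. g (fst z) * h (snd z))"
    and integral_tensor_real: "(LINT z|lborel. g (fst z) * h (snd z)) = (LINT x|lborel. g x) * (LINT y|lborel. h y)"
proof -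
  have c: "integrable lborel (\<lambda>x. complex_of_real (g x))" "integrable lborel (\<lambda>x. complex_of_real (h x))"
    using g h by auto
  show "integrable lborel (\<lambda>z. g (fst z) * h (snd z))"
    using integrable_tensor[OF c] by (simp flip: of_real_mult add: complex_of_real_integrable_eq)
  have "complex_of_real (LINT z|lborel. g (fst z) * h (snd z)) = of_real ((LINT x|lborel. g x) * (LINT y|lborel. h y))"
    using integral_tensor[OF c] by (simp only: integral_complex_of_real of_real_mult[symmetric])
  then show "(LINT z|lborel. g (fst z) * h (snd z)) = (LINT x|lborel. g x) * (LINT y|lborel. h y)"
    by (simp only: of_real_eq_iff)
qed

lemma borel_measurable_fst_snd [measurable]:
  "(fst :: 'a::euclidean_space \<times> 'b::euclidean_space \<Rightarrow> 'a) \<in> borel_measurable borel"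
  "(snd :: 'a::euclidean_space \<times> 'b::euclidean_space \<Rightarrow> 'b) \<in> borel_measurable borel"
  by (intro borel_measurable_continuous_onI continuous_intros)+

definition trial :: "real \<times> real \<Rightarrow> complex" where
  "trial z = profile (fst z) * profile (snd z)"

lemma fourier_trial: "fourier_integral trial z = fourier_integral profile (fst z) * fourier_integral profile (snd z)"
proof -
  have "(LINT w|lborel. trial w * exp (- \<i> * of_real (w \<bullet> z))) =
     (LINT w|lborel. (profile (fst w) * exp (- \<i> * of_real (fst w \<bullet> fst z))) * (profile (snd w) * exp (- \<i> * of_real (snd w \<bullet> snd z))))"
    by (intro Bochner_Integration.integral_cong refl)
       (simp add: trial_def inner_prod_def distrib_left exp_add[symmetric] exp_diff mult_ac exp_minus field_simps)
  also have "\<dots> = (LINT x|lborel. profile x * exp (- \<i> * of_real (x \<bullet> fst z))) * (LINT x|lborel. profile x * exp (- \<i> * of_real (x \<bullet> snd z)))"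
    by (intro integral_tensor fourier_integrand_integrable profile_integrable)
  finally have *: "(LINT w|lborel. trial w * exp (- \<i> * of_real (w \<bullet> z))) = \<dots>" .
  have "(2 * pi) powr (- real DIM(real \<times> real) / 2) = (2 * pi) powr (- real DIM(real) / 2) * (2 * pi) powr (- real DIM(real) / 2)"
    by (simp flip: powr_add)
  then show ?thesis
    unfolding fourier_integral_def * by (simp add: mult_ac)
qed

lemma
  shows trial_square_integrable: "square_integrable trial"
    and mass_trial: "mass trial = (16 / 15)\<^sup>2"
proof -
  note [measurable] = square_integrable_measurable[OF profile_square_integrable]

  have [measurable]: "trial \<in> borel_measurable borel"
    unfolding trial_def[abs_def] by measurable
  have eq: "(norm (trial z))\<^sup>2 = (norm (profile (fst z)))\<^sup>2 * (norm (profile (snd z)))\<^sup>2" for z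
    by (simp add: trial_def norm_mult power_mult_distrib)
  note i = square_integrable_norm_sq[OF profile_square_integrable]
  show "square_integrable trial"
    unfolding square_integrable_def eq using integrable_tensor_real[OF i i] by simp
  show "mass trial = (16 / 15)\<^sup>2"
    using mass_profile unfolding mass_def eq integral_tensor_real[OF i i]
    by (simp only:) (simp add: power2_eq_square)
qed

lemma trial_support: "z \<notin> {-1<..<1} \<times> {-1<..<1} \<Longrightarrow> trial z = 0"
  by (cases z) (auto simp: trial_def on_ivl_def indicator_def power2_eq_1_iff)

text \<open>The probability density of one frequency variable in the state \<open>profile\<close>.\<close>

definition freq_density :: "real \<Rightarrow> real" where
  "freq_density \<xi> = 15 / 16 * (norm (fourier_integral profile \<xi>))\<^sup>2"

lemma
  shows freq_density_integrable: "integrable lborel freq_density"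
    and freq_density_integral: "(LINT \<xi>|lborel. freq_density \<xi>) = 1"
    and freq_density_nonneg: "freq_density \<xi> \<ge> 0"
    and freq_density_moment_integrable: "integrable lborel (\<lambda>\<xi>. freq_density \<xi> * \<xi>\<^sup>2)"
    and freq_density_moment: "(LINT \<xi>|lborel. freq_density \<xi> * \<xi>\<^sup>2) = 5 / 2"
    and freq_density_resolvent_integrable: "integrable lborel (\<lambda>\<xi>. freq_density \<xi> * (1 / (9/4 + \<xi>\<^sup>2)))"
    and freq_density_resolvent: "2911 / 10000 \<le> (LINT \<xi>|lborel. freq_density \<xi> * (1 / (9/4 + \<xi>\<^sup>2)))"
proof -
  note F = plancherel_square_integrable[OF profile_integrable profile_square_integrable]
  show "integrable lborel freq_density"
    unfolding freq_density_def[abs_def] by (intro integrable_mult_right square_integrable_norm_sq F)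
  show "(LINT \<xi>|lborel. freq_density \<xi>) = 1"
    using plancherel[OF profile_integrable profile_square_integrable] mass_profile
    by (simp add: freq_density_def mass_def)
  show "freq_density \<xi> \<ge> 0" by (simp add: freq_density_def)
  have m: "freq_density \<xi> * \<xi>\<^sup>2 = 15 / 16 * (\<xi>\<^sup>2 * (norm (fourier_integral profile \<xi>))\<^sup>2)" for \<xi>
    by (simp add: freq_density_def)
  show "integrable lborel (\<lambda>\<xi>. freq_density \<xi> * \<xi>\<^sup>2)"
    unfolding m by (intro integrable_mult_right profile_moment_integrable)
  show "(LINT \<xi>|lborel. freq_density \<xi> * \<xi>\<^sup>2) = 5 / 2"
    unfolding m by (simp add: profile_moment)
  have r: "freq_density \<xi> * (1 / (9/4 + \<xi>\<^sup>2)) = 15 / 16 * ((norm (fourier_integral profile \<xi>))\<^sup>2 / (9/4 + \<xi>\<^sup>2))" for \<xi>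
    by (simp add: freq_density_def)
  show "integrable lborel (\<lambda>\<xi>. freq_density \<xi> * (1 / (9/4 + \<xi>\<^sup>2)))"
    unfolding r by (intro integrable_mult_right profile_resolvent)
  show "2911 / 10000 \<le> (LINT \<xi>|lborel. freq_density \<xi> * (1 / (9/4 + \<xi>\<^sup>2)))"
    unfolding r integral_mult_right_zero using profile_resolvent(2) by simp
qed

section \<open>The logarithmic mean of the trial function\<close>

text \<open>This is \<open>ln_le_radau\<close> at \<open>y = 2 (1 + \<xi>\<^sup>2) / 5\<close>. The scale \<open>5/2\<close> makes the leading term of the final bound
  \<open>2 ln (5/2) - ln 2 = ln (25/8)\<close>, just below \<open>ln \<pi>\<close>, and its pole produces the resolvent at \<open>9/4\<close>.\<close>

definition log_majorant :: "real \<Rightarrow> real" where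
  "log_majorant \<xi> = ln (5/2) + 39 / 40 + 1 / 10 * \<xi>\<^sup>2 - 135 / 32 * (1 / (9/4 + \<xi>\<^sup>2))"

lemma log_majorant: "ln (1 + \<xi>\<^sup>2) \<le> log_majorant \<xi>"
proof -
  define y where "y = 2 * (1 + \<xi>\<^sup>2) / 5"
  have p: "1 + \<xi>\<^sup>2 > 0" by (intro add_pos_nonneg) auto
  then have y: "y > 0" by (simp add: y_def)
  have "1 + \<xi>\<^sup>2 = 5/2 * y" by (simp add: y_def field_simps)
  then have "ln (1 + \<xi>\<^sup>2) = ln (5/2 * y)" by (simp only:)
  also have "\<dots> = ln (5/2) + ln y" using y by (intro ln_mult_pos) auto
  also have "ln y \<le> (y - 1) / 4 + 9 / 8 - 27 / (8 * (1 + 2 * y))" by (rule ln_le_radau[OF y])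
  also have "8 * (1 + 2 * y) = 32 / 5 * (9/4 + \<xi>\<^sup>2)" by (simp add: y_def field_simps)
  also have "(y - 1) / 4 + 9 / 8 - 27 / (32 / 5 * (9/4 + \<xi>\<^sup>2)) = 39 / 40 + 1 / 10 * \<xi>\<^sup>2 - 135 / 32 * (1 / (9/4 + \<xi>\<^sup>2))"
  proof -
    have "27 / (32 / 5 * D) = 135 / 32 * (1 / D)" for D :: real by simp
    moreover have "(y - 1) / 4 + 9 / 8 = 39 / 40 + 1 / 10 * \<xi>\<^sup>2" by (simp add: y_def field_simps)
    ultimately show ?thesis by (simp only:)
  qed
  finally show ?thesis by (simp add: log_majorant_def)
qed

lemma
  shows log_majorant_integrable: "integrable lborel (\<lambda>\<xi>. freq_density \<xi> * log_majorant \<xi>)"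
    and log_majorant_integral: "(LINT \<xi>|lborel. freq_density \<xi> * log_majorant \<xi>) \<le> ln (5/2) - 3 / 1000"
proof -
  have eq: "freq_density \<xi> * log_majorant \<xi> = (ln (5/2) + 39 / 40) * freq_density \<xi> + 1 / 10 * (freq_density \<xi> * \<xi>\<^sup>2)
      - 135 / 32 * (freq_density \<xi> * (1 / (9/4 + \<xi>\<^sup>2)))" for \<xi>
    by (simp add: log_majorant_def algebra_simps)
  note i = freq_density_integrable freq_density_moment_integrable freq_density_resolvent_integrable
  show "integrable lborel (\<lambda>\<xi>. freq_density \<xi> * log_majorant \<xi>)"
    unfolding eq by (intro Bochner_Integration.integrable_add Bochner_Integration.integrable_diff integrable_mult_right i)
  have "(LINT \<xi>|lborel. freq_density \<xi> * log_majorant \<xi>) = (ln (5/2) + 39 / 40) * (LINT \<xi>|lborel. freq_density \<xi>)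
     + 1 / 10 * (LINT \<xi>|lborel. freq_density \<xi> * \<xi>\<^sup>2) - 135 / 32 * (LINT \<xi>|lborel. freq_density \<xi> * (1 / (9/4 + \<xi>\<^sup>2)))"
    unfolding eq
    by (subst Bochner_Integration.integral_diff Bochner_Integration.integral_add;
        (intro Bochner_Integration.integrable_add integrable_mult_right i)?)+
       (simp only: integral_mult_right_zero)
  then show "(LINT \<xi>|lborel. freq_density \<xi> * log_majorant \<xi>) \<le> ln (5/2) - 3 / 1000"
    using freq_density_resolvent unfolding freq_density_integral freq_density_moment by simp
qed

text \<open>Tangent line of the logarithm at \<open>m = (1 + a\<^sup>2) (1 + b\<^sup>2) / 2\<close>. This product form of \<open>m\<close> lets the
  mean over the product density factor, and the constant \<open>1/2\<close> is the scale for which the term \<open>4 A (1 - A)\<close>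
  in that mean is at most \<open>1\<close>.\<close>

lemma ln_sum_squares_le:
  fixes a b :: real
  defines "A \<equiv> 1 / (1 + a\<^sup>2)" and "B \<equiv> 1 / (1 + b\<^sup>2)"
  shows "ln (a\<^sup>2 + b\<^sup>2 + 1 / 1000) \<le>
    log_majorant a + log_majorant b + 2 * (A + B - 2 * A * B) + (2 / 1000 - 1 - ln 2)"
proof -
  have pa: "1 + a\<^sup>2 > 0" and pb: "1 + b\<^sup>2 > 0" by (intro add_pos_nonneg; simp)+
  define m where "m = (1 + a\<^sup>2) * (1 + b\<^sup>2) / 2"
  define y where "y = a\<^sup>2 + b\<^sup>2 + 1 / 1000"
  have m: "m > 0" using pa pb by (simp add: m_def)
  have y: "y > 0" unfolding y_def by (intro add_nonneg_pos) auto
  have "ln y = ln m + ln (y / m)" using m y by (simp add: ln_div)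
  also have "ln (y / m) \<le> y / m - 1" using m y by (intro ln_le_minus_one) auto
  also have "ln m = ln (1 + a\<^sup>2) + ln (1 + b\<^sup>2) - ln 2"
    using pa pb by (simp add: m_def ln_div ln_mult)
  also have "y / m = 2 * (a\<^sup>2 * A * B + b\<^sup>2 * A * B) + 2 / 1000 * (A * B)"
  proof -
    have "1 / m = 2 * (A * B)" by (simp add: m_def A_def B_def)
    then have "y / m = y * (2 * (A * B))" by (simp add: divide_inverse)
    then show ?thesis by (simp add: y_def algebra_simps)
  qed
  also have "a\<^sup>2 * A = 1 - A" using pa by (simp add: A_def field_simps)
  also have "b\<^sup>2 * A * B = A * (1 - B)" using pb by (simp add: B_def field_simps)
  finally have "ln y \<le> (ln (1 + a\<^sup>2) + ln (1 + b\<^sup>2) - ln 2) + (2 * ((1 - A) * B + A * (1 - B)) + 2 / 1000 * (A * B) - 1)"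
    by simp
  moreover have "A * B \<le> 1"
  proof -
    have "A \<le> 1" "B \<le> 1" "0 \<le> A" "0 \<le> B" using pa pb by (auto simp: A_def B_def)
    then show ?thesis using mult_mono[of A 1 B 1] by simp
  qed
  ultimately show ?thesis
    using log_majorant[of a] log_majorant[of b] unfolding y_def by (simp add: algebra_simps)
qed

text \<open>For independent \<open>a\<close> and \<open>b\<close> with density \<open>freq_density\<close>, the mean of the majorant in \<open>ln_sum_squares_le\<close> is
  \<open>2 \<Lambda> + 4 A (1 - A) + 2/1000 - 1 - ln 2\<close>, where \<open>\<Lambda>\<close> and \<open>A\<close> are the means of \<open>log_majorant\<close> and of
  \<open>1 / (1 + \<xi>\<^sup>2)\<close>. The only information about \<open>A\<close> that enters is \<open>4 A (1 - A) \<le> 1\<close>,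
  and \<open>\<Lambda> \<le> ln (5/2) - 3/1000\<close> leaves room for the regularization \<open>1/1000\<close>.\<close>

theorem trial_energy:
  obtains s where "0 < s" "s < 1" "square_integrable (weighted_ft (2 * s) trial)"
    "energy (2 * s) trial < pi powr s * mass trial"
proof -
  let ?r = "freq_density"
  let ?A = "\<lambda>\<xi>. 1 / (1 + \<xi>\<^sup>2 :: real)"
  define A where "A = (LINT \<xi>|lborel. ?r \<xi> * ?A \<xi>)"
  define \<Lambda> where "\<Lambda> = (LINT \<xi>|lborel. ?r \<xi> * log_majorant \<xi>)"
  define p where "p z = ?r (fst z) * ?r (snd z)" for z
  \<comment> \<open>The shift by \<open>1/1000\<close> keeps \<open>ln y\<close> bounded below, as \<open>exists_small_power\<close> requires.\<close>
  define y where "y z = (fst z)\<^sup>2 + (snd z)\<^sup>2 + 1 / 1000" for z :: "real \<times> real"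
  define r where "r z = log_majorant (fst z) + log_majorant (snd z) + 2 * (?A (fst z) + ?A (snd z) - 2 * ?A (fst z) * ?A (snd z))
      + (2 / 1000 - 1 - ln 2)" for z
  have [measurable]: "freq_density \<in> borel_measurable borel"
    using freq_density_integrable by auto
  have A1: "?A \<xi> \<le> 1" "?A \<xi> \<ge> 0" for \<xi>
  proof -
    have "1 + \<xi>\<^sup>2 > 0" by (intro add_pos_nonneg) auto
    then show "?A \<xi> \<le> 1" "?A \<xi> \<ge> 0" by auto
  qed
  have iA: "integrable lborel (\<lambda>\<xi>. ?r \<xi> * ?A \<xi>)"
  proof (rule Bochner_Integration.integrable_bound[OF freq_density_integrable])
    show "AE \<xi> in lborel. norm (?r \<xi> * ?A \<xi>) \<le> norm (?r \<xi>)"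
      using A1 freq_density_nonneg by (intro AE_I2) (simp only: real_norm_def abs_mult abs_of_nonneg mult_left_le)
  qed measurable
  note i0 = freq_density_integrable and i2 = freq_density_moment_integrable and iL = log_majorant_integrable
  note I = integrable_tensor_real[OF i0 i0] integrable_tensor_real[OF iL i0] integrable_tensor_real[OF i0 iL]
    integrable_tensor_real[OF iA i0] integrable_tensor_real[OF i0 iA] integrable_tensor_real[OF iA iA]
  have pr: "p z * r z = (2 / 1000 - 1 - ln 2) * (?r (fst z) * ?r (snd z)) +
      ((?r (fst z) * log_majorant (fst z)) * ?r (snd z) + ?r (fst z) * (?r (snd z) * log_majorant (snd z))) +
      2 * ((?r (fst z) * ?A (fst z)) * ?r (snd z) + ?r (fst z) * (?r (snd z) * ?A (snd z))) -
      4 * ((?r (fst z) * ?A (fst z)) * (?r (snd z) * ?A (snd z)))" for z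
  proof -
    define a where "a = ?A (fst z)"
    define b where "b = ?A (snd z)"
    show ?thesis unfolding p_def r_def a_def[symmetric] b_def[symmetric] by (simp add: algebra_simps)
  qed
  have "integrable lborel p" "(LINT z|lborel. p z) = 1"
    unfolding p_def[abs_def] integral_tensor_real[OF i0 i0] freq_density_integral by (auto intro: I)
  moreover have "p z \<ge> 0" for z by (simp add: p_def freq_density_nonneg)
  moreover have "y \<in> borel_measurable borel" unfolding y_def[abs_def] by measurable
  moreover have "y z \<ge> 1 / 1000" for z by (simp add: y_def)
  moreover have "(1 / 1000 :: real) > 0" by simp
  moreover have "integrable lborel (\<lambda>z. p z * y z)"
  proof -
    have "p z * y z = (?r (fst z) * (fst z)\<^sup>2) * ?r (snd z) + ?r (fst z) * (?r (snd z) * (snd z)\<^sup>2) + 1 / 1000 * (?r (fst z) * ?r (snd z))" for z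
      by (simp add: p_def y_def algebra_simps)
    then show ?thesis
      by (simp only:) (intro Bochner_Integration.integrable_add integrable_mult_right integrable_tensor_real i0 i2)
  qed
  moreover have "integrable lborel (\<lambda>z. p z * r z)"
    unfolding pr by (intro Bochner_Integration.integrable_add Bochner_Integration.integrable_diff integrable_mult_right I)
  moreover have "ln (y z) \<le> r z" for z
    unfolding y_def r_def by (rule ln_sum_squares_le)
  moreover have "(LINT z|lborel. p z * r z) < ln pi"
  proof -
    have "(LINT z|lborel. p z * r z) = (2 / 1000 - 1 - ln 2) + 2 * \<Lambda> + (4 * A - 4 * (A * A))"
    proof -
      have "(LINT z|lborel. p z * r z) = (2 / 1000 - 1 - ln 2) * (1 * 1) + (\<Lambda> * 1 + 1 * \<Lambda>) + 2 * (A * 1 + 1 * A) - 4 * (A * A)"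
        unfolding pr
        apply (subst Bochner_Integration.integral_diff, (intro Bochner_Integration.integrable_add integrable_mult_right I)+)
        apply (subst Bochner_Integration.integral_add, (intro Bochner_Integration.integrable_add integrable_mult_right I)+)
        apply (subst Bochner_Integration.integral_add, (intro Bochner_Integration.integrable_add integrable_mult_right I)+)
        unfolding integral_mult_right_zero
        apply (subst Bochner_Integration.integral_add, (rule I)+)
        apply (subst Bochner_Integration.integral_add, (rule I)+)
        unfolding integral_tensor_real[OF i0 i0] integral_tensor_real[OF iL i0] integral_tensor_real[OF i0 iL]
          integral_tensor_real[OF iA i0] integral_tensor_real[OF i0 iA] integral_tensor_real[OF iA iA]
          freq_density_integral A_def[symmetric] \<Lambda>_def[symmetric]
        by simp
      then show ?thesis by simp
    qed
    also have "4 * A - 4 * (A * A) \<le> 1"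
    proof -
      have "0 \<le> (2 * A - 1)\<^sup>2" by simp
      then show ?thesis by (simp add: power2_eq_square algebra_simps)
    qed
    also have "\<Lambda> \<le> ln (5/2) - 3 / 1000" unfolding \<Lambda>_def by (rule log_majorant_integral)
    finally have "(LINT z|lborel. p z * r z) \<le> 2 * ln (5/2) - ln 2" by simp
    also have "\<dots> = ln (25 / 8 :: real)"
    proof -
      have "ln (25 / 8 :: real) = ln ((5/2) * (5/2) / 2)" by simp
      also have "\<dots> = 2 * ln (5/2) - ln 2" by (simp only: ln_div ln_mult) simp
      finally show ?thesis by simp
    qed
    also have "\<dots> < ln pi" using pi_approx(1) by simp
    finally show ?thesis .
  qed
  ultimately obtain s where s: "0 < s" "s < 1" and ips: "integrable lborel (\<lambda>z. p z * y z powr s)"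
    and lt: "(LINT z|lborel. p z * y z powr s) < pi powr s"
    using exists_small_power[of p y "1 / 1000" r pi] pi_gt_zero by blast
  have tm [measurable]: "trial \<in> borel_measurable borel"
    by (rule square_integrable_measurable[OF trial_square_integrable])
  have wle: "(norm (weighted_ft (2 * s) trial z))\<^sup>2 \<le> (16 / 15)\<^sup>2 * (p z * y z powr s)" for z
  proof -
    have "norm z powr (2 * s) = ((norm z)\<^sup>2) powr s"
      by (cases "z = 0") (auto simp: powr_powr simp flip: powr_numeral)
    also have "(norm z)\<^sup>2 = (fst z)\<^sup>2 + (snd z)\<^sup>2"
      by (simp add: norm_prod_def)
    also have "((fst z)\<^sup>2 + (snd z)\<^sup>2) powr s \<le> y z powr s"
      using s by (intro powr_mono2) (auto simp: y_def)
    finally have 1: "norm z powr (2 * s) \<le> y z powr s" .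
    have 2: "(norm (fourier_integral trial z))\<^sup>2 = (16 / 15)\<^sup>2 * p z"
      by (simp add: fourier_trial p_def freq_density_def norm_mult power_mult_distrib power_divide)
    have "(norm (weighted_ft (2 * s) trial z))\<^sup>2 \<le> y z powr s * (norm (fourier_integral trial z))\<^sup>2"
      unfolding norm_weighted_ft by (intro mult_right_mono 1) simp
    then show ?thesis unfolding 2 by (simp add: mult_ac)
  qed
  have wi: "integrable lborel (\<lambda>z. (norm (weighted_ft (2 * s) trial z))\<^sup>2)"
  proof (rule Bochner_Integration.integrable_bound[OF integrable_mult_right[OF ips, of "(16 / 15)\<^sup>2"]])
    show "AE z in lborel. norm ((norm (weighted_ft (2 * s) trial z))\<^sup>2) \<le> norm ((16 / 15)\<^sup>2 * (p z * y z powr s))"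
      using wle by (intro AE_I2) (simp add: order_trans[OF _ abs_ge_self])
  qed measurable
  show thesis
  proof
    show "0 < s" "s < 1" by (rule s)+
    show "square_integrable (weighted_ft (2 * s) trial)"
      using wi weighted_ft_measurable[OF tm, of "2 * s"] by (simp add: square_integrable_def)
    have "energy (2 * s) trial \<le> (LINT z|lborel. (16 / 15)\<^sup>2 * (p z * y z powr s))"
      unfolding mass_def by (intro integral_mono wi integrable_mult_right ips wle)
    also have "\<dots> < (16 / 15)\<^sup>2 * pi powr s"
      unfolding integral_mult_right_zero by (intro mult_strict_left_mono lt) simp
    finally show "energy (2 * s) trial < pi powr s * mass trial"
      unfolding mass_trial by (simp add: mult.commute)
  qed
qed

text \<open>The witness is \<open>\<alpha> = 2 s\<close>, and the violated inequality is the one for \<open>n = 1\<close>.\<close>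

theorem mainTheorem3:
  fixes \<Omega> :: "(real \<times> real) set"
  assumes "\<Omega> = {-1<..<1} \<times> {-1<..<1}"
  shows "\<exists>\<alpha>::real. 0 < \<alpha> \<and> \<alpha> < 2 \<and>
           \<not> (\<forall>n::nat. n \<ge> 1 \<longrightarrow>
                 frac_laplacian_eigenvalue \<Omega> \<alpha> n \<ge> (real n * pi) powr (\<alpha> / 2))"
proof -
  obtain s where s: "0 < s" "s < 1" and sq: "square_integrable (weighted_ft (2 * s) trial)"
    and lt: "energy (2 * s) trial < pi powr s * mass trial"
    by (rule trial_energy)
  have \<Omega>: "\<Omega> \<subseteq> ball 0 2"
  proof
    fix z assume "z \<in> \<Omega>"
    then have "\<bar>fst z\<bar> < 1" "\<bar>snd z\<bar> < 1" using assms by auto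
    then have "norm z < 2" using norm_Pair_le[of "fst z" "snd z"] by simp
    then show "z \<in> ball 0 2" by simp
  qed
  have "AE z in lborel. z \<notin> \<Omega> \<longrightarrow> trial z = 0"
    unfolding assms using trial_support by auto
  then have dom: "trial \<in> form_domain (2 * s) \<Omega>"
    unfolding form_domain_def using trial_square_integrable sq by blast
  have m: "mass trial > 0" by (simp add: mass_trial)
  have "frac_laplacian_eigenvalue \<Omega> (2 * s) 1 * mass trial \<le> energy (2 * s) trial"
    using s by (intro first_eigenvalue_le[OF \<Omega>] dom m) auto
  also note lt
  finally have "frac_laplacian_eigenvalue \<Omega> (2 * s) 1 < pi powr s"
    using m by simp
  then show ?thesis
    using s by (intro exI[of _ "2 * s"]) (auto intro!: exI[of _ 1])
qed

end
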